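(* Assume the Small Set Expansion Hypothesis (SSEH). Let $r \geq 1$ and let $\psi:\{0,1\}^r \to \{0,1\}$ be a predicate. Then $\psi$ is bias independent if and only if $\mathcal{M}_\psi \subseteq \mathcal{S}_{\leq 1}$, where $\mathcal{S}_{\leq 1}$ is the set of strings in $\{0,1\}^r$ of Hamming weight at most $1$.
   Context: A $\mu$-biased CSP instance $\Psi(V,E,w,\mu,\psi)$ with predicate $\psi:\{0,1\}^r\to\{0,1\}$ consists of a vertex set $V=[n]$, a multiset $E$ of ordered $r$-tuples of vertices (constraints), and nonnegative vertex weights $w:V\to\mathbb{R}_{\geq 0}$. For a labeling $\sigma:V\to\{0,1\}$, its relative weight is $\sum_{i:\sigma(i)=1}w(i)/\sum_{i\in V}w(i)$, and its value is ${\sf Val}_\sigma(\Psi)=\Pr_{e\sim E}[\psi(\sigma(e))=1]$ ($e$ uniform in $E$, $\sigma$ applied coordinatewise). ${\sf Val}_{\leq\mu}(\Psi)$ is the maximum value over labelings of relative weight at most $\mu$. $\alpha_{\leq\mu}(\psi)$ denotes the best approximation factor achievable by polynomial-time algorithms for $\mu$-biased vertex-weighted instances with predicate $\psi$ (the paper's convention: the algorithm may output a labeling of relative weight at most $\mu(1+\eta)$ for an arbitrary fixed constant $\eta>0$, and its value is compared with ${\sf Val}_{\leq\mu}(\Psi)$). The predicate $\psi$ is bias dependent if $\inf_{\mu\in(0,1/2)}\alpha_{\leq\mu}(\psi)=0$, and bias independent if $\inf_{\mu\in(0,1/2)}\alpha_{\leq\mu}(\psi)=c_\psi$ for some constant $c_\psi>0$.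 $\mathcal{M}_\psi$ is the set of minimal elements of $\psi^{-1}(1)$ under the partial order $x\preceq y \iff {\rm supp}(x)\subseteq{\rm supp}(y)$ (strings viewed as indicator vectors of subsets of $[r]$). SSEH: for a regular graph $G=(V,E)$ and $S\subseteq V$, let ${\sf Vol}(S)$ be the stationary (uniform) measure of $S$ and $\phi_G(S)=\Pr_{(i,j)\sim E}[i\in S,j\notin S]/\min\{{\sf Vol}(S),{\sf Vol}(S^c)\}$; the hypothesis states that for every $\epsilon\in(0,1)$ and $M\in[1,1/\sqrt{\epsilon}]$ there is $\delta=\delta(\epsilon,M)$ such that it is NP-hard, given a regular graph $G$, to distinguish between (YES) some $S$ with ${\sf Vol}(S)=\delta$ has $\phi_G(S)\leq\epsilon$, and (NO) every $S$ with ${\sf Vol}(S)\in[\delta/M,M\delta]$ has $\phi_G(S)\geq 1-\epsilon$.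
   Formalization: P ≠ NP is assumed explicitly; the vertices within each constraint tuple are pairwise distinct (with repetitions ψ accepting exactly 100 and 111 is a counterexample); weights are nonnegative rationals with positive sum, and there is at least one constraint. *)

theory Defs
  imports Complex_Main "HOL-Computational_Algebra.Polynomial"
begin

section \<open>Polynomial-time computation and NP-hardness\<close>

text \<open>
  Deterministic single-tape Turing machines with a two-way infinite tape. States and tape symbols
  are initial segments of the naturals. State 0 is the start state and state 1 the halting state;
  symbol 0 is the blank, and symbols 1 and 2 represent the bits 0 and 1.
\<close>

record tm =
  num_states :: nat
  num_symbols :: nat
  delta :: "nat \<Rightarrow> nat \<Rightarrow> nat \<times> nat \<times> int"

definition wf_tm :: "tm \<Rightarrow> bool" where
  "wf_tm M \<longleftrightarrow> num_states M \<ge> 2 \<and> num_symbols M \<ge> 3 \<and>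
     (\<forall>q < num_states M. \<forall>s < num_symbols M.
        case delta M q s of (q', s', d) \<Rightarrow>
          q' < num_states M \<and> s' < num_symbols M \<and> d \<in> {-1, 0, 1})"

type_synonym config = "nat \<times> (int \<Rightarrow> nat) \<times> int"

fun tm_step :: "tm \<Rightarrow> config \<Rightarrow> config" where
  "tm_step M (q, t, h) =
     (if q = 1 then (q, t, h)
      else case delta M q (t h) of (q', s', d) \<Rightarrow> (q', t(h := s'), h + d))"

definition bit_symbol :: "bool \<Rightarrow> nat" where
  "bit_symbol b = (if b then 2 else 1)"

definition initial_config :: "bool list \<Rightarrow> config" where
  "initial_config x =
     (0, (\<lambda>i. if 0 \<le> i \<and> nat i < length x then bit_symbol (x ! nat i) else 0), 0)"

text \<open>The output is the bit string that starts in cell 0 and ends before the first blank.\<close>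

definition halts_with :: "config \<Rightarrow> bool list \<Rightarrow> bool" where
  "halts_with c y \<longleftrightarrow> (case c of (q, t, h) \<Rightarrow>
     q = 1 \<and> (\<forall>i < length y. t (int i) = bit_symbol (y ! i)) \<and> t (int (length y)) = 0)"

definition poly_time :: "(bool list \<Rightarrow> bool list) \<Rightarrow> bool" where
  "poly_time f \<longleftrightarrow> (\<exists>M (p :: nat poly). wf_tm M \<and>
     (\<forall>x. \<exists>t \<le> poly p (length x). halts_with ((tm_step M ^^ t) (initial_config x)) (f x)))"

definition class_P :: "bool list set set" where
  "class_P = {L. poly_time (\<lambda>x. [x \<in> L])}"

text \<open>A prefix-free encoding of bit strings: every bit is doubled, and 01 marks the end.\<close>

definition delimit :: "bool list \<Rightarrow> bool list" where
  "delimit x = concat (map (\<lambda>b. [b, b]) x) @ [False, True]"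

definition class_NP :: "bool list set set" where
  "class_NP = {L. \<exists>V \<in> class_P. \<exists>p :: nat poly.
     \<forall>x. x \<in> L \<longleftrightarrow> (\<exists>y. length y \<le> poly p (length x) \<and> delimit x @ y \<in> V)}"

text \<open>NP-hardness, under polynomial-time many-one reductions, of the promise problem of
  distinguishing the strings in \<open>Yes\<close> from the strings in \<open>No\<close>.\<close>

definition np_hard_promise :: "bool list set \<Rightarrow> bool list set \<Rightarrow> bool" where
  "np_hard_promise Yes No \<longleftrightarrow>
     (\<forall>L \<in> class_NP. \<exists>f. poly_time f \<and>
        (\<forall>x. (x \<in> L \<longrightarrow> f x \<in> Yes) \<and> (x \<notin> L \<longrightarrow> f x \<in> No)))"


section \<open>The Small Set Expansion Hypothesis\<close>

text \<open>Graphs on the vertex set \<open>{..<n}\<close>; an undirected edge is stored in both orientations, so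
  that a uniform element of \<open>E\<close> is a uniformly random edge with a random orientation.\<close>

definition regular_graph :: "nat \<Rightarrow> nat rel \<Rightarrow> bool" where
  "regular_graph n E \<longleftrightarrow> n \<ge> 1 \<and> E \<subseteq> {..<n} \<times> {..<n} \<and> sym E \<and> irrefl E \<and>
     (\<exists>d \<ge> 1. \<forall>i < n. card (E `` {i}) = d)"

definition vol :: "nat \<Rightarrow> nat set \<Rightarrow> real" where
  "vol n S = real (card S) / real n"

definition expansion :: "nat \<Rightarrow> nat rel \<Rightarrow> nat set \<Rightarrow> real" where
  "expansion n E S =
     (real (card {(i, j) \<in> E. i \<in> S \<and> j \<notin> S}) / real (card E)) /
     min (vol n S) (vol n ({..<n} - S))"

text \<open>Row-major adjacency matrix.\<close>

definition encode_graph :: "nat \<Rightarrow> nat rel \<Rightarrow> bool list" where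
  "encode_graph n E = map (\<lambda>k. (k div n, k mod n) \<in> E) [0..<n * n]"

definition sse_yes :: "real \<Rightarrow> real \<Rightarrow> bool list set" where
  "sse_yes \<epsilon> \<delta> = {encode_graph n E | n E. regular_graph n E \<and>
     (\<exists>S \<subseteq> {..<n}. vol n S = \<delta> \<and> expansion n E S \<le> \<epsilon>)}"

definition sse_no :: "real \<Rightarrow> real \<Rightarrow> real \<Rightarrow> bool list set" where
  "sse_no \<epsilon> M \<delta> = {encode_graph n E | n E. regular_graph n E \<and>
     (\<forall>S \<subseteq> {..<n}. vol n S \<in> {\<delta> / M..M * \<delta>} \<longrightarrow> expansion n E S \<ge> 1 - \<epsilon>)}"

definition SSEH :: bool where
  "SSEH \<longleftrightarrow> (\<forall>\<epsilon> \<in> {0<..<1}. \<forall>M \<in> {1..1 / sqrt \<epsilon>}.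
     \<exists>\<delta> \<in> {0<..<1}. np_hard_promise (sse_yes \<epsilon> \<delta>) (sse_no \<epsilon> M \<delta>))"


section \<open>Biased constraint satisfaction problems\<close>

text \<open>
  An element of the cube \<open>{0,1}^r\<close> is a list of \<open>r\<close> booleans, and a predicate on the cube is a
  function on boolean lists of which only the values on lists of length \<open>r\<close> are ever used.

  The vertex set of an instance is \<open>{..<num_vertices}\<close>. The multiset of constraints is presented as
  a list, and the weights are rational, so that instances are finite objects. The entries of a
  constraint are pairwise distinct. This matters: with repeated vertices, the predicate
  accepting exactly 100 and 111 would express the conjunction of two vertices \<open>i\<close>, \<open>j\<close> by the
  tuple \<open>(i, i, j)\<close>, although its only minimal accepted string is 100.
\<close>

record csp =
  num_vertices :: nat
  constraints :: "nat list list"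
  weight :: "nat \<Rightarrow> rat"

definition csp_instance :: "nat \<Rightarrow> csp \<Rightarrow> bool" where
  "csp_instance r \<Psi> \<longleftrightarrow>
     constraints \<Psi> \<noteq> [] \<and>
     (\<forall>e \<in> set (constraints \<Psi>). length e = r \<and> distinct e \<and> set e \<subseteq> {..<num_vertices \<Psi>}) \<and>
     (\<forall>i < num_vertices \<Psi>. weight \<Psi> i \<ge> 0) \<and>
     (\<Sum>i < num_vertices \<Psi>. weight \<Psi> i) > 0"

definition labelings :: "csp \<Rightarrow> bool list set" where
  "labelings \<Psi> = {\<sigma>. length \<sigma> = num_vertices \<Psi>}"

definition relative_weight :: "csp \<Rightarrow> bool list \<Rightarrow> real" where
  "relative_weight \<Psi> \<sigma> =
     (\<Sum>i | i < num_vertices \<Psi> \<and> \<sigma> ! i. of_rat (weight \<Psi> i)) /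
     (\<Sum>i < num_vertices \<Psi>. of_rat (weight \<Psi> i))"

definition labeling_value :: "(bool list \<Rightarrow> bool) \<Rightarrow> csp \<Rightarrow> bool list \<Rightarrow> real" where
  "labeling_value \<psi> \<Psi> \<sigma> =
     real (length (filter (\<lambda>e. \<psi> (map (\<lambda>i. \<sigma> ! i) e)) (constraints \<Psi>))) /
     real (length (constraints \<Psi>))"

definition biased_value :: "(bool list \<Rightarrow> bool) \<Rightarrow> real \<Rightarrow> csp \<Rightarrow> real" where
  "biased_value \<psi> \<mu> \<Psi> =
     Max {labeling_value \<psi> \<Psi> \<sigma> | \<sigma>. \<sigma> \<in> labelings \<Psi> \<and> relative_weight \<Psi> \<sigma> \<le> \<mu>}"

text \<open>Binary representation, least significant bit first.\<close>

fun binary :: "nat \<Rightarrow> bool list" where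
  "binary n = (if n = 0 then [] else odd n # binary (n div 2))"

declare binary.simps [simp del]

definition encode_nat :: "nat \<Rightarrow> bool list" where
  "encode_nat n = delimit (binary n)"

text \<open>For nonnegative rationals only.\<close>

definition encode_rat :: "rat \<Rightarrow> bool list" where
  "encode_rat q =
     encode_nat (nat (fst (quotient_of q))) @ encode_nat (nat (snd (quotient_of q)))"

definition encode_csp :: "csp \<Rightarrow> bool list" where
  "encode_csp \<Psi> =
     encode_nat (num_vertices \<Psi>) @
     concat (map (\<lambda>i. encode_rat (weight \<Psi> i)) [0..<num_vertices \<Psi>]) @
     encode_nat (length (constraints \<Psi>)) @
     concat (map (\<lambda>e. concat (map encode_nat e)) (constraints \<Psi>))"

text \<open>The factor \<open>a\<close> is achievable if for every constant \<open>\<eta> > 0\<close> some polynomial-time algorithm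
  achieves it with labelings of relative weight at most \<open>\<mu> (1 + \<eta>)\<close>. The algorithm may
  depend on \<open>r\<close>, \<open>\<psi>\<close>, \<open>\<mu>\<close> and \<open>\<eta>\<close>.\<close>

definition achievable_factor :: "nat \<Rightarrow> (bool list \<Rightarrow> bool) \<Rightarrow> real \<Rightarrow> real \<Rightarrow> bool" where
  "achievable_factor r \<psi> \<mu> a \<longleftrightarrow>
     (\<forall>\<eta> > 0. \<exists>f. poly_time f \<and>
        (\<forall>\<Psi>. csp_instance r \<Psi> \<longrightarrow>
           f (encode_csp \<Psi>) \<in> labelings \<Psi> \<and>
           relative_weight \<Psi> (f (encode_csp \<Psi>)) \<le> \<mu> * (1 + \<eta>) \<and>
           labeling_value \<psi> \<Psi> (f (encode_csp \<Psi>)) \<ge> a * biased_value \<psi> \<mu> \<Psi>))"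

text \<open>Approximation factors lie in \<open>[0,1]\<close>; without the bound the supremum would not exist
  for a predicate that is never satisfied.\<close>

definition approx_factor :: "nat \<Rightarrow> (bool list \<Rightarrow> bool) \<Rightarrow> real \<Rightarrow> real" where
  "approx_factor r \<psi> \<mu> = Sup {a \<in> {0..1}. achievable_factor r \<psi> \<mu> a}"

definition bias_independent :: "nat \<Rightarrow> (bool list \<Rightarrow> bool) \<Rightarrow> bool" where
  "bias_independent r \<psi> \<longleftrightarrow>
     (\<exists>c > 0. (INF \<mu> \<in> {0<..<1 / 2}. approx_factor r \<psi> \<mu>) = c)"

definition supp :: "bool list \<Rightarrow> nat set" where
  "supp x = {i. i < length x \<and> x ! i}"

definition minimal_accepted :: "nat \<Rightarrow> (bool list \<Rightarrow> bool) \<Rightarrow> bool list set" where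
  "minimal_accepted r \<psi> = {x. length x = r \<and> \<psi> x \<and>
     (\<forall>y. length y = r \<and> \<psi> y \<and> supp y \<subseteq> supp x \<longrightarrow> y = x)}"

definition weight_at_most_one :: "nat \<Rightarrow> bool list set" where
  "weight_at_most_one r = {x. length x = r \<and> card (supp x) \<le> 1}"

end

theory Submission
  imports Defs
begin

text \<open>
  Suppose that some minimal accepted string has two ones. Then constraints whose other support
  positions hold vertices of weight 0, and whose positions off the support hold vertices that exceed the
  budget, express the conjunction of two vertices, so the value counts the edges of a graph inside a set
  of bounded volume. In the YES case of SSEH this can be a fraction \<open>(1 - \<epsilon>) \<delta>\<close>, in the NO case it
  is at most \<open>\<delta> / M\<close>, and \<open>M\<close> is arbitrary.

  Conversely, suppose that all minimal accepted strings have weight 1, in the positions \<open>I\<close>. A satisfied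
  constraint has a chosen vertex in a position of \<open>I\<close>. Up to a factor \<open>r\<close>, the number of such
  constraints is the sum of the degrees of the chosen vertices, which a greedy knapsack algorithm
  maximizes. A greedy colouring with \<open>2 r\<close> colours then splits the chosen set into parts one of which
  meets many constraints in exactly one vertex, so that they are satisfied by a string of weight 1.

  Polynomial time is handled by a calculus of functions on types with an encoding by binary trees. It is
  closed under composition and under iterations with intermediate results of polynomial size, and it agrees
  with Turing machines on bit strings; a small stack language mediates between the two.
\<close>

section \<open>A stack language on Turing machines\<close>


text \<open>SSEH asserts only NP-hardness, so the first half derives
  \<open>class_NP \<subseteq> class_P\<close>, against the assumption that the classes differ. The
  hypothesis does not say that \<delta> is small. If \<delta> is at least 1/4, there are only
  finitely many NO instances and a table decides the language. Otherwise the NO window reaches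
  beyond 2\<delta>, which tolerates an algorithm that overshoots the bias by the factor 2 (slack
  \<eta> = 1). For \<epsilon> = 1/k^2 the largest admissible M is k, and the YES and NO values
  differ by a factor of order k, so a large k refutes any constant factor. In the second half the
  slack leaves room for a rational bias between \<mu> and \<mu>(1 + \<eta>), so that the algorithm
  compares integers only. Its factor 1/(4r + 1) is free of \<mu>: the conflicts number at most r
  times the degree sum, so 2r colours keep at most half the degree sum in monochromatic conflicts,
  and the best of the 2r classes satisfies at least 1/(4r) of the degree sum in constraints; the
  summand 1 is for the vertex at which the greedy algorithm overflows.\<close>

datatype 'c act = Goto 'c | Push nat nat 'c | Pop nat 'c | Test nat nat 'c 'c

text \<open>\<open>WHILE j s c\<close> repeats \<open>c\<close> until, not while, the top of stack
  \<open>j\<close> is \<open>s\<close>. An empty stack has top 0, so 0 tests for emptiness and only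
  positive symbols may be pushed.\<close>

datatype com = SKIP | PUSH nat nat | POP nat | SEQ com com
  | IFTOP nat nat com com | WHILE nat nat com

type_synonym store = "nat \<Rightarrow> nat list"

definition top_of :: "nat list \<Rightarrow> nat" where
  "top_of l = (case l of [] \<Rightarrow> 0 | a # _ \<Rightarrow> a)"

lemma top_of_simps [simp]: "top_of [] = 0" "top_of (a # l) = a"
  by (simp_all add: top_of_def)

text \<open>One step leads to the program that remains to be run. These residual programs become the
  control states of the machine.\<close>

fun act_of :: "com \<Rightarrow> com act" where
  "act_of SKIP = Goto SKIP"
| "act_of (PUSH j s) = Push j s SKIP"
| "act_of (POP j) = Pop j SKIP"
| "act_of (SEQ a b) = (if a = SKIP then Goto b else map_act (\<lambda>a'. SEQ a' b) (act_of a))"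
| "act_of (IFTOP j s a b) = Test j s a b"
| "act_of (WHILE j s c) = Test j s SKIP (SEQ c (WHILE j s c))"

definition apply_act :: "'c act \<Rightarrow> store \<Rightarrow> 'c \<times> store" where
  "apply_act a st = (case a of
     Goto c \<Rightarrow> (c, st)
   | Push j s c \<Rightarrow> (c, st(j := s # st j))
   | Pop j c \<Rightarrow> (c, st(j := tl (st j)))
   | Test j s c c' \<Rightarrow> (if top_of (st j) = s then c else c', st))"

definition sstep :: "com \<times> store \<Rightarrow> com \<times> store" where
  "sstep cs = apply_act (act_of (fst cs)) (snd cs)"

definition runs :: "com \<Rightarrow> store \<Rightarrow> nat \<Rightarrow> store \<Rightarrow> bool" where
  "runs c st t st' \<longleftrightarrow> (sstep ^^ t) (c, st) = (SKIP, st')"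

lemma sstep_SEQ: "a \<noteq> SKIP \<Longrightarrow> sstep (SEQ a b, st) = (SEQ (fst (sstep (a, st))) b, snd (sstep (a, st)))"
  by (cases "act_of a") (auto simp: sstep_def apply_act_def)

lemma runs_SKIP: "runs SKIP st 0 st"
  by (simp add: runs_def)

lemma runs_Suc: "sstep (c, st) = (c1, st1) \<Longrightarrow> runs c1 st1 t st' \<Longrightarrow> runs c st (Suc t) st'"
  by (simp add: runs_def funpow_swap1)

lemma runs_SEQ:
  assumes "runs a st t1 st1" and "runs b st1 t2 st2"
  shows "\<exists>t \<le> Suc (t1 + t2). runs (SEQ a b) st t st2"
  using assms(1)
proof (induction t1 arbitrary: a st)
  case 0
  then have "a = SKIP" "st = st1" by (auto simp: runs_def)
  then have "sstep (SEQ a b, st) = (b, st1)" by (simp add: sstep_def apply_act_def)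
  from runs_Suc[OF this assms(2)] show ?case by auto
next
  case (Suc t1)
  show ?case
  proof (cases "a = SKIP")
    case True
    \<comment> \<open>\<open>SKIP\<close> idles, so a run may reach it early and wait there.\<close>
    have "(sstep ^^ n) (SKIP, st) = (SKIP, st)" for n
      by (induction n) (simp_all add: sstep_def apply_act_def)
    with Suc.prems True have "st = st1" unfolding runs_def by (metis prod.inject)
    then have "sstep (SEQ a b, st) = (b, st1)" using True by (simp add: sstep_def apply_act_def)
    from runs_Suc[OF this assms(2)] show ?thesis by (intro exI[of _ "Suc t2"]) simp
  next
    case False
    obtain a' st' where s: "sstep (a, st) = (a', st')" by fastforce
    with Suc.prems have "runs a' st' t1 st1" by (simp add: runs_def funpow_swap1)
    from Suc.IH[OF this] obtain t where "t \<le> Suc (t1 + t2)" "runs (SEQ a' b) st' t st2" by auto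
    moreover have "sstep (SEQ a b, st) = (SEQ a' b, st')" using sstep_SEQ[OF False] s by simp
    ultimately show ?thesis using runs_Suc by fastforce
  qed
qed

lemma runs_PUSH: "runs (PUSH j s) st 1 (st(j := s # st j))"
  by (simp add: runs_def sstep_def apply_act_def)

lemma runs_POP: "runs (POP j) st 1 (st(j := tl (st j)))"
  by (simp add: runs_def sstep_def apply_act_def)

lemma runs_IFTOP:
  "runs (if top_of (st j) = s then a else b) st t st' \<Longrightarrow> runs (IFTOP j s a b) st (Suc t) st'"
  by (rule runs_Suc) (auto simp: sstep_def apply_act_def)

lemma runs_WHILE_done: "top_of (st j) = s \<Longrightarrow> runs (WHILE j s c) st 1 st"
  by (simp add: runs_def sstep_def apply_act_def)

lemma runs_WHILE_step:
  assumes "top_of (st j) \<noteq> s" "runs c st t1 st1" "runs (WHILE j s c) st1 t2 st2"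
  shows "\<exists>t \<le> t1 + t2 + 2. runs (WHILE j s c) st t st2"
proof -
  obtain t where "t \<le> Suc (t1 + t2)" "runs (SEQ c (WHILE j s c)) st t st2"
    using runs_SEQ[OF assms(2,3)] by blast
  then show ?thesis using assms(1)
    by (intro exI[of _ "Suc t"] conjI runs_Suc[of _ _ "SEQ c (WHILE j s c)" st])
       (auto simp: sstep_def apply_act_def)
qed

fun okc :: "nat \<Rightarrow> com \<Rightarrow> bool" where
  "okc B SKIP = True"
| "okc B (PUSH j s) = (j < B \<and> 0 < s \<and> s \<le> B)"
| "okc B (POP j) = (j < B)"
| "okc B (SEQ a b) = (okc B a \<and> okc B b)"
| "okc B (IFTOP j s a b) = (j < B \<and> okc B a \<and> okc B b)"
| "okc B (WHILE j s c) = (j < B \<and> okc B c)"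

lemma okc_mono: "okc B c \<Longrightarrow> B \<le> B' \<Longrightarrow> okc B' c"
  by (induction c) auto

text \<open>A finite set of residual programs that contains the program and is closed under steps.
  Unfolding a loop only puts residuals of its body in front of the same loop, so the set stays
  finite.\<close>

fun pts :: "com \<Rightarrow> com set" where
  "pts SKIP = {SKIP}"
| "pts (PUSH j s) = {PUSH j s, SKIP}"
| "pts (POP j) = {POP j, SKIP}"
| "pts (SEQ a b) = (\<lambda>a'. SEQ a' b) ` pts a \<union> pts b"
| "pts (IFTOP j s a b) = {IFTOP j s a b} \<union> pts a \<union> pts b"
| "pts (WHILE j s c) = {WHILE j s c, SKIP} \<union> (\<lambda>c'. SEQ c' (WHILE j s c)) ` pts c"

lemma finite_pts: "finite (pts c)"
  by (induction c) auto

lemma self_in_pts: "c \<in> pts c"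
  by (induction c) auto

lemma SKIP_in_pts: "SKIP \<in> pts c"
  by (induction c) auto

fun ok_act :: "nat \<Rightarrow> 'c act \<Rightarrow> bool" where
  "ok_act B (Goto c) = True"
| "ok_act B (Push j s c) = (j < B \<and> 0 < s \<and> s \<le> B)"
| "ok_act B (Pop j c) = (j < B)"
| "ok_act B (Test j s c c') = (j < B)"

lemma ok_act_map [simp]: "ok_act B (map_act f a) = ok_act B a"
  by (cases a) auto

lemma pts_closed: "okc B c \<Longrightarrow> d \<in> pts c \<Longrightarrow> set_act (act_of d) \<subseteq> pts c \<and> ok_act B (act_of d)"
proof (induction c arbitrary: d)
  case (SEQ a b)
  show ?case
  proof (cases "d \<in> pts b")
    case True
    then have "set_act (act_of d) \<subseteq> pts b \<and> ok_act B (act_of d)" using SEQ.IH(2) SEQ.prems(1) by simp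
    then show ?thesis by auto
  next
    case False
    then obtain a' where d: "d = SEQ a' b" "a' \<in> pts a" using SEQ.prems by auto
    show ?thesis
    proof (cases "a' = SKIP")
      case True
      then show ?thesis using d self_in_pts by auto
    next
      case f: False
      have "set_act (act_of a') \<subseteq> pts a \<and> ok_act B (act_of a')" using SEQ d by auto
      then show ?thesis using d f by (auto simp: act.set_map)
    qed
  qed
next
  case (IFTOP j s a b)
  then show ?case using self_in_pts by auto
next
  case (WHILE j s c)
  show ?case
  proof (cases "d \<in> {WHILE j s c, SKIP}")
    case True
    then show ?thesis using WHILE.prems self_in_pts by auto
  next
    case False
    then obtain c' where d: "d = SEQ c' (WHILE j s c)" "c' \<in> pts c" using WHILE.prems by auto
    show ?thesis
    proof (cases "c' = SKIP")
      case True
      then show ?thesis using d by auto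
    next
      case f: False
      have "set_act (act_of c') \<subseteq> pts c \<and> ok_act B (act_of c')" using WHILE d by auto
      then show ?thesis using d f by (auto simp: act.set_map)
    qed
  qed
qed auto

text \<open>All stacks live side by side on the tracks of one tape, bottom in cell 0; cell -1 carries a
  mark, so that the head finds its way home after every stack operation.\<close>

datatype tsym = Mark | Cell "nat list"
datatype tstate = Init0 | Init1 | Scan com | Look com | Ret com

text \<open>\<open>Scan\<close> runs right from cell 0 to the first free cell on the track of the
  stack concerned, and \<open>Look\<close> inspects the cell to its left: this is the top of the
  stack, or the mark if the stack is empty. \<open>Ret\<close> goes home. The two initial states
  write the mark.\<close>

fun tm_trans :: "com \<Rightarrow> tstate \<Rightarrow> tsym \<Rightarrow> tstate \<times> tsym \<times> int" where
  "tm_trans c0 Init0 g = (Init1, g, -1)"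
| "tm_trans c0 Init1 g = (Scan c0, Mark, 1)"
| "tm_trans c0 (Scan c) Mark = (Scan c, Mark, 0)"
| "tm_trans c0 (Scan c) (Cell v) = (case act_of c of
     Goto c' \<Rightarrow> (Scan c', Cell v, 0)
   | Push j s c' \<Rightarrow> (if v ! j = 0 then (Ret c', Cell (v[j := s]), 0) else (Scan c, Cell v, 1))
   | Pop j c' \<Rightarrow> (if v ! j = 0 then (Look c, Cell v, -1) else (Scan c, Cell v, 1))
   | Test j s c' c'' \<Rightarrow> (if v ! j = 0 then (Look c, Cell v, -1) else (Scan c, Cell v, 1)))"
| "tm_trans c0 (Look c) g = (case act_of c of
     Pop j c' \<Rightarrow> (case g of Mark \<Rightarrow> (Scan c', g, 1) | Cell v \<Rightarrow> (Ret c', Cell (v[j := 0]), 0))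
   | Test j s c' c'' \<Rightarrow> (case g of Mark \<Rightarrow> (Scan (if 0 = s then c' else c''), g, 1)
       | Cell v \<Rightarrow> (Ret (if v ! j = s then c' else c''), g, 0))
   | _ \<Rightarrow> (Look c, g, 0))"
| "tm_trans c0 (Ret c) Mark = (Scan c, Mark, 1)"
| "tm_trans c0 (Ret c) (Cell v) = (Ret c, Cell v, -1)"

definition mstep :: "('q \<Rightarrow> 'g \<Rightarrow> 'q \<times> 'g \<times> int) \<Rightarrow> 'q \<Rightarrow> 'q \<times> (int \<Rightarrow> 'g) \<times> int \<Rightarrow> 'q \<times> (int \<Rightarrow> 'g) \<times> int" where
  "mstep D qh C = (case C of (q, t, h) \<Rightarrow> if q = qh then (q, t, h)
     else case D q (t h) of (q', s', d) \<Rightarrow> (q', t(h := s'), h + d))"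

text \<open>The head of the list is the top, but cell 0 holds the bottom; hence the
  reversal.\<close>

definition cellval :: "nat list \<Rightarrow> nat \<Rightarrow> nat" where
  "cellval l i = (if i < length l then rev l ! i else 0)"

definition tape_of :: "nat \<Rightarrow> store \<Rightarrow> int \<Rightarrow> tsym" where
  "tape_of k st i = (if i = -1 then Mark
     else if i < -1 then Cell (replicate k 0)
     else Cell (map (\<lambda>j. cellval (st j) (nat i)) [0..<k]))"

abbreviation tmstep :: "com \<Rightarrow> tstate \<times> (int \<Rightarrow> tsym) \<times> int \<Rightarrow> tstate \<times> (int \<Rightarrow> tsym) \<times> int" where
  "tmstep c0 \<equiv> mstep (tm_trans c0) (Scan SKIP)"

lemma tape_of_nonneg [simp]:
  "tape_of k st (int i) = Cell (map (\<lambda>j. cellval (st j) i) [0..<k])"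
  by (simp add: tape_of_def)

lemma tape_of_mark [simp]: "tape_of k st (-1) = Mark"
  by (simp add: tape_of_def)

lemma cellval_eq_0: "0 \<notin> set l \<Longrightarrow> cellval l i = 0 \<longleftrightarrow> length l \<le> i"
  using nth_mem[of i "rev l"] by (auto simp: cellval_def not_less) (metis neq0_conv)

lemma cellval_push: "cellval (s # l) i = (if i = length l then s else cellval l i)"
  by (auto simp: cellval_def nth_append)

lemma cellval_tl: "l \<noteq> [] \<Longrightarrow> cellval (tl l) i = (if i = length l - 1 then 0 else cellval l i)"
  by (cases l) (auto simp: cellval_def nth_append)

lemma cellval_top: "l \<noteq> [] \<Longrightarrow> cellval l (length l - 1) = top_of l"
  by (cases l) (auto simp: cellval_def nth_append)

lemma tape_of_upd:
  assumes "j < k" and "\<And>i. cellval l' i = (if i = a then s else cellval (st j) i)"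
  shows "(tape_of k st)(int a := Cell ((map (\<lambda>j. cellval (st j) a) [0..<k])[j := s])) = tape_of k (st(j := l'))"
proof
  fix i
  show "((tape_of k st)(int a := Cell ((map (\<lambda>j. cellval (st j) a) [0..<k])[j := s]))) i = tape_of k (st(j := l')) i"
  proof (cases "i = int a")
    case True
    then show ?thesis using assms by (auto intro!: nth_equalityI simp: nth_list_update)
  next
    case False
    then show ?thesis using assms by (auto simp: tape_of_def)
  qed
qed

text \<open>From cell \<open>a\<close> it takes \<open>a + 1\<close> moves to reach the mark in cell
  -1 and one more to return to cell 0.\<close>

lemma ret_steps: "(tmstep c0 ^^ (a + 2)) (Ret c, tape_of k st, int a) = (Scan c, tape_of k st, 0)"
proof (induction a)
  case 0
  have "(tape_of k st)(0 := Cell (map (\<lambda>j. cellval (st j) 0) [0..<k]), -1 := Mark) = tape_of k st"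
    by (auto simp: fun_eq_iff tape_of_def)
  then show ?case by (simp add: mstep_def numeral_2_eq_2 tape_of_nonneg[of k st 0, simplified])
next
  case (Suc a)
  have "tmstep c0 (Ret c, tape_of k st, int (Suc a)) = (Ret c, tape_of k st, int a)"
    using tape_of_nonneg[of k st "Suc a"] fun_upd_triv[of "tape_of k st" "int (Suc a)"]
    by (simp add: mstep_def del: fun_upd_triv)
  then show ?case using Suc by (simp add: funpow_swap1 del: of_nat_Suc)
qed

definition act_var :: "'c act \<Rightarrow> nat" where
  "act_var a = (case a of Goto _ \<Rightarrow> 0 | Push j _ _ \<Rightarrow> j | Pop j _ \<Rightarrow> j | Test j _ _ _ \<Rightarrow> j)"

lemma scan_steps:
  assumes "c \<noteq> SKIP" "ok_act k (act_of c)" "\<And>c'. act_of c \<noteq> Goto c'"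
    and "0 \<notin> set (st (act_var (act_of c)))" "a \<le> length (st (act_var (act_of c)))"
  shows "(tmstep c0 ^^ a) (Scan c, tape_of k st, 0) = (Scan c, tape_of k st, int a)"
  using assms(5)
proof (induction a)
  case (Suc a)
  then have "cellval (st (act_var (act_of c))) a \<noteq> 0" using cellval_eq_0[OF assms(4)] by auto
  then have "tmstep c0 (Scan c, tape_of k st, int a) = (Scan c, tape_of k st, int (Suc a))"
    using assms(1-3) fun_upd_triv[of "tape_of k st" "int a"]
    by (cases "act_of c") (auto simp: mstep_def act_var_def simp del: fun_upd_triv)
  then show ?case using Suc by simp
qed simp

text \<open>A stack operation costs a walk to the top of the stack and back, with at most 4 steps
  for turning, writing and passing the mark.\<close>

lemma sim_step:
  assumes c: "c \<noteq> SKIP" and ok: "ok_act k (act_of c)"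
    and nz: "\<And>j. 0 \<notin> set (st j)" and L: "\<And>j. length (st j) \<le> L"
    and s: "sstep (c, st) = (c', st')"
  shows "\<exists>n \<le> 2 * L + 4. (tmstep c0 ^^ n) (Scan c, tape_of k st, 0) = (Scan c', tape_of k st', 0)"
proof (cases "\<exists>d. act_of c = Goto d")
  case True
  then have "tmstep c0 (Scan c, tape_of k st, 0) = (Scan c', tape_of k st', 0)"
    using c s fun_upd_triv[of "tape_of k st" 0] tape_of_nonneg[of k st 0]
    by (auto simp: mstep_def sstep_def apply_act_def simp del: fun_upd_triv tape_of_nonneg)
  then show ?thesis by (intro exI[of _ 1]) auto
next
  case False
  define j where "j = act_var (act_of c)"
  define a where "a = length (st j)"
  define T where "T = tape_of k st"
  have jk: "j < k" using ok False by (cases "act_of c") (auto simp: j_def act_var_def)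
  have scan: "(tmstep c0 ^^ a) (Scan c, T, 0) = (Scan c, T, int a)"
    using scan_steps[of c k st a c0] c ok False nz by (auto simp: a_def j_def T_def)
  have cv: "cellval (st j) a = 0" using cellval_eq_0 nz by (simp add: a_def)
  have Ta: "T (int a) = Cell (map (\<lambda>j. cellval (st j) a) [0..<k])" by (simp add: T_def)
  have triv: "T(int a := T (int a)) = T" by simp
  have comb: "\<exists>n \<le> 2 * L + 4. (tmstep c0 ^^ n) (Scan c, T, 0) = (Scan c', tape_of k st', 0)"
    if "(tmstep c0 ^^ m) (Scan c, T, int a) = (Scan c', tape_of k st', 0)" "m \<le> a + 4" for m
  proof -
    have "(tmstep c0 ^^ (m + a)) (Scan c, T, 0) = (Scan c', tape_of k st', 0)"
      using that scan by (simp add: funpow_add)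
    moreover have "m + a \<le> 2 * L + 4" using that L[of j] by (simp add: a_def)
    ultimately show ?thesis by blast
  qed
  show ?thesis unfolding T_def[symmetric]
  proof (cases "act_of c")
    case (Goto d) then show "\<exists>n \<le> 2 * L + 4. (tmstep c0 ^^ n) (Scan c, T, 0) = (Scan c', tape_of k st', 0)"
      using False by blast
  next
    case (Push i s0 d)
    then have ij: "i = j" by (simp add: j_def act_var_def)
    have st': "st' = st(j := s0 # st j)" "c' = d" using s Push ij by (auto simp: sstep_def apply_act_def)
    have "tape_of k st' = T(int a := Cell ((map (\<lambda>j. cellval (st j) a) [0..<k])[j := s0]))"
      unfolding T_def st' by (rule tape_of_upd[symmetric]) (use jk in \<open>auto simp: cellval_push a_def\<close>)
    then have "tmstep c0 (Scan c, T, int a) = (Ret d, tape_of k st', int a)"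
      using Push c jk cv ij by (auto simp: mstep_def Ta)
    then have "(tmstep c0 ^^ Suc (a + 2)) (Scan c, T, int a) = (Scan c', tape_of k st', 0)"
      using ret_steps[of a c0 d k st'] st'(2) by (simp del: funpow.simps add: funpow_Suc_right)
    then show "\<exists>n \<le> 2 * L + 4. (tmstep c0 ^^ n) (Scan c, T, 0) = (Scan c', tape_of k st', 0)"
      by (rule comb) auto
  next
    case (Pop i d)
    then have ij: "i = j" by (simp add: j_def act_var_def)
    have st': "st' = st(j := tl (st j))" "c' = d" using s Pop ij by (auto simp: sstep_def apply_act_def)
    have l: "tmstep c0 (Scan c, T, int a) = (Look c, T, int a - 1)"
      using Pop c jk cv ij triv[unfolded Ta] by (auto simp: mstep_def Ta)
    show "\<exists>n \<le> 2 * L + 4. (tmstep c0 ^^ n) (Scan c, T, 0) = (Scan c', tape_of k st', 0)"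
    proof (cases "a = 0")
      case True
      then have "st' = st" using st' by (auto simp: a_def)
      then have "tmstep c0 (Look c, T, int a - 1) = (Scan d, tape_of k st', 0)"
        using Pop True fun_upd_triv[of T "-1"] by (auto simp: mstep_def T_def simp del: fun_upd_triv)
      then have "(tmstep c0 ^^ 2) (Scan c, T, int a) = (Scan c', tape_of k st', 0)"
        using l st' by (simp add: numeral_2_eq_2)
      then show ?thesis by (rule comb) auto
    next
      case a0: False
      then have ne: "st j \<noteq> []" by (auto simp: a_def)
      obtain b where b: "a = Suc b" using a0 by (cases a) auto
      have l': "tmstep c0 (Scan c, T, int a) = (Look c, T, int b)" using l by (simp add: b)
      have "tape_of k st' = T(int b := Cell ((map (\<lambda>j. cellval (st j) b) [0..<k])[j := 0]))"
        unfolding T_def st' by (rule tape_of_upd[symmetric]) (use jk ne in \<open>auto simp: cellval_tl a_def[symmetric] b\<close>)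
      then have "tmstep c0 (Look c, T, int b) = (Ret d, tape_of k st', int b)"
        using Pop ij by (auto simp: mstep_def T_def)
      then have "(tmstep c0 ^^ Suc (Suc (b + 2))) (Scan c, T, int a) = (Scan c', tape_of k st', 0)"
        using ret_steps[of b c0 d k st'] st'(2) l' by (simp del: funpow.simps add: funpow_Suc_right)
      then show ?thesis using b by (intro comb[of "Suc (Suc (b + 2))"]) auto
    qed
  next
    case (Test i s0 d e)
    then have ij: "i = j" by (simp add: j_def act_var_def)
    have st': "st' = st" "c' = (if top_of (st j) = s0 then d else e)" using s Test ij by (auto simp: sstep_def apply_act_def)
    have l: "tmstep c0 (Scan c, T, int a) = (Look c, T, int a - 1)"
      using Test c jk cv ij triv[unfolded Ta] by (auto simp: mstep_def Ta)
    show "\<exists>n \<le> 2 * L + 4. (tmstep c0 ^^ n) (Scan c, T, 0) = (Scan c', tape_of k st', 0)"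
    proof (cases "a = 0")
      case True
      then have "top_of (st j) = 0" by (auto simp: a_def)
      then have "tmstep c0 (Look c, T, int a - 1) = (Scan c', tape_of k st', 0)"
        using Test True st' fun_upd_triv[of T "-1"] by (auto simp: mstep_def T_def simp del: fun_upd_triv)
      then have "(tmstep c0 ^^ 2) (Scan c, T, int a) = (Scan c', tape_of k st', 0)"
        using l st' by (simp add: numeral_2_eq_2)
      then show ?thesis by (rule comb) auto
    next
      case a0: False
      then have ne: "st j \<noteq> []" by (auto simp: a_def)
      obtain b where b: "a = Suc b" using a0 by (cases a) auto
      have l': "tmstep c0 (Scan c, T, int a) = (Look c, T, int b)" using l by (simp add: b)
      have "cellval (st j) b = top_of (st j)" using cellval_top[OF ne] by (simp add: a_def[symmetric] b)
      then have "tmstep c0 (Look c, T, int b) = (Ret c', T, int b)"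
        using Test ij st' jk fun_upd_triv[of T "int b"] by (auto simp: mstep_def T_def simp del: fun_upd_triv)
      then have "(tmstep c0 ^^ Suc (Suc (b + 2))) (Scan c, T, int a) = (Scan c', tape_of k st', 0)"
        using ret_steps[of b c0 c' k st'] st'(1) l' by (simp del: funpow.simps add: funpow_Suc_right T_def)
      then show ?thesis using b by (intro comb[of "Suc (Suc (b + 2))"]) auto
    qed
  qed
qed

lemma sstep_invariants:
  assumes "sstep (c, st) = (c', st')" and "ok_act B (act_of c)" and "\<And>j. 0 \<notin> set (st j)"
    and "\<And>j. length (st j) \<le> L"
  shows "0 \<notin> set (st' j)" "length (st' j) \<le> Suc L"
  using assms(1,2) assms(3,4)[of j] list.set_sel(2)[of "st j" 0]
  by (cases "act_of c"; cases "st j"; auto simp: sstep_def apply_act_def le_SucI split: if_splits)+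

text \<open>A step lengthens a stack by at most one symbol, so \<open>L + t\<close> bounds all
  heights during the run.\<close>

lemma sim_runs:
  assumes "okc k c0" "c \<in> pts c0" "runs c st t st'"
    and "\<And>j. 0 \<notin> set (st j)" "\<And>j. length (st j) \<le> L"
  shows "\<exists>n \<le> t * (2 * (L + t) + 4). (tmstep c0 ^^ n) (Scan c, tape_of k st, 0) = (Scan SKIP, tape_of k st', 0)"
  using assms(2-)
proof (induction t arbitrary: c st L)
  case 0
  then show ?case by (auto simp: runs_def)
next
  case (Suc t)
  obtain c1 st1 where s: "sstep (c, st) = (c1, st1)" by fastforce
  have ok: "ok_act k (act_of c)" and cl: "set_act (act_of c) \<subseteq> pts c0"
    using pts_closed[OF assms(1) Suc.prems(1)] by auto
  have r1: "runs c1 st1 t st'" using Suc.prems(2) s by (simp add: runs_def funpow_swap1)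
  have c1: "c1 \<in> pts c0" using cl s by (cases "act_of c") (auto simp: sstep_def apply_act_def)
  obtain n where n: "n \<le> t * (2 * (Suc L + t) + 4)"
    "(tmstep c0 ^^ n) (Scan c1, tape_of k st1, 0) = (Scan SKIP, tape_of k st', 0)"
    using Suc.IH[OF c1 r1] sstep_invariants[OF s ok Suc.prems(3,4)] by meson
  show ?case
  proof (cases "c = SKIP")
    case True
    then have "c1 = c \<and> st1 = st" using s by (auto simp: sstep_def apply_act_def)
    then have "(tmstep c0 ^^ n) (Scan c, tape_of k st, 0) = (Scan SKIP, tape_of k st', 0)" using n by simp
    moreover have "n \<le> Suc t * (2 * (L + Suc t) + 4)" using n(1) by (auto simp: algebra_simps)
    ultimately show ?thesis by blast
  next
    case False
    obtain m where m: "m \<le> 2 * L + 4"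
      "(tmstep c0 ^^ m) (Scan c, tape_of k st, 0) = (Scan c1, tape_of k st1, 0)"
      using sim_step[OF False ok Suc.prems(3,4) s] by blast
    have "(tmstep c0 ^^ (n + m)) (Scan c, tape_of k st, 0) = (Scan SKIP, tape_of k st', 0)"
      using m n by (simp add: funpow_add)
    moreover have "n + m \<le> Suc t * (2 * (L + Suc t) + 4)" using n(1) m(1) by (auto simp: algebra_simps)
    ultimately show ?thesis by blast
  qed
qed

section \<open>Finite machines over arbitrary types as Turing machines\<close>

lemma numbering_with_prefix:
  assumes "finite A" "distinct xs" "set xs \<subseteq> A"
  shows "\<exists>e. bij_betw e A {..<card A} \<and> (\<forall>i < length xs. e (xs ! i) = i)"
proof -
  obtain ys where ys: "set ys = A - set xs" "distinct ys"
    using finite_distinct_list[of "A - set xs"] assms(1) by auto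
  define zs where "zs = xs @ ys"
  have zs: "set zs = A" "distinct zs" using ys assms by (auto simp: zs_def)
  then have b: "bij_betw ((!) zs) {..<length zs} A" by (intro bij_betw_nth) auto
  define e where "e = the_inv_into {..<length zs} ((!) zs)"
  have "bij_betw e A {..<length zs}" unfolding e_def by (rule bij_betw_the_inv_into[OF b])
  moreover have "length zs = card A" using zs distinct_card by metis
  moreover have "e (xs ! i) = i" if "i < length xs" for i
    using the_inv_into_f_f[of "(!) zs" "{..<length zs}" i] b that
    by (auto simp: e_def bij_betw_def zs_def nth_append)
  ultimately show ?thesis by auto
qed

text \<open>The format of \<open>tm\<close> fixes the numbers of the start state, the halting state,
  the blank and the two bits. The renumbering therefore has to send these five objects to prescribed
  values, and is arbitrary elsewhere.\<close>

lemma machine_to_tm: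
  fixes D :: "'q \<Rightarrow> 'g \<Rightarrow> 'q \<times> 'g \<times> int"
  assumes fin: "finite Q" "finite G" and q: "q0 \<in> Q" "q1 \<in> Q" "q0 \<noteq> q1"
    and g: "distinct [b, s1, s2]" "set [b, s1, s2] \<subseteq> G"
    and cl: "\<And>q s q' s' d. q \<in> Q \<Longrightarrow> s \<in> G \<Longrightarrow> D q s = (q', s', d) \<Longrightarrow> q' \<in> Q \<and> s' \<in> G \<and> d \<in> {-1, 0, 1}"
  shows "\<exists>M eq eg. wf_tm M \<and> eq q0 = 0 \<and> eq q1 = 1 \<and> eg b = 0 \<and> eg s1 = 1 \<and> eg s2 = 2 \<and>
    (\<forall>n t h. (\<forall>i. t i \<in> G) \<longrightarrow> (case (mstep D q1 ^^ n) (q0, t, h) of (q, t', h') \<Rightarrow>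
        (tm_step M ^^ n) (0, eg \<circ> t, h) = (eq q, eg \<circ> t', h')))"
proof -
  obtain eq where eq: "bij_betw eq Q {..<card Q}" "\<forall>i < length [q0, q1]. eq ([q0, q1] ! i) = i"
    using numbering_with_prefix[of Q "[q0, q1]"] fin q by auto
  obtain eg where eg: "bij_betw eg G {..<card G}" "\<forall>i < length [b, s1, s2]. eg ([b, s1, s2] ! i) = i"
    using numbering_with_prefix[of G "[b, s1, s2]"] fin g by auto
  have v: "eq q0 = 0" "eq q1 = 1" "eg b = 0" "eg s1 = 1" "eg s2 = 2"
    using eq(2)[rule_format, of 0] eq(2)[rule_format, of 1]
      eg(2)[rule_format, of 0] eg(2)[rule_format, of 1] eg(2)[rule_format, of 2] by auto
  define dq dg where "dq = the_inv_into Q eq" and "dg = the_inv_into G eg"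
  have dq: "dq (eq x) = x" if "x \<in> Q" for x
    using that eq(1) by (simp add: dq_def bij_betw_def the_inv_into_f_f)
  have dg: "dg (eg x) = x" if "x \<in> G" for x
    using that eg(1) by (simp add: dg_def bij_betw_def the_inv_into_f_f)
  have dq': "dq i \<in> Q" if "i < card Q" for i
    using that bij_betw_the_inv_into[OF eq(1)] by (auto simp: dq_def bij_betw_def)
  have dg': "dg i \<in> G" if "i < card G" for i
    using that bij_betw_the_inv_into[OF eg(1)] by (auto simp: dg_def bij_betw_def)
  have eq': "eq x < card Q" if "x \<in> Q" for x using that eq(1) by (auto simp: bij_betw_def)
  have eg': "eg x < card G" if "x \<in> G" for x using that eg(1) by (auto simp: bij_betw_def)
  define M where "M = \<lparr>num_states = card Q, num_symbols = card G,
    delta = (\<lambda>q s. case D (dq q) (dg s) of (q', s', d) \<Rightarrow> (eq q', eg s', d))\<rparr>"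
  have c2: "2 \<le> card Q" using eq'[OF q(2)] v by auto
  have c3: "3 \<le> card G" using eg'[of s2] g v by auto
  have wf: "wf_tm M"
    unfolding wf_tm_def
  proof (intro conjI allI impI)
    show "2 \<le> num_states M" "3 \<le> num_symbols M" using c2 c3 by (auto simp: M_def)
    fix i s assume i_s: "i < num_states M" "s < num_symbols M"
    obtain q' s' d where Dd: "D (dq i) (dg s) = (q', s', d)" by (cases "D (dq i) (dg s)") auto
    have "q' \<in> Q \<and> s' \<in> G \<and> d \<in> {-1, 0, 1}"
      using i_s by (intro cl[OF dq' dg' Dd]) (auto simp: M_def)
    then show "case delta M i s of (q', s', d) \<Rightarrow> q' < num_states M \<and> s' < num_symbols M \<and> d \<in> {-1, 0, 1}"
      using Dd eq' eg' by (auto simp: M_def)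
  qed
  have st: "tm_step M (eq q, eg \<circ> t, h) = (eq q', eg \<circ> t', h') \<and> q' \<in> Q \<and> (\<forall>i. t' i \<in> G)"
    if "q \<in> Q" "\<forall>i. t i \<in> G" "mstep D q1 (q, t, h) = (q', t', h')" for q t h q' t' h'
  proof (cases "q = q1")
    case True
    then show ?thesis using that v by (auto simp: mstep_def)
  next
    case False
    then have ne: "eq q \<noteq> 1" using dq[OF that(1)] dq[OF q(2)] v by metis
    obtain q2 s2 d where Dd: "D q (t h) = (q2, s2, d)" by (cases "D q (t h)") auto
    moreover have "q2 \<in> Q \<and> s2 \<in> G" using cl[OF that(1) _ Dd] that(2) by auto
    moreover have "q' = q2" "t' = t(h := s2)" "h' = h + d" using that(3) False Dd by (auto simp: mstep_def)
    moreover have "eg \<circ> t(h := s2) = (eg \<circ> t)(h := eg s2)" by (simp add: fun_upd_comp)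
    ultimately show ?thesis using that(1,2) ne dq dg by (auto simp: M_def)
  qed
  have full: "case (mstep D q1 ^^ n) (q0, t, h) of (q, t', h') \<Rightarrow>
        (tm_step M ^^ n) (0, eg \<circ> t, h) = (eq q, eg \<circ> t', h') \<and> q \<in> Q \<and> (\<forall>i. t' i \<in> G)"
    if "\<forall>i. t i \<in> G" for n t h
  proof (induction n)
    case 0
    then show ?case using v q that by auto
  next
    case (Suc n)
    obtain q t' h' where e: "(mstep D q1 ^^ n) (q0, t, h) = (q, t', h')" by (cases "(mstep D q1 ^^ n) (q0, t, h)") auto
    obtain q2 t2 h2 where e2: "mstep D q1 (q, t', h') = (q2, t2, h2)" by (cases "mstep D q1 (q, t', h')") auto
    have "(mstep D q1 ^^ Suc n) (q0, t, h) = (q2, t2, h2)" using e e2 by simp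
    moreover have "(tm_step M ^^ Suc n) (0, eg \<circ> t, h) = tm_step M (eq q, eg \<circ> t', h')"
      using Suc e unfolding funpow.simps comp_apply[of "tm_step M"] by (auto simp del: tm_step.simps comp_apply)
    moreover have "q \<in> Q" "\<forall>i. t' i \<in> G" using Suc e by auto
    ultimately show ?case using st[OF _ _ e2] by (auto simp del: tm_step.simps comp_apply funpow.simps)
  qed
  have "\<forall>n t h. (\<forall>i. t i \<in> G) \<longrightarrow> (case (mstep D q1 ^^ n) (q0, t, h) of (q, t', h') \<Rightarrow>
        (tm_step M ^^ n) (0, eg \<circ> t, h) = (eq q, eg \<circ> t', h'))"
  proof (intro allI impI)
    fix n h and t :: "int \<Rightarrow> 'g" assume "\<forall>i. t i \<in> G"
    from full[OF this, of n h]
    show "case (mstep D q1 ^^ n) (q0, t, h) of (q, t', h') \<Rightarrow> (tm_step M ^^ n) (0, eg \<circ> t, h) = (eq q, eg \<circ> t', h')"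
      by (cases "(mstep D q1 ^^ n) (q0, t, h)") simp
  qed
  then show ?thesis using wf v by blast
qed

lemma mono_poly_nat: "a \<le> b \<Longrightarrow> poly (p :: nat poly) a \<le> poly p b"
  by (induction p) (auto intro!: add_mono mult_mono)

definition empty_store :: store where "empty_store = (\<lambda>_. [])"

text \<open>Input and output are reversed on stack 0 because the bottom of a stack is in cell 0. Up
  to the mark, the tape of the initial store then is the input tape, and the final tape shows the
  output where \<open>halts_with\<close> expects it.\<close>

theorem program_poly_time:
  assumes ok: "okc B c"
    and run: "\<And>x. \<exists>t \<le> poly (p :: nat poly) (length x). runs c (empty_store(0 := rev (map bit_symbol x))) t
        (empty_store(0 := rev (map bit_symbol (f x))))"
  shows "poly_time f"
proof -
  \<comment> \<open>The number of tracks and also the largest symbol. The summand 2 makes it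
    positive and admits both bit symbols.\<close>
  define k where "k = B + 2"
  have k0: "0 < k" by (simp add: k_def)
  have ok: "okc k c" using ok okc_mono by (simp add: k_def)
  define G where "G = insert Mark (Cell ` {v. set v \<subseteq> {0..k} \<and> length v = k})"
  define Q where "Q = {Init0, Init1} \<union> Scan ` pts c \<union> Look ` pts c \<union> Ret ` pts c"
  define bl where "bl = Cell (replicate k 0)"
  define sy where "sy = (\<lambda>b. Cell ((replicate k 0)[0 := bit_symbol b]))"
  have finG: "finite G" unfolding G_def by (intro finite.insertI finite_imageI finite_lists_length_eq) auto
  have finQ: "finite Q" by (simp add: Q_def finite_pts)
  have sy0: "sy b = Cell (bit_symbol b # replicate (k - 1) 0)" for b
    by (simp add: sy_def k_def)
  have bl0: "bl = Cell (0 # replicate (k - 1) 0)" by (simp add: bl_def k_def)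
  have cl: "q' \<in> Q \<and> s' \<in> G \<and> d \<in> {-1, 0, 1}" if "q \<in> Q" "s \<in> G" "tm_trans c q s = (q', s', d)" for q s q' s' d
  proof -
    have up: "Cell (v[j := a]) \<in> G" if "Cell v \<in> G" "a \<le> k" for v j a
      using that set_update_subset_insert[of v j a] by (fastforce simp: G_def)
    have M: "Mark \<in> G" by (simp add: G_def)
    note qQ = that(1)
    consider "q \<in> {Init0, Init1}" | e where "e \<in> pts c" "q = Scan e" | e where "e \<in> pts c" "q = Look e"
      | e where "e \<in> pts c" "q = Ret e" using qQ by (fastforce simp: Q_def)
    then show ?thesis
    proof cases
      case 1
      then show ?thesis using that M self_in_pts[of c] by (auto simp: Q_def)
    next
      case 2
      then show ?thesis using that M pts_closed[OF ok 2(1)] up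
        by (cases s; cases "act_of e"; auto simp: Q_def split: if_splits)
    next
      case 3
      then show ?thesis using that M pts_closed[OF ok 3(1)] up
        by (cases s; cases "act_of e"; auto simp: Q_def split: if_splits)
    next
      case 4
      then show ?thesis using that M by (cases s; auto simp: Q_def)
    qed
  qed
  have d3: "distinct [bl, sy False, sy True]" by (simp add: sy0 bl0 bit_symbol_def)
  have Gbs: "set [bl, sy False, sy True] \<subseteq> G" by (auto simp: sy0 bl0 G_def bit_symbol_def k_def image_iff)
  have q01: "Init0 \<in> Q" "Scan SKIP \<in> Q" "Init0 \<noteq> Scan SKIP" using SKIP_in_pts by (auto simp: Q_def)
  have "\<exists>M eq eg. wf_tm M \<and> eq Init0 = 0 \<and> eq (Scan SKIP) = 1 \<and> eg bl = 0 \<and> eg (sy False) = 1 \<and> eg (sy True) = 2 \<and>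
    (\<forall>n t h. (\<forall>i. t i \<in> G) \<longrightarrow> (case (tmstep c ^^ n) (Init0, t, h) of (q, t', h') \<Rightarrow>
        (tm_step M ^^ n) (0, eg \<circ> t, h) = (eq q, eg \<circ> t', h')))"
    by (rule machine_to_tm[OF finQ finG q01 d3 Gbs]) (erule (2) cl)
  then obtain M eq eg where M0: "wf_tm M \<and> eq Init0 = 0 \<and> eq (Scan SKIP) = 1 \<and> eg bl = 0 \<and> eg (sy False) = 1 \<and> eg (sy True) = 2 \<and>
    (\<forall>n t h. (\<forall>i. t i \<in> G) \<longrightarrow> (case (tmstep c ^^ n) (Init0, t, h) of (q, t', h') \<Rightarrow>
        (tm_step M ^^ n) (0, eg \<circ> t, h) = (eq q, eg \<circ> t', h')))"
    by (elim exE) (rule that)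
  note M = M0[THEN conjunct1] M0[THEN conjunct2, THEN conjunct2, THEN conjunct1]
    M0[THEN conjunct2, THEN conjunct2, THEN conjunct2, THEN conjunct1]
    M0[THEN conjunct2, THEN conjunct2, THEN conjunct2, THEN conjunct2, THEN conjunct1]
    M0[THEN conjunct2, THEN conjunct2, THEN conjunct2, THEN conjunct2, THEN conjunct2, THEN conjunct1]
  have sim: "case (tmstep c ^^ n) (Init0, t, h) of (q, t', h') \<Rightarrow>
        (tm_step M ^^ n) (0, eg \<circ> t, h) = (eq q, eg \<circ> t', h')" if "\<forall>i. t i \<in> G" for n t h
    by (rule M0[THEN conjunct2, THEN conjunct2, THEN conjunct2, THEN conjunct2, THEN conjunct2, THEN conjunct2,
          THEN spec, THEN spec, THEN spec, THEN mp]) (rule that)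
  \<comment> \<open>The bound of \<open>sim_runs\<close> for height \<open>length x\<close> and time
    \<open>p\<close>, with 2 more steps for writing the mark.\<close>
  define q where "q = p * ([:4, 2:] + 2 * p) + 2"
  have "\<exists>t \<le> poly q (length x). halts_with ((tm_step M ^^ t) (initial_config x)) (f x)" for x
  proof -
    define st st' where "st = empty_store(0 := rev (map bit_symbol x))"
      and "st' = empty_store(0 := rev (map bit_symbol (f x)))"
    define t0 where "t0 = (\<lambda>i. if 0 \<le> i \<and> nat i < length x then sy (x ! nat i) else bl)"
    obtain t where t: "t \<le> poly p (length x)" "runs c st t st'" using run by (auto simp: st_def st'_def)
    have nz: "0 \<notin> set (st j)" for j by (auto simp: st_def empty_store_def bit_symbol_def)
    have ln: "length (st j) \<le> length x" for j by (auto simp: st_def empty_store_def)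
    obtain n where n: "n \<le> t * (2 * (length x + t) + 4)"
      "(tmstep c ^^ n) (Scan c, tape_of k st, 0) = (Scan SKIP, tape_of k st', 0)"
      using sim_runs[OF ok self_in_pts t(2) nz ln] by blast
    have vec: "map (\<lambda>j. cellval ((empty_store(0 := rev (map bit_symbol y))) j) i) [0..<k]
        = (if i < length y then bit_symbol (y ! i) else 0) # replicate (k - 1) 0" for y i
      using k0 by (intro nth_equalityI) (auto simp: cellval_def empty_store_def nth_Cons split: nat.splits)
    have tape: "tape_of k (empty_store(0 := rev (map bit_symbol y))) (int i) = (if i < length y then sy (y ! i) else bl)" for y i
      unfolding tape_of_nonneg vec by (simp add: sy0 bl0)
    have t0s: "t0(-1 := Mark) = tape_of k st"
    proof
      fix i
      show "(t0(-1 := Mark)) i = tape_of k st i"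
      proof (cases "i \<ge> 0")
        case True
        then show ?thesis using tape[of x "nat i"] by (auto simp: t0_def st_def)
      next
        case False
        then show ?thesis by (auto simp: t0_def tape_of_def bl_def)
      qed
    qed
    have "(tmstep c ^^ 2) (Init0, t0, 0) = (Scan c, tape_of k st, 0)"
      by (simp add: numeral_2_eq_2 mstep_def t0s)
    then have fin: "(tmstep c ^^ (n + 2)) (Init0, t0, 0) = (Scan SKIP, tape_of k st', 0)"
      using n(2) unfolding funpow_add comp_apply by simp
    have t0G: "\<forall>i. t0 i \<in> G"
    proof
      fix i show "t0 i \<in> G" using Gbs by (cases "x ! nat i") (auto simp: t0_def)
    qed
    have init: "initial_config x = (0, eg \<circ> t0, 0)"
      using M by (auto simp: initial_config_def t0_def fun_eq_iff bit_symbol_def)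
    have "(tm_step M ^^ (n + 2)) (initial_config x) = (1, eg \<circ> tape_of k st', 0)"
      using sim[of t0 "n + 2" 0, OF t0G] fin M by (simp add: init)
    moreover have "halts_with (1, eg \<circ> tape_of k st', 0) (f x)"
      using M by (auto simp: halts_with_def st'_def tape bit_symbol_def simp del: tape_of_nonneg)
    moreover have "n + 2 \<le> poly q (length x)"
    proof -
      have "t * (2 * (length x + t) + 4) \<le> poly p (length x) * (2 * (length x + poly p (length x)) + 4)"
        using t(1) by (intro mult_mono) auto
      then show ?thesis using n(1) by (simp add: q_def algebra_simps)
    qed
    ultimately show ?thesis by metis
  qed
  then show ?thesis unfolding poly_time_def using M(1) by blast
qed

section \<open>Structured execution with time bounds\<close>

definition exec :: "com \<Rightarrow> store \<Rightarrow> nat \<Rightarrow> store \<Rightarrow> bool" where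
  "exec c st T st' \<longleftrightarrow> (\<exists>t \<le> T. runs c st t st')"

lemma exec_mono: "exec c st T st' \<Longrightarrow> T \<le> T' \<Longrightarrow> exec c st T' st'"
  by (auto simp: exec_def intro: order_trans)

lemma exec_SEQ: "exec a st T1 st1 \<Longrightarrow> exec b st1 T2 st2 \<Longrightarrow> exec (SEQ a b) st (T1 + T2 + 1) st2"
proof -
  assume "exec a st T1 st1" "exec b st1 T2 st2"
  then obtain t1 t2 where t: "t1 \<le> T1" "runs a st t1 st1" "t2 \<le> T2" "runs b st1 t2 st2" by (auto simp: exec_def)
  obtain t where "t \<le> Suc (t1 + t2)" "runs (SEQ a b) st t st2" using runs_SEQ[OF t(2,4)] by blast
  then show ?thesis using t(1,3) unfolding exec_def by (intro exI[of _ t]) simp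
qed

lemma exec_WHILE_done: "top_of (st j) = s \<Longrightarrow> exec (WHILE j s c) st 1 st"
  unfolding exec_def using runs_WHILE_done by blast

lemma exec_WHILE_step:
  "top_of (st j) \<noteq> s \<Longrightarrow> exec c st T1 st1 \<Longrightarrow> exec (WHILE j s c) st1 T2 st2
    \<Longrightarrow> exec (WHILE j s c) st (T1 + T2 + 2) st2"
proof -
  assume *: "top_of (st j) \<noteq> s" and "exec c st T1 st1" "exec (WHILE j s c) st1 T2 st2"
  then obtain t1 t2 where t: "t1 \<le> T1" "runs c st t1 st1" "t2 \<le> T2" "runs (WHILE j s c) st1 t2 st2"
    by (auto simp: exec_def)
  obtain t where "t \<le> t1 + t2 + 2" "runs (WHILE j s c) st t st2"
    using runs_WHILE_step[where c = c and s = s, OF * t(2,4)] by blast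
  then show ?thesis using t(1,3) unfolding exec_def by (intro exI[of _ t]) simp
qed

lemma exec_IFTOP_then: "top_of (st j) = s \<Longrightarrow> exec a st T st' \<Longrightarrow> exec (IFTOP j s a b) st (T + 1) st'"
proof -
  assume *: "top_of (st j) = s" "exec a st T st'"
  then obtain t where "t \<le> T" "runs a st t st'" by (auto simp: exec_def)
  then show ?thesis using runs_IFTOP[of st j s a b t st'] *(1) unfolding exec_def
    by (intro exI[of _ "Suc t"]) simp
qed

lemma exec_IFTOP_else: "top_of (st j) \<noteq> s \<Longrightarrow> exec b st T st' \<Longrightarrow> exec (IFTOP j s a b) st (T + 1) st'"
proof -
  assume *: "top_of (st j) \<noteq> s" "exec b st T st'"
  then obtain t where "t \<le> T" "runs b st t st'" by (auto simp: exec_def)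
  then show ?thesis using runs_IFTOP[of st j s a b t st'] *(1) unfolding exec_def
    by (intro exI[of _ "Suc t"]) simp
qed

fun loopfree :: "com \<Rightarrow> bool" where
  "loopfree (SEQ a b) = (loopfree a \<and> loopfree b)"
| "loopfree (IFTOP j s a b) = (loopfree a \<and> loopfree b)"
| "loopfree (WHILE j s c) = False"
| "loopfree c = True"

text \<open>Loop-free code is evaluated by the simplifier, with a crude time bound
  \<open>ctime\<close>; only loops need inductions of their own.\<close>

fun ev :: "com \<Rightarrow> store \<Rightarrow> store" where
  "ev (PUSH j s) st = st(j := s # st j)"
| "ev (POP j) st = st(j := tl (st j))"
| "ev (SEQ a b) st = ev b (ev a st)"
| "ev (IFTOP j s a b) st = (if top_of (st j) = s then ev a st else ev b st)"
| "ev c st = st"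

fun ctime :: "com \<Rightarrow> nat" where
  "ctime (SEQ a b) = ctime a + ctime b + 1"
| "ctime (IFTOP j s a b) = ctime a + ctime b + 1"
| "ctime c = 1"

lemma exec_ev: "loopfree c \<Longrightarrow> exec c st (ctime c) (ev c st)"
proof (induction c arbitrary: st)
  case SKIP
  show ?case unfolding exec_def using runs_SKIP by (metis ev.simps(5) zero_le)
next
  case (PUSH j s)
  show ?case unfolding exec_def using runs_PUSH by (metis ctime.simps(4) ev.simps(1) order_refl)
next
  case (POP j)
  show ?case unfolding exec_def using runs_POP by (metis ctime.simps(5) ev.simps(2) order_refl)
next
  case (SEQ a b)
  then have "exec a st (ctime a) (ev a st)" "exec b (ev a st) (ctime b) (ev b (ev a st))" by simp_all
  from exec_SEQ[OF this] show ?case by simp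
next
  case (IFTOP j s a b)
  show ?case
  proof (cases "top_of (st j) = s")
    case True
    then show ?thesis using exec_IFTOP_then[of st j s a "ctime a" "ev a st" b] IFTOP
      by (auto intro: exec_mono)
  next
    case False
    then show ?thesis using exec_IFTOP_else[of st j s b "ctime b" "ev b st" a] IFTOP
      by (auto intro: exec_mono)
  qed
qed auto

lemma exec_loopfree: "loopfree c \<Longrightarrow> ev c st = st' \<Longrightarrow> ctime c \<le> T \<Longrightarrow> exec c st T st'"
  using exec_ev exec_mono by blast

text \<open>Space is bounded by time. Below, this bounds the size of a result by the running time of
  the program that computes it.\<close>

lemma exec_length: "exec c st T st' \<Longrightarrow> length (st' j) \<le> length (st j) + T"
proof -
  have "length ((snd ((sstep ^^ t) (c, st))) j) \<le> length (st j) + t" for t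
  proof (induction t)
    case (Suc t)
    have "length ((snd (sstep cs)) j) \<le> Suc (length (snd cs j))" for cs
      by (cases "act_of (fst cs)") (auto simp: sstep_def apply_act_def)
    from this[of "(sstep ^^ t) (c, st)"] show ?case using Suc by simp
  qed auto
  note len = this
  assume "exec c st T st'"
  then obtain t where "t \<le> T" "(sstep ^^ t) (c, st) = (SKIP, st')" by (auto simp: exec_def runs_def)
  then show ?thesis using len[of t] by simp
qed

definition mk :: "nat list \<Rightarrow> nat list \<Rightarrow> nat list \<Rightarrow> nat list \<Rightarrow> store" where
  "mk a b c d = empty_store(0 := a, 1 := b, 2 := c, 3 := d)"

lemma mk_get [simp]:
  "mk a b c d 0 = a" "mk a b c d (Suc 0) = b" "mk a b c d 2 = c" "mk a b c d 3 = d"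
  by (simp_all add: mk_def)

lemma mk_upd [simp]:
  "(mk a b c d)(0 := x) = mk x b c d" "(mk a b c d)(Suc 0 := x) = mk a x c d"
  "(mk a b c d)(2 := x) = mk a b x d" "(mk a b c d)(3 := x) = mk a b c x"
  by (auto simp: mk_def fun_eq_iff)

fun pushes :: "nat \<Rightarrow> nat list \<Rightarrow> com" where
  "pushes j [] = SKIP"
| "pushes j (s # l) = SEQ (pushes j l) (PUSH j s)"

lemma ev_pushes: "ev (pushes j l) st = st(j := l @ st j)"
  by (induction l) auto

lemma loopfree_pushes [simp]: "loopfree (pushes j l)"
  by (induction l) auto

definition switch :: "nat \<Rightarrow> nat list \<Rightarrow> (nat \<Rightarrow> com) \<Rightarrow> com" where
  "switch j vs f = foldr (\<lambda>v c. IFTOP j v (f v) c) vs SKIP"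

lemma switch_simps [simp]: "switch j [] f = SKIP" "switch j (v # vs) f = IFTOP j v (f v) (switch j vs f)"
  by (simp_all add: switch_def)

lemma ev_switch: "ev (switch j vs f) st = (if top_of (st j) \<in> set vs then ev (f (top_of (st j))) st else st)"
  by (induction vs) auto

lemma loopfree_switch [simp]: "loopfree (switch j vs f) \<longleftrightarrow> (\<forall>v \<in> set vs. loopfree (f v))"
  by (induction vs) auto

lemma okc_switch [simp]: "okc B (switch j vs f) \<longleftrightarrow> vs = [] \<or> j < B \<and> (\<forall>v \<in> set vs. okc B (f v))"
  by (induction vs) auto

definition xfer :: "nat list \<Rightarrow> nat \<Rightarrow> nat \<Rightarrow> com" where
  "xfer vs i j = WHILE i 0 (switch i vs (\<lambda>v. SEQ (POP i) (PUSH j v)))"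

lemma ctime_switch_xfer: "ctime (switch i vs (\<lambda>v. SEQ (POP i) (PUSH j v))) \<le> 1 + 4 * length vs"
  by (induction vs) auto

lemma exec_xfer:
  assumes "i \<noteq> j" "set l \<subseteq> set vs" "0 \<notin> set vs"
  shows "exec (xfer vs i j) (st(i := l, j := m)) ((4 * length vs + 3) * length l + 1) (st(i := [], j := rev l @ m))"
  using assms(2)
proof (induction l arbitrary: m)
  case Nil
  have "exec (xfer vs i j) (st(i := [], j := m)) 1 (st(i := [], j := m))"
    unfolding xfer_def by (rule exec_WHILE_done) (use assms(1) in auto)
  then show ?case unfolding list.size mult_0_right add_0 rev.simps append_Nil .
next
  case (Cons v l)
  let ?b = "switch i vs (\<lambda>v. SEQ (POP i) (PUSH j v))"
  have v: "v \<in> set vs" using Cons.prems by simp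
  then have v0: "v \<noteq> 0" using assms(3) by metis
  have "exec ?b (st(i := v # l, j := m)) (1 + 4 * length vs) (st(i := l, j := v # m))"
    by (rule exec_loopfree) (use v v0 assms(1) ctime_switch_xfer in \<open>auto simp: ev_switch fun_upd_twist\<close>)
  moreover have "exec (xfer vs i j) (st(i := l, j := v # m)) ((4 * length vs + 3) * length l + 1) (st(i := [], j := rev l @ v # m))"
    by (rule Cons.IH[of "v # m"]) (use Cons.prems in simp)
  ultimately have e: "exec (xfer vs i j) (st(i := v # l, j := m))
     (1 + 4 * length vs + ((4 * length vs + 3) * length l + 1) + 2) (st(i := [], j := rev l @ v # m))"
    unfolding xfer_def by (rule exec_WHILE_step[rotated]) (use v0 assms(1) in simp)
  have "exec (xfer vs i j) (st(i := v # l, j := m)) ((4 * length vs + 3) * length (v # l) + 1) (st(i := [], j := rev (v # l) @ m))"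
    using exec_mono[OF e, of "(4 * length vs + 3) * length (v # l) + 1"] by simp
  then show ?case .
qed

section \<open>Trees on the data stack\<close>

datatype D = N | C D D

fun tok :: "D \<Rightarrow> nat list" where
  "tok N = [1]"
| "tok (C a b) = 2 # tok a @ tok b"

lemma set_tok: "set (tok x) \<subseteq> {1, 2}"
  by (induction x) auto

lemma tok_nonempty [simp]: "tok x \<noteq> []"
  by (cases x) auto

lemma top_of_append [simp]: "l \<noteq> [] \<Longrightarrow> top_of (l @ m) = top_of l"
  by (cases l) auto

abbreviation dlen :: "D \<Rightarrow> nat" where "dlen x \<equiv> length (tok x)"

lemma dlen_pos: "1 \<le> dlen x"
  by (cases x) auto

text \<open>Stack 2 counts the subtrees that still have to be read.\<close>

definition MOVE_body :: com where
  "MOVE_body = IFTOP 0 1 (SEQ (POP 0) (SEQ (PUSH 1 1) (POP 2))) (SEQ (POP 0) (SEQ (PUSH 1 2) (PUSH 2 1)))"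

definition MOVE :: com where
  "MOVE = SEQ (PUSH 2 1) (WHILE 2 0 MOVE_body)"

lemma exec_MOVE_body:
  "exec MOVE_body (mk (1 # S) A (1 # K) Z) 12 (mk S (1 # A) K Z)"
  "exec MOVE_body (mk (2 # S) A (1 # K) Z) 12 (mk S (2 # A) (1 # 1 # K) Z)"
  by (rule exec_loopfree; simp add: MOVE_body_def)+

text \<open>The loop does not stop between two subtrees. The statement therefore assumes the rest of
  the run and extends it backwards by one tree, so that the induction hypotheses for the two
  subtrees can be chained.\<close>

lemma exec_MOVE_loop:
  "exec (WHILE 2 0 MOVE_body) (mk S (rev (tok x) @ A) K Z) T st' \<Longrightarrow>
   exec (WHILE 2 0 MOVE_body) (mk (tok x @ S) A (1 # K) Z) (T + 14 * dlen x) st'"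
proof (induction x arbitrary: S A K T st')
  case N
  have "exec (WHILE 2 0 MOVE_body) (mk S (1 # A) K Z) T st'" using N by simp
  from exec_WHILE_step[OF _ exec_MOVE_body(1) this] show ?case by (simp add: add.commute)
next
  case (C a b)
  have "exec (WHILE 2 0 MOVE_body) (mk (tok b @ S) (rev (tok a) @ 2 # A) (1 # K) Z) (T + 14 * dlen b) st'"
    by (rule C.IH(2)) (use C.prems in simp)
  from C.IH(1)[OF this]
  have "exec (WHILE 2 0 MOVE_body) (mk (tok a @ tok b @ S) (2 # A) (1 # 1 # K) Z) (T + 14 * dlen b + 14 * dlen a) st'" .
  from exec_WHILE_step[OF _ exec_MOVE_body(2) this]
  show ?case by (simp add: algebra_simps)
qed

lemma exec_MOVE:
  "exec MOVE (mk (tok x @ S) A [] Z) (17 * dlen x) (mk S (rev (tok x) @ A) [] Z)"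
proof -
  have 1: "exec (PUSH 2 1) (mk (tok x @ S) A [] Z) 1 (mk (tok x @ S) A [1] Z)"
    by (rule exec_loopfree) auto
  have "exec (WHILE 2 0 MOVE_body) (mk S (rev (tok x) @ A) [] Z) 1 (mk S (rev (tok x) @ A) [] Z)"
    by (rule exec_WHILE_done) simp
  from exec_MOVE_loop[OF this] exec_SEQ[OF 1]
  have "exec MOVE (mk (tok x @ S) A [] Z) (1 + (1 + 14 * dlen x) + 1) (mk S (rev (tok x) @ A) [] Z)"
    unfolding MOVE_def by blast
  then show ?thesis by (rule exec_mono) (use dlen_pos[of x] in simp)
qed

lemma xfer_mk:
  assumes "set l \<subseteq> {1, 2}"
  shows "exec (xfer [1,2] 1 3) (mk S l K []) (12 * length l + 1) (mk S [] K (rev l))"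
    "exec (xfer [1,2] 3 2) (mk S A [] l) (12 * length l + 1) (mk S A (rev l) [])"
    "exec (xfer [1,2] 2 0) (mk S A l Z) (12 * length l + 1) (mk (rev l @ S) A [] Z)"
    "exec (xfer [1,2] 1 0) (mk S l K Z) (12 * length l + 1) (mk (rev l @ S) [] K Z)"
    "exec (xfer [1,2] 1 2) (mk S l [] Z) (12 * length l + 1) (mk S [] (rev l) Z)"
proof -
  have *: "exec (xfer [1,2] i j) (st(i := l, j := m)) (12 * length l + 1) (st(i := [], j := rev l @ m))"
    if "i \<noteq> j" for i j m st
    by (rule exec_mono[OF exec_xfer[OF that]]) (use assms in auto)
  show "exec (xfer [1,2] 1 3) (mk S l K []) (12 * length l + 1) (mk S [] K (rev l))"
    using *[of 1 3 "mk S l K []" "[]"] by simp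
  show "exec (xfer [1,2] 3 2) (mk S A [] l) (12 * length l + 1) (mk S A (rev l) [])"
    using *[of 3 2 "mk S A [] l" "[]"] by simp
  show "exec (xfer [1,2] 2 0) (mk S A l Z) (12 * length l + 1) (mk (rev l @ S) A [] Z)"
    using *[of 2 0 "mk S A l Z" S] by simp
  show "exec (xfer [1,2] 1 0) (mk S l K Z) (12 * length l + 1) (mk (rev l @ S) [] K Z)"
    using *[of 1 0 "mk S l K Z" S] by simp
  show "exec (xfer [1,2] 1 2) (mk S l [] Z) (12 * length l + 1) (mk S [] (rev l) Z)"
    using *[of 1 2 "mk S l [] Z" "[]"] by simp
qed

definition CLEAR :: "nat \<Rightarrow> com" where "CLEAR j = WHILE j 0 (POP j)"

lemma exec_CLEAR: "0 \<notin> set l \<Longrightarrow> exec (CLEAR j) (st(j := l)) (3 * length l + 1) (st(j := []))"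
proof (induction l)
  case Nil
  have "exec (CLEAR j) (st(j := [])) 1 (st(j := []))" unfolding CLEAR_def by (rule exec_WHILE_done) auto
  then show ?case unfolding list.size mult_0_right add_0 .
next
  case (Cons v l)
  have "exec (POP j) (st(j := v # l)) 1 (st(j := l))" by (rule exec_loopfree) auto
  moreover have "exec (CLEAR j) (st(j := l)) (3 * length l + 1) (st(j := []))" by (rule Cons.IH) (use Cons.prems in simp)
  ultimately have "exec (CLEAR j) (st(j := v # l)) (1 + (3 * length l + 1) + 2) (st(j := []))"
    unfolding CLEAR_def by (rule exec_WHILE_step[rotated]) (use Cons.prems in auto)
  then show ?case by (rule exec_mono) simp
qed

definition DROP :: com where "DROP = SEQ MOVE (CLEAR 1)"
text \<open>Every transfer reverses. The second copy ends up on stack 3 in the right order, so it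
  reaches stack 0 by way of stack 2.\<close>

definition DUPL :: com where
  "DUPL = SEQ MOVE (SEQ (WHILE 1 0 (IFTOP 1 1 (SEQ (POP 1) (SEQ (PUSH 0 1) (PUSH 3 1)))
     (SEQ (POP 1) (SEQ (PUSH 0 2) (PUSH 3 2))))) (SEQ (xfer [1,2] 3 2) (xfer [1,2] 2 0)))"
definition SWAP :: com where
  "SWAP = SEQ MOVE (SEQ (xfer [1,2] 1 3) (SEQ MOVE (SEQ (xfer [1,2] 3 2) (SEQ (xfer [1,2] 2 0) (xfer [1,2] 1 0)))))"

abbreviation ds :: "nat list \<Rightarrow> store" where "ds S \<equiv> mk S [] [] []"

lemma set_rev_tok: "set (rev (tok x)) \<subseteq> {1, 2}" "0 \<notin> set (rev (tok x))"
  using set_tok[of x] by auto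

lemma exec_DROP: "exec DROP (ds (tok x @ S)) (25 * dlen x) (ds S)"
proof -
  have "exec (CLEAR 1) (mk S (rev (tok x)) [] []) (3 * dlen x + 1) (ds S)"
    using exec_CLEAR[of "rev (tok x)" 1 "mk S (rev (tok x)) [] []"] set_rev_tok(2)[of x] by simp
  from exec_SEQ[OF exec_MOVE[of x S "[]" "[]", unfolded append_Nil2] this]
  have "exec DROP (ds (tok x @ S)) (17 * dlen x + (3 * dlen x + 1) + 1) (ds S)" by (simp add: DROP_def)
  then show ?thesis by (rule exec_mono) (use dlen_pos[of x] in simp)
qed

lemma exec_copy_loop:
  assumes "set l \<subseteq> {1, 2}"
  shows "exec (WHILE 1 0 (IFTOP 1 1 (SEQ (POP 1) (SEQ (PUSH 0 1) (PUSH 3 1)))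
     (SEQ (POP 1) (SEQ (PUSH 0 2) (PUSH 3 2))))) (mk S l [] Z) (15 * length l + 1) (mk (rev l @ S) [] [] (rev l @ Z))"
  using assms
proof (induction l arbitrary: S Z)
  case Nil
  then show ?case using exec_WHILE_done by simp
next
  case (Cons v l)
  let ?b = "IFTOP 1 1 (SEQ (POP 1) (SEQ (PUSH 0 1) (PUSH 3 1))) (SEQ (POP 1) (SEQ (PUSH 0 2) (PUSH 3 2)))"
  have "exec ?b (mk S (v # l) [] Z) 12 (mk (v # S) l [] (v # Z))"
    by (rule exec_loopfree) (use Cons.prems in auto)
  moreover have "exec (WHILE 1 0 ?b) (mk (v # S) l [] (v # Z)) (15 * length l + 1) (mk (rev l @ v # S) [] [] (rev l @ v # Z))"
    using Cons by auto
  ultimately have "exec (WHILE 1 0 ?b) (mk S (v # l) [] Z) (12 + (15 * length l + 1) + 2) (mk (rev l @ v # S) [] [] (rev l @ v # Z))"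
    by (rule exec_WHILE_step[rotated]) (use Cons.prems in auto)
  then have "exec (WHILE 1 0 ?b) (mk S (v # l) [] Z) (15 * length (v # l) + 1) (mk (rev l @ v # S) [] [] (rev l @ v # Z))"
    by (rule exec_mono) simp
  then show ?case by simp
qed

lemma exec_DUPL: "exec DUPL (ds (tok x @ S)) (70 * dlen x) (ds (tok x @ tok x @ S))"
proof -
  have e: "exec DUPL (ds (tok x @ S)) (17 * dlen x + ((15 * dlen x + 1) + ((12 * dlen x + 1) + (12 * dlen x + 1) + 1) + 1) + 1)
     (ds (tok x @ tok x @ S))"
    unfolding DUPL_def
    using exec_SEQ[OF exec_MOVE exec_SEQ[OF exec_copy_loop[of "rev (tok x) @ []" S "[]"]
        exec_SEQ[OF xfer_mk(2)[of "rev (rev (tok x) @ []) @ []" "rev (rev (tok x) @ []) @ S" "[]"]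
          xfer_mk(3)[of "rev (rev (rev (tok x) @ []) @ [])" "rev (rev (tok x) @ []) @ S" "[]" "[]"]]]]
      set_tok[of x] by simp
  then show ?thesis by (rule exec_mono) (use dlen_pos[of x] in simp)
qed

lemma exec_SWAP: "exec SWAP (ds (tok x @ tok y @ S)) (100 * (dlen x + dlen y)) (ds (tok y @ tok x @ S))"
proof -
  have "exec SWAP (ds (tok x @ tok y @ S)) (17 * dlen x + ((12 * dlen x + 1) + (17 * dlen y + ((12 * dlen x + 1)
      + ((12 * dlen x + 1) + (12 * dlen y + 1) + 1) + 1) + 1) + 1) + 1)
     (ds (tok y @ tok x @ S))"
    unfolding SWAP_def
    using exec_SEQ[OF exec_MOVE[of x "tok y @ S" "[]" "[]"] exec_SEQ[OF xfer_mk(1)[of "rev (tok x) @ []" "tok y @ S" "[]"]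
      exec_SEQ[OF exec_MOVE exec_SEQ[OF xfer_mk(2)[of "rev (rev (tok x) @ [])" S "rev (tok y) @ []"]
        exec_SEQ[OF xfer_mk(3)[of "rev (rev (rev (tok x) @ []))" S "rev (tok y) @ []" "[]"]
          xfer_mk(4)[of "rev (tok y) @ []" "rev (rev (rev (rev (tok x) @ []))) @ S" "[]" "[]"]]]]]]
      set_tok[of x] set_tok[of y] by (simp add: algebra_simps)
  then show ?thesis by (rule exec_mono) (use dlen_pos[of x] dlen_pos[of y] in simp)
qed

lemma okc_tree_ops [simp]: "4 \<le> B \<Longrightarrow> okc B MOVE" "4 \<le> B \<Longrightarrow> okc B DROP" "4 \<le> B \<Longrightarrow> okc B DUPL" "4 \<le> B \<Longrightarrow> okc B SWAP"
  by (auto simp: MOVE_def MOVE_body_def DROP_def DUPL_def SWAP_def CLEAR_def xfer_def)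

section \<open>Polynomial-time functions on encodable types\<close>

text \<open>Natural numbers are encoded in unary; binary numbers will be a type of their own.\<close>

class enc = fixes enc :: "'a \<Rightarrow> D"

abbreviation toke :: "'a::enc \<Rightarrow> nat list" where "toke x \<equiv> tok (enc x)"
abbreviation esize :: "'a::enc \<Rightarrow> nat" where "esize x \<equiv> dlen (enc x)"

instantiation bool :: enc
begin
definition enc_bool :: "bool \<Rightarrow> D" where "enc_bool b = (if b then C N N else N)"
instance ..
end

instantiation nat :: enc
begin
fun enc_nat :: "nat \<Rightarrow> D" where "enc_nat 0 = N" | "enc_nat (Suc n) = C N (enc_nat n)"
instance ..
end

instantiation prod :: (enc, enc) enc
begin
definition enc_prod :: "'a \<times> 'b \<Rightarrow> D" where "enc_prod p = C (enc (fst p)) (enc (snd p))"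
instance ..
end

instantiation list :: (enc) enc
begin
fun enc_list :: "'a list \<Rightarrow> D" where "enc_list [] = N" | "enc_list (a # l) = C (enc a) (enc_list l)"
instance ..
end

text \<open>Domination by a polynomial suffices, so running times can stay in the shape in which
  \<open>exec_SEQ\<close> produces them; the rules \<open>pbi\<close> follow that shape.\<close>

definition pbound :: "(nat \<Rightarrow> nat) \<Rightarrow> bool" where
  "pbound g \<longleftrightarrow> (\<exists>p :: nat poly. \<forall>n. g n \<le> poly p n)"

named_theorems pbi

lemma pbound_const [pbi]: "pbound (\<lambda>n. k)"
  unfolding pbound_def by (rule exI[of _ "[:k:]"]) simp

lemma pbound_id [pbi]: "pbound (\<lambda>n. n)"
  unfolding pbound_def by (rule exI[of _ "[:0, 1:]"]) simp

lemma pbound_add [pbi]: "pbound f \<Longrightarrow> pbound g \<Longrightarrow> pbound (\<lambda>n. f n + g n)"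
  unfolding pbound_def by (metis add_mono poly_add)

lemma pbound_mult [pbi]: "pbound f \<Longrightarrow> pbound g \<Longrightarrow> pbound (\<lambda>n. f n * g n)"
  unfolding pbound_def by (metis mult_mono poly_mult zero_le)

lemma pbound_poly [pbi]: "pbound f \<Longrightarrow> pbound (\<lambda>n. poly (p :: nat poly) (f n))"
  unfolding pbound_def by (metis mono_poly_nat poly_pcompose)

text \<open>The argument is a tree in prefix notation on top of stack 0, where it is replaced by the result;
  stacks 1 to 3 are scratch space.\<close>

definition ptime :: "('a::enc \<Rightarrow> 'b::enc) \<Rightarrow> bool" where
  "ptime f \<longleftrightarrow> (\<exists>c B (p :: nat poly). okc B c \<and>
     (\<forall>x S. exec c (ds (toke x @ S)) (poly p (esize x)) (ds (toke (f x) @ S))))"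

lemma ptimeI:
  assumes "okc B c" "pbound g" "\<And>x S. exec c (ds (toke x @ S)) (g (esize x)) (ds (toke (f x) @ S))"
  shows "ptime f"
  using assms unfolding ptime_def pbound_def by (meson exec_mono)

lemma ptimeE:
  assumes "ptime f"
  obtains c B p where "4 \<le> B" "okc B c"
    "\<And>x S. exec c (ds (toke x @ S)) (poly (p :: nat poly) (esize x)) (ds (toke (f x) @ S))"
    "\<And>x. esize (f x) \<le> esize x + poly p (esize x)"
proof -
  obtain c B p where *: "okc B c"
    "\<And>x S. exec c (ds (toke x @ S)) (poly (p :: nat poly) (esize x)) (ds (toke (f x) @ S))"
    using assms unfolding ptime_def by blast
  have "esize (f x) \<le> esize x + poly p (esize x)" for x
    using exec_length[OF *(2)[of x "[]"], of 0] by simp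
  moreover have "okc (B + 4) c" using *(1) okc_mono by simp
  ultimately show ?thesis using that[of "B + 4" c p] *(2) by simp
qed

lemma ptime_size: "ptime f \<Longrightarrow> \<exists>p :: nat poly. \<forall>x. esize (f x) \<le> poly p (esize x)"
proof -
  assume "ptime f"
  then obtain p where "\<And>x. esize (f x) \<le> esize x + poly (p :: nat poly) (esize x)" by (metis ptimeE)
  then show ?thesis by (intro exI[of _ "[:0,1:] + p"]) simp
qed

text \<open>Programs see codes only. A nonempty list has the code of a pair, and a successor that of
  a pair with \<open>False\<close>, so operations carry over between types without any new
  program.\<close>

lemma ptime_recode: "ptime f \<Longrightarrow> (\<And>x. enc (g x) = enc (f x)) \<Longrightarrow> ptime g"
  unfolding ptime_def by simp

named_theorems pti

lemma ptime_ident [pti]: "ptime (\<lambda>x. x)"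
  by (rule ptimeI[of 4 SKIP "\<lambda>_. 1"]) (auto intro: pbi exec_loopfree)

lemma ptime_compose:
  assumes "ptime g" "ptime f" shows "ptime (\<lambda>x. g (f x))"
proof -
  obtain cf Bf pf where f: "okc Bf cf"
    "\<And>x S. exec cf (ds (toke x @ S)) (poly (pf :: nat poly) (esize x)) (ds (toke (f x) @ S))"
    "\<And>x. esize (f x) \<le> esize x + poly pf (esize x)" using ptimeE[OF assms(2)] by metis
  obtain cg Bg pg where g: "okc Bg cg"
    "\<And>x S. exec cg (ds (toke x @ S)) (poly (pg :: nat poly) (esize x)) (ds (toke (g x) @ S))"
    using ptimeE[OF assms(1)] by metis
  show ?thesis
  proof (rule ptimeI[of "Bf + Bg" "SEQ cf cg"])
    show "okc (Bf + Bg) (SEQ cf cg)" using f(1) g(1) okc_mono by simp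
    show "pbound (\<lambda>n. poly pf n + poly pg (n + poly pf n) + 1)" by (intro pbi)
    fix x S
    show "exec (SEQ cf cg) (ds (toke x @ S)) (poly pf (esize x) + poly pg (esize x + poly pf (esize x)) + 1) (ds (toke (g (f x)) @ S))"
      using exec_SEQ[OF f(2) exec_mono[OF g(2) mono_poly_nat[OF f(3)]]] .
  qed
qed

lemma dlen_prod [simp]: "esize (a, b) = 1 + esize a + esize b"
  by (simp add: enc_prod_def)

text \<open>The second component is computed first, because in prefix notation the first one lies on
  top.\<close>

lemma ptime_Pair [pti]:
  assumes "ptime f" "ptime g" shows "ptime (\<lambda>x. (f x, g x))"
proof -
  obtain cf Bf pf where f: "okc Bf cf" "4 \<le> Bf"
    "\<And>x S. exec cf (ds (toke x @ S)) (poly (pf :: nat poly) (esize x)) (ds (toke (f x) @ S))"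
    using ptimeE[OF assms(1)] by metis
  obtain cg Bg pg where g: "okc Bg cg"
    "\<And>x S. exec cg (ds (toke x @ S)) (poly (pg :: nat poly) (esize x)) (ds (toke (g x) @ S))"
    "\<And>x. esize (g x) \<le> esize x + poly pg (esize x)"
    using ptimeE[OF assms(2)] by metis
  let ?c = "SEQ DUPL (SEQ cg (SEQ SWAP (SEQ cf (PUSH 0 2))))"
  let ?T = "\<lambda>n. 70 * n + (poly pg n + (100 * (n + poly pg n + n) + (poly pf n + 1 + 1) + 1) + 1) + 1"
  show ?thesis
  proof (rule ptimeI[of "Bf + Bg" ?c])
    show "okc (Bf + Bg) ?c" using f(1,2) g(1) okc_mono by simp
    show "pbound ?T" by (intro pbi)
    fix x S
    have "exec (PUSH 0 2) (ds (toke (f x) @ toke (g x) @ S)) 1 (ds (toke (f x, g x) @ S))"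
      by (rule exec_loopfree) (auto simp: enc_prod_def)
    from exec_SEQ[OF exec_DUPL exec_SEQ[OF g(2) exec_SEQ[OF exec_SWAP exec_SEQ[OF f(3) this]]]]
    show "exec ?c (ds (toke x @ S)) (?T (esize x)) (ds (toke (f x, g x) @ S))"
      by (rule exec_mono) (use g(3)[of x] in auto)
  qed
qed

lemma ptime_fst: "ptime (fst :: 'a::enc \<times> 'b::enc \<Rightarrow> 'a)"
proof (rule ptimeI[of 4 "SEQ (POP 0) (SEQ SWAP DROP)"])
  show "pbound (\<lambda>n. 1 + (100 * (n + n) + 25 * n + 1) + 1)" by (intro pbi)
  fix x :: "'a \<times> 'b" and S
  have "exec (POP 0) (ds (toke x @ S)) 1 (ds (toke (fst x) @ toke (snd x) @ S))"
    by (rule exec_loopfree) (auto simp: enc_prod_def)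
  from exec_SEQ[OF this exec_SEQ[OF exec_SWAP exec_DROP]]
  show "exec (SEQ (POP 0) (SEQ SWAP DROP)) (ds (toke x @ S)) (1 + (100 * (esize x + esize x) + 25 * esize x + 1) + 1) (ds (toke (fst x) @ S))"
    by (rule exec_mono) (auto simp: enc_prod_def)
qed simp

lemma ptime_snd: "ptime (snd :: 'a::enc \<times> 'b::enc \<Rightarrow> 'b)"
proof (rule ptimeI[of 4 "SEQ (POP 0) DROP"])
  show "pbound (\<lambda>n. 1 + 25 * n + 1)" by (intro pbi)
  fix x :: "'a \<times> 'b" and S
  have "exec (POP 0) (ds (toke x @ S)) 1 (ds (toke (fst x) @ toke (snd x) @ S))"
    by (rule exec_loopfree) (auto simp: enc_prod_def)
  from exec_SEQ[OF this exec_DROP]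
  show "exec (SEQ (POP 0) DROP) (ds (toke x @ S)) (1 + 25 * esize x + 1) (ds (toke (snd x) @ S))"
    by (rule exec_mono) (auto simp: enc_prod_def)
qed simp

lemmas ptime_fst' [pti] = ptime_compose[OF ptime_fst]
lemmas ptime_snd' [pti] = ptime_compose[OF ptime_snd]

lemma ptime_const [pti]: "ptime (\<lambda>x. k)"
proof (rule ptimeI[of 4 "SEQ DROP (pushes 0 (toke k))"])
  have "okc 4 (pushes 0 l)" if "set l \<subseteq> {1, 2}" for l using that by (induction l) auto
  then show "okc 4 (SEQ DROP (pushes 0 (toke k)))" using set_tok by simp
  show "pbound (\<lambda>n. 25 * n + ctime (pushes 0 (toke k)) + 1)" by (intro pbi)
  fix x S
  show "exec (SEQ DROP (pushes 0 (toke k))) (ds (toke x @ S)) (25 * esize x + ctime (pushes 0 (toke k)) + 1) (ds (toke k @ S))"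
    by (intro exec_SEQ[OF exec_DROP] exec_loopfree) (auto simp: ev_pushes)
qed

lemma ptime_Cons [pti]: "ptime f \<Longrightarrow> ptime g \<Longrightarrow> ptime (\<lambda>x. f x # g x)"
  by (rule ptime_recode[OF ptime_Pair]) (auto simp: enc_prod_def)

lemma ptime_Suc [pti]: "ptime f \<Longrightarrow> ptime (\<lambda>x. Suc (f x))"
  by (rule ptime_recode[OF ptime_Pair[OF ptime_const[of False]]]) (auto simp: enc_prod_def enc_bool_def)

lemma ptime_if [pti]:
  assumes "ptime b" "ptime f" "ptime g" shows "ptime (\<lambda>x. if b x then f x else g x)"
proof -
  obtain cb Bb pb where b: "okc Bb cb" "4 \<le> Bb"
    "\<And>x S. exec cb (ds (toke x @ S)) (poly (pb :: nat poly) (esize x)) (ds (toke (b x) @ S))"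
    using ptimeE[OF assms(1)] by metis
  obtain cf Bf pf where f: "okc Bf cf"
    "\<And>x S. exec cf (ds (toke x @ S)) (poly (pf :: nat poly) (esize x)) (ds (toke (f x) @ S))"
    using ptimeE[OF assms(2)] by metis
  obtain cg Bg pg where g: "okc Bg cg"
    "\<And>x S. exec cg (ds (toke x @ S)) (poly (pg :: nat poly) (esize x)) (ds (toke (g x) @ S))"
    using ptimeE[OF assms(3)] by metis
  let ?c = "SEQ DUPL (SEQ cb (IFTOP 0 1 (SEQ (POP 0) cg) (SEQ DROP cf)))"
  \<comment> \<open>75 is 25 * 3: the code of \<open>True\<close> has three tokens, and it has to be
    dropped.\<close>
  let ?T = "\<lambda>n. 70 * n + (poly pb n + (75 + poly pf n + poly pg n + 1 + 1) + 1) + 1"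
  show ?thesis
  proof (rule ptimeI[of "Bb + Bf + Bg" ?c])
    show "okc (Bb + Bf + Bg) ?c" using b(1,2) f(1) g(1) okc_mono by simp
    show "pbound ?T" by (intro pbi)
    fix x S
    have "exec (IFTOP 0 1 (SEQ (POP 0) cg) (SEQ DROP cf)) (ds (toke (b x) @ toke x @ S))
      (75 + poly pf (esize x) + poly pg (esize x) + 1 + 1) (ds (toke (if b x then f x else g x) @ S))"
    proof (cases "b x")
      case True
      have "exec (SEQ DROP cf) (ds (toke (b x) @ toke x @ S)) (25 * esize (b x) + poly pf (esize x) + 1) (ds (toke (f x) @ S))"
        by (rule exec_SEQ[OF exec_DROP f(2)])
      then show ?thesis using True
        by (intro exec_IFTOP_else) (auto simp: enc_bool_def elim!: exec_mono)
    next
      case False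
      have "exec (POP 0) (ds (toke (b x) @ toke x @ S)) 1 (ds (toke x @ S))"
        by (rule exec_loopfree) (use False in \<open>auto simp: enc_bool_def\<close>)
      from exec_SEQ[OF this g(2)] show ?thesis using False
        by (intro exec_IFTOP_then) (auto simp: enc_bool_def elim!: exec_mono)
    qed
    from exec_SEQ[OF exec_DUPL exec_SEQ[OF b(3) this]]
    show "exec ?c (ds (toke x @ S)) (?T (esize x)) (ds (toke (if b x then f x else g x) @ S))" .
  qed
qed

text \<open>A nonempty list is coded as the pair of its head and tail. One constructor token in
  front of \<open>x\<close> and the list thus yields the code of \<open>(x, a, l')\<close> with
  nothing unpacked.\<close>

lemma ptime_case_list [pti]:
  assumes "ptime l" "ptime f" "ptime (\<lambda>(x, a, l'). g x a l')"
  shows "ptime (\<lambda>x::'a::enc. case l x of [] \<Rightarrow> f x | a # l' \<Rightarrow> g x a l')"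
proof -
  obtain cb Bb pb where b: "okc Bb cb" "4 \<le> Bb"
    "\<And>x S. exec cb (ds (toke x @ S)) (poly (pb :: nat poly) (esize x)) (ds (toke (l x) @ S))"
    "\<And>x. esize (l x) \<le> esize x + poly pb (esize x)"
    using ptimeE[OF assms(1)] by metis
  obtain cf Bf pf where f: "okc Bf cf"
    "\<And>x S. exec cf (ds (toke x @ S)) (poly (pf :: nat poly) (esize x)) (ds (toke (f x) @ S))"
    using ptimeE[OF assms(2)] by metis
  obtain cg Bg pg where g: "okc Bg cg"
    "\<And>x S. exec cg (ds (toke x @ S)) (poly (pg :: nat poly) (esize x)) (ds (toke ((\<lambda>(x, a, l'). g x a l') x) @ S))"
    using ptimeE[OF assms(3)] by metis
  let ?c = "SEQ DUPL (SEQ cb (IFTOP 0 1 (SEQ (POP 0) cf) (SEQ SWAP (SEQ (PUSH 0 2) cg))))"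
  let ?G = "\<lambda>n. (100 * (n + poly pb n + n) + (1 + poly pg (1 + n + n + poly pb n) + 1) + 1)"
  let ?T = "\<lambda>n. 70 * n + (poly pb n + ((1 + poly pf n + 1) + ?G n + 1) + 1) + 1"
  let ?r = "\<lambda>x. case l x of [] \<Rightarrow> f x | a # l' \<Rightarrow> g x a l'"
  show ?thesis
  proof (rule ptimeI[of "Bb + Bf + Bg" ?c])
    show "okc (Bb + Bf + Bg) ?c" using b(1,2) f(1) g(1) okc_mono by simp
    show "pbound ?T" by (intro pbi)
    fix x :: 'a and S
    let ?n = "esize x"
    have "exec (IFTOP 0 1 (SEQ (POP 0) cf) (SEQ SWAP (SEQ (PUSH 0 2) cg))) (ds (toke (l x) @ toke x @ S))
      ((1 + poly pf ?n + 1) + ?G ?n + 1) (ds (toke (?r x) @ S))"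
    proof (cases "l x")
      case (Cons a l')
      have "exec (PUSH 0 2) (ds (toke x @ toke (l x) @ S)) 1 (ds (toke (x, a, l') @ S))"
        by (rule exec_loopfree) (auto simp: Cons enc_prod_def)
      moreover have "exec cg (ds (toke (x, a, l') @ S)) (poly pg (1 + ?n + ?n + poly pb ?n)) (ds (toke (?r x) @ S))"
        using g(2)[of "(x, a, l')" S] b(4)[of x] Cons by (auto elim!: exec_mono intro!: mono_poly_nat)
      ultimately have "exec (SEQ (PUSH 0 2) cg) (ds (toke x @ toke (l x) @ S)) (1 + poly pg (1 + ?n + ?n + poly pb ?n) + 1) (ds (toke (?r x) @ S))"
        by (rule exec_SEQ)
      from exec_SEQ[OF exec_SWAP this]
      have "exec (SEQ SWAP (SEQ (PUSH 0 2) cg)) (ds (toke (l x) @ toke x @ S)) (?G ?n) (ds (toke (?r x) @ S))"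
        by (rule exec_mono) (use b(4)[of x] in auto)
      then show ?thesis
        by (intro exec_IFTOP_else) (auto simp: Cons elim!: exec_mono)
    next
      case Nil
      have "exec (POP 0) (ds (toke (l x) @ toke x @ S)) 1 (ds (toke x @ S))"
        by (rule exec_loopfree) (use Nil in auto)
      from exec_SEQ[OF this f(2)] show ?thesis
        by (intro exec_IFTOP_then) (auto simp: Nil elim!: exec_mono)
    qed
    from exec_SEQ[OF exec_DUPL exec_SEQ[OF b(3) this]]
    show "exec ?c (ds (toke x @ S)) (?T ?n) (ds (toke (?r x) @ S))" .
  qed
qed

text \<open>The list only serves as a counter. Without the size bound on all intermediate states,
  repeated doubling would already lead out of polynomial time.\<close>

lemma ptime_iterate:
  fixes l :: "'e::enc \<Rightarrow> 'b::enc list" and f :: "'s::enc \<Rightarrow> 's"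
  assumes "ptime l" "ptime i" "ptime f"
    and bnd: "\<And>e k. k \<le> length (l e) \<Longrightarrow> esize ((f ^^ k) (i e)) \<le> poly (q :: nat poly) (esize e)"
  shows "ptime (\<lambda>e. (f ^^ length (l e)) (i e))"
proof -
  obtain cl Bl pl where l: "okc Bl cl" "4 \<le> Bl"
    "\<And>x S. exec cl (ds (toke x @ S)) (poly (pl :: nat poly) (esize x)) (ds (toke (l x) @ S))"
    "\<And>x. esize (l x) \<le> esize x + poly pl (esize x)"
    using ptimeE[OF assms(1)] by metis
  obtain ci Bi pj where i: "okc Bi ci"
    "\<And>x S. exec ci (ds (toke x @ S)) (poly (pj :: nat poly) (esize x)) (ds (toke (i x) @ S))"
    using ptimeE[OF assms(2)] by metis
  obtain cf Bf pf where f: "okc Bf cf"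
    "\<And>x S. exec cf (ds (toke x @ S)) (poly (pf :: nat poly) (esize x)) (ds (toke (f x) @ S))"
    using ptimeE[OF assms(3)] by metis
  let ?b = "SEQ (POP 0) (SEQ DROP (SEQ SWAP (SEQ cf SWAP)))"
  let ?W = "WHILE 0 1 ?b"
  let ?c = "SEQ DUPL (SEQ cl (SEQ SWAP (SEQ ci (SEQ SWAP (SEQ ?W (POP 0))))))"
  \<comment> \<open>Per round, 25 is spent on the dropped entry and at most 200 on each of the two
    swaps, times the common size bound \<open>Z\<close>; 430 covers this.\<close>
  have loop: "exec ?W (ds (toke m @ toke s @ S)) (length m * (430 * Z + poly pf Z + 10) + 1)
      (ds (1 # toke ((f ^^ length m) s) @ S))"
    if "esize m \<le> Z" "\<And>k. k \<le> length m \<Longrightarrow> esize ((f ^^ k) s) \<le> Z" for m :: "'b list" and s S Z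
    using that
  proof (induction m arbitrary: s)
    case Nil
    show ?case using exec_WHILE_done[of "ds (1 # toke s @ S)" 0 1 ?b] by simp
  next
    case (Cons a m)
    have s1: "esize s \<le> Z" using Cons.prems(2)[of 0] by simp
    have s2: "esize (f s) \<le> Z" using Cons.prems(2)[of 1] by simp
    have a: "esize a \<le> Z" "esize m \<le> Z" "esize m + esize a \<le> Z" using Cons.prems(1) by auto
    have "exec (POP 0) (ds (toke (a # m) @ toke s @ S)) 1 (ds (toke a @ toke m @ toke s @ S))"
      by (rule exec_loopfree) auto
    from exec_SEQ[OF this exec_SEQ[OF exec_DROP exec_SEQ[OF exec_SWAP exec_SEQ[OF f(2) exec_SWAP]]]]
    have "exec ?b (ds (toke (a # m) @ toke s @ S)) (1 + (25 * esize a + (100 * (esize m + esize s) + (poly pf (esize s) + 100 * (esize (f s) + esize m) + 1) + 1) + 1) + 1)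
       (ds (toke m @ toke (f s) @ S))"
      .
    moreover have "exec ?W (ds (toke m @ toke (f s) @ S)) (length m * (430 * Z + poly pf Z + 10) + 1)
      (ds (1 # toke ((f ^^ length m) (f s)) @ S))"
      using Cons.prems(2)[of "Suc k" for k] a by (intro Cons.IH) (auto simp: funpow_swap1)
    ultimately have "exec ?W (ds (toke (a # m) @ toke s @ S))
       (1 + (25 * esize a + (100 * (esize m + esize s) + (poly pf (esize s) + 100 * (esize (f s) + esize m) + 1) + 1) + 1) + 1
          + (length m * (430 * Z + poly pf Z + 10) + 1) + 2)
       (ds (1 # toke ((f ^^ length m) (f s)) @ S))"
      by (intro exec_WHILE_step) auto
    moreover have "1 + (25 * esize a + (100 * (esize m + esize s) + (poly pf (esize s) + 100 * (esize (f s) + esize m) + 1) + 1) + 1) + 1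
          + (length m * (430 * Z + poly pf Z + 10) + 1) + 2 \<le> length (a # m) * (430 * Z + poly pf Z + 10) + 1"
      using a s1 s2 mono_poly_nat[OF s1, of pf] by simp
    ultimately show ?case by (simp add: funpow_swap1 exec_mono)
  qed
  let ?Z = "\<lambda>n. n + poly pl n + poly q n"
  let ?T = "\<lambda>n. 70 * n + (poly pl n + (100 * (n + poly pl n + n) + (poly pj n + (100 * (poly q n + (n + poly pl n))
      + ((?Z n * (430 * ?Z n + poly pf (?Z n) + 10) + 1) + 1 + 1) + 1) + 1) + 1) + 1) + 1"
  show ?thesis
  proof (rule ptimeI[of "Bl + Bi + Bf" ?c])
    show "okc (Bl + Bi + Bf) ?c" using l(1,2) i(1) f(1) okc_mono by simp
    show "pbound ?T" by (intro pbi)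
    fix e :: 'e and S
    let ?n = "esize e"
    have len: "length m \<le> esize m" for m :: "'b list"
      by (induction m) auto
    have Z: "esize (l e) \<le> ?Z ?n" "esize ((f ^^ k) (i e)) \<le> ?Z ?n" if "k \<le> length (l e)" for k
      using bnd[OF that] l(4)[of e] by auto
    have "exec ?W (ds (toke (l e) @ toke (i e) @ S)) (?Z ?n * (430 * ?Z ?n + poly pf (?Z ?n) + 10) + 1)
      (ds (1 # toke ((f ^^ length (l e)) (i e)) @ S))"
      by (rule exec_mono[OF loop[OF Z]])
         (use Z(1)[of 0] len[of "l e"] in \<open>auto intro!: mult_mono\<close>)
    moreover have "exec (POP 0) (ds (1 # toke ((f ^^ length (l e)) (i e)) @ S)) 1 (ds (toke ((f ^^ length (l e)) (i e)) @ S))"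
      by (rule exec_loopfree) auto
    ultimately have "exec (SEQ ?W (POP 0)) (ds (toke (l e) @ toke (i e) @ S))
      ((?Z ?n * (430 * ?Z ?n + poly pf (?Z ?n) + 10) + 1) + 1 + 1) (ds (toke ((f ^^ length (l e)) (i e)) @ S))"
      by (rule exec_SEQ)
    from exec_SEQ[OF exec_DUPL exec_SEQ[OF l(3) exec_SEQ[OF exec_SWAP exec_SEQ[OF i(2) exec_SEQ[OF exec_SWAP this]]]]]
    show "exec ?c (ds (toke e @ S)) (?T ?n) (ds (toke ((f ^^ length (l e)) (i e)) @ S))"
      by (rule exec_mono) (use l(4)[of e] bnd[of 0 e] in auto)
  qed
qed

section \<open>Passing between bit strings and coded lists\<close>

definition READ :: com where
  "READ = SEQ (WHILE 0 1 (SEQ (POP 0) (IFTOP 0 1 (SEQ (POP 0) (PUSH 1 1))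
     (SEQ (POP 0) (SEQ (POP 0) (SEQ (POP 0) (PUSH 1 2))))))) (POP 0)"

definition BUILD :: com where
  "BUILD = SEQ (PUSH 0 1) (WHILE 1 0 (IFTOP 1 1 (SEQ (POP 1) (SEQ (PUSH 0 1) (PUSH 0 2)))
     (SEQ (POP 1) (SEQ (PUSH 0 1) (SEQ (PUSH 0 1) (SEQ (PUSH 0 2) (PUSH 0 2)))))))"

lemma length_le_esize: "length x \<le> esize x"
  by (induction x) auto

lemma bit_symbol_set: "set (map bit_symbol x) \<subseteq> {1, 2}"
  by (auto simp: bit_symbol_def)

text \<open>The codes of the two bits are the token lists 1 and 2 1 1. After the token of the list
  constructor, one pop removes \<open>False\<close> and three pops remove
  \<open>True\<close>.\<close>

lemma exec_READ:
  "exec READ (mk (toke (x :: bool list) @ S) A K Z) (20 * length x + 3) (mk S (rev (map bit_symbol x) @ A) K Z)"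
proof -
  let ?b = "SEQ (POP 0) (IFTOP 0 1 (SEQ (POP 0) (PUSH 1 1)) (SEQ (POP 0) (SEQ (POP 0) (SEQ (POP 0) (PUSH 1 2)))))"
  have loop: "exec (WHILE 0 1 ?b) (mk (toke x @ S) A K Z) (20 * length x + 1) (mk (1 # S) (rev (map bit_symbol x) @ A) K Z)"
  proof (induction x arbitrary: A)
    case Nil
    show ?case using exec_WHILE_done[of "mk (1 # S) A K Z" 0 1 ?b] by simp
  next
    case (Cons v x)
    have "exec ?b (mk (toke (v # x) @ S) A K Z) 15 (mk (toke x @ S) (bit_symbol v # A) K Z)"
      by (rule exec_loopfree) (auto simp: enc_bool_def bit_symbol_def)
    from exec_WHILE_step[OF _ this Cons.IH]
    have "exec (WHILE 0 1 ?b) (mk (toke (v # x) @ S) A K Z) (15 + (20 * length x + 1) + 2) (mk (1 # S) (rev (map bit_symbol (v # x)) @ A) K Z)"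
      by simp
    then show ?case by (rule exec_mono) simp
  qed
  have "exec (POP 0) (mk (1 # S) (rev (map bit_symbol x) @ A) K Z) 1 (mk S (rev (map bit_symbol x) @ A) K Z)"
    by (rule exec_loopfree) auto
  from exec_SEQ[OF loop this] show ?thesis unfolding READ_def by (rule exec_mono) simp
qed

lemma exec_BUILD:
  "exec BUILD (mk S (rev (map bit_symbol x)) K Z) (22 * length x + 3) (mk (toke (x :: bool list) @ S) [] K Z)"
proof -
  let ?b = "IFTOP 1 1 (SEQ (POP 1) (SEQ (PUSH 0 1) (PUSH 0 2)))
     (SEQ (POP 1) (SEQ (PUSH 0 1) (SEQ (PUSH 0 1) (SEQ (PUSH 0 2) (PUSH 0 2)))))"
  have loop: "exec (WHILE 1 0 ?b) (mk (toke y @ S) (rev (map bit_symbol x)) K Z) (22 * length x + 1) (mk (toke (x @ y) @ S) [] K Z)" for y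
  proof (induction x arbitrary: y rule: rev_induct)
    case Nil
    show ?case using exec_WHILE_done[of "mk (toke y @ S) [] K Z" 1 0 ?b] by simp
  next
    case (snoc v x)
    have "exec ?b (mk (toke y @ S) (rev (map bit_symbol (x @ [v]))) K Z) 16 (mk (toke (v # y) @ S) (rev (map bit_symbol x)) K Z)"
      by (rule exec_loopfree) (auto simp: enc_bool_def bit_symbol_def)
    from exec_WHILE_step[OF _ this snoc.IH]
    have "exec (WHILE 1 0 ?b) (mk (toke y @ S) (rev (map bit_symbol (x @ [v]))) K Z) (16 + (22 * length x + 1) + 2) (mk (toke (x @ v # y) @ S) [] K Z)"
      by (simp add: bit_symbol_def)
    then have "exec (WHILE 1 0 ?b) (mk (toke y @ S) (rev (map bit_symbol (x @ [v]))) K Z) (22 * length (x @ [v]) + 1) (mk (toke (x @ v # y) @ S) [] K Z)"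
      by (rule exec_mono) simp
    then show ?case by simp
  qed
  have "exec (PUSH 0 1) (mk S (rev (map bit_symbol x)) K Z) 1 (mk (toke ([] :: bool list) @ S) (rev (map bit_symbol x)) K Z)"
    by (rule exec_loopfree) auto
  from exec_SEQ[OF this loop]
  have "exec BUILD (mk S (rev (map bit_symbol x)) K Z) (1 + (22 * length x + 1) + 1) (mk (toke (x @ []) @ S) [] K Z)"
    unfolding BUILD_def .
  then have "exec BUILD (mk S (rev (map bit_symbol x)) K Z) (1 + (22 * length x + 1) + 1) (mk (toke x @ S) [] K Z)" by simp
  then show ?thesis by (rule exec_mono) simp
qed

lemma okc_READ_BUILD [simp]: "4 \<le> B \<Longrightarrow> okc B READ" "4 \<le> B \<Longrightarrow> okc B BUILD"
  by (auto simp: READ_def BUILD_def)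

lemma esize_bools: "esize (x :: bool list) \<le> 4 * length x + 1"
  by (induction x) (auto simp: enc_bool_def)

theorem ptime_imp_poly_time:
  fixes f :: "bool list \<Rightarrow> bool list"
  assumes "ptime f" shows "poly_time f"
proof -
  obtain c B p where c: "okc B c" "4 \<le> B"
    "\<And>x S. exec c (ds (toke x @ S)) (poly (p :: nat poly) (esize x)) (ds (toke (f x) @ S))"
    "\<And>x. esize (f x) \<le> esize x + poly p (esize x)" using ptimeE[OF assms] by metis
  \<comment> \<open>Two transfers move a stack without reversing it.\<close>
  let ?c = "SEQ (xfer [1,2] 0 2) (SEQ (xfer [1,2] 2 1) (SEQ BUILD (SEQ c (SEQ READ (SEQ (xfer [1,2] 1 2) (xfer [1,2] 2 0))))))"
  let ?n = "\<lambda>n. 4 * n + 1"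
  let ?m = "\<lambda>n. ?n n + poly p (?n n)"
  let ?T = "\<lambda>n. (12 * n + 1) + ((12 * n + 1) + ((22 * n + 3) + (poly p (?n n) + ((20 * ?m n + 3)
       + ((12 * ?m n + 1) + (12 * ?m n + 1) + 1) + 1) + 1) + 1) + 1) + 1"
  have "pbound ?T" by (intro pbi)
  then obtain q where q: "\<And>n. ?T n \<le> poly (q :: nat poly) n" unfolding pbound_def by blast
  show ?thesis
  proof (rule program_poly_time)
    show "okc B ?c" using c(1,2) by (auto simp: xfer_def)
    fix x
    let ?x = "rev (map bit_symbol x)" and ?y = "rev (map bit_symbol (f x))"
    have xf: "exec (xfer [1,2] i j) (st(i := l, j := m)) (12 * length l + 1) (st(i := [], j := rev l @ m))"
      if "i \<noteq> j" "set l \<subseteq> {1, 2}" for i j l m st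
      by (rule exec_mono[OF exec_xfer[OF that(1)]]) (use that in auto)
    have sx: "set ?x \<subseteq> {1, 2}" "set ?y \<subseteq> {1, 2}" using bit_symbol_set by auto
    have 1: "exec (xfer [1,2] 0 2) (ds ?x) (12 * length x + 1) (mk [] [] (rev ?x) [])"
      using xf[of 0 2 ?x "ds ?x" "[]"] sx by simp
    have 2: "exec (xfer [1,2] 2 1) (mk [] [] (rev ?x) []) (12 * length x + 1) (mk [] ?x [] [])"
      using xf[of 2 1 "rev ?x" "mk [] [] (rev ?x) []" "[]"] sx by simp
    have 3: "exec BUILD (mk [] ?x [] []) (22 * length x + 3) (ds (toke x @ []))" using exec_BUILD[of "[]" x] by simp
    have 4: "exec READ (ds (toke (f x) @ [])) (20 * length (f x) + 3) (mk [] ?y [] [])"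
      using exec_READ[of "f x" "[]" "[]"] by simp
    have 5: "exec (xfer [1,2] 1 2) (mk [] ?y [] []) (12 * length (f x) + 1) (mk [] [] (rev ?y) [])"
      using xf[of 1 2 ?y "mk [] ?y [] []" "[]"] sx by simp
    have 6: "exec (xfer [1,2] 2 0) (mk [] [] (rev ?y) []) (12 * length (f x) + 1) (ds ?y)"
      using xf[of 2 0 "rev ?y" "mk [] [] (rev ?y) []" "[]"] sx by simp
    have e: "esize x \<le> ?n (length x)" using esize_bools .
    have p: "poly p (esize x) \<le> poly p (?n (length x))" by (rule mono_poly_nat[OF e])
    have y: "length (f x) \<le> ?m (length x)" using length_le_esize[of "f x"] c(4)[of x] e p by linarith
    have "exec ?c (ds ?x) (?T (length x)) (ds ?y)"
      by (rule exec_mono[OF exec_SEQ[OF 1 exec_SEQ[OF 2 exec_SEQ[OF 3 exec_SEQ[OF c(3) exec_SEQ[OF 4 exec_SEQ[OF 5 6]]]]]]])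
         (use y p in \<open>intro add_mono mult_le_mono2 order_refl; simp\<close>)
    then have "exec ?c (ds ?x) (poly q (length x)) (ds ?y)" using q exec_mono by blast
    moreover have "ds l = empty_store(0 := l)" for l by (auto simp: mk_def empty_store_def)
    ultimately show "\<exists>t \<le> poly q (length x). runs ?c (empty_store(0 := ?x)) t (empty_store(0 := ?y))"
      by (simp add: exec_def)
  qed
qed

section \<open>Turing machines as polynomial-time functions\<close>

locale tm_sim =
  fixes M :: tm
  assumes wf: "wf_tm M"
begin

abbreviation "K \<equiv> num_symbols M"
abbreviation "Q \<equiv> num_states M"

lemma K3: "3 \<le> K" and Q2: "2 \<le> Q"
  using wf by (auto simp: wf_tm_def)

text \<open>A tape symbol becomes a positive stack symbol; the content of cell 0 carries a flag, so that
  the origin can be found again.\<close>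

definition code :: "bool \<Rightarrow> nat \<Rightarrow> nat" where
  "code m s = (if s = 0 then K else s) + (if m then K else 0)"

definition marked :: "nat \<Rightarrow> bool" where "marked v \<longleftrightarrow> K < v"

definition symb :: "nat \<Rightarrow> nat" where
  "symb v = (let w = (if K < v then v - K else v) in if w = K then 0 else w)"

lemma code_inverse: "s < K \<Longrightarrow> symb (code m s) = s" "s < K \<Longrightarrow> marked (code m s) = m"
  using K3 by (auto simp: symb_def code_def marked_def)

lemma code_range: "s < K \<Longrightarrow> 0 < code m s \<and> code m s \<le> 2 * K"
  using K3 by (auto simp: code_def)

text \<open>Outside of the stored part every cell is an unmarked blank, whose code is
  \<open>K\<close>. \<open>tocell\<close> does the same for the top of an empty stack.\<close>

definition getc :: "nat list \<Rightarrow> nat \<Rightarrow> nat" where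
  "getc R i = (if i < length R then R ! i else K)"

lemma getc_Cons [simp]: "getc (v # R) 0 = v" "getc (v # R) (Suc i) = getc R i"
  by (simp_all add: getc_def)

lemma getc_tl: "getc (tl R) i = getc R (Suc i)"
  by (cases R) (auto simp: getc_def)

definition tocell :: "nat \<Rightarrow> nat" where "tocell v = (if v = 0 then K else v)"

definition okl :: "nat list \<Rightarrow> bool" where "okl R \<longleftrightarrow> set R \<subseteq> {1..2 * K}"

lemma tocell_top: "okl R \<Longrightarrow> tocell (top_of R) = getc R 0"
  by (cases R) (auto simp: okl_def tocell_def getc_def)

lemma okl_top: "okl R \<Longrightarrow> top_of R \<le> 2 * K"
  by (cases R) (auto simp: okl_def)

text \<open>Stack 3 holds the state plus one, as symbols must be positive. Stack 2 holds the cells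
  from the head on, and stack 1 those to its left, nearest first. A move to the left takes over a
  cell of stack 1, or a blank if there is none.\<close>

definition STEP :: "nat \<Rightarrow> nat \<Rightarrow> com" where
  "STEP q v = (case delta M q (symb (tocell v)) of (q', s', d) \<Rightarrow>
     let w = code (marked (tocell v)) s' in
     SEQ (POP 3) (SEQ (PUSH 3 (Suc q')) (SEQ (POP 2)
       (if d = 1 then PUSH 1 w else if d = 0 then PUSH 2 w
        else SEQ (PUSH 2 w) (switch 1 [0..<Suc (2 * K)] (\<lambda>u. SEQ (POP 1) (PUSH 2 (tocell u))))))))"

definition BODY :: com where
  "BODY = switch 3 [1..<Suc Q] (\<lambda>q. switch 2 [0..<Suc (2 * K)] (STEP (q - 1)))"

lemma loopfree_BODY: "loopfree BODY"
  by (auto simp: BODY_def STEP_def Let_def split: prod.split)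

lemma symb_less: "v \<le> 2 * K \<Longrightarrow> symb (tocell v) < K"
  using K3 by (auto simp: symb_def tocell_def Let_def)

lemma delta_ok: "q < Q \<Longrightarrow> s < K \<Longrightarrow> delta M q s = (q', s', d) \<Longrightarrow> q' < Q \<and> s' < K \<and> d \<in> {-1, 0, 1}"
  using wf unfolding wf_tm_def by fastforce

lemma okc_BODY: "okc (2 * K + Q + 4) BODY"
proof -
  have "okc (2 * K + Q + 4) (STEP q v)" if "q < Q" "v \<le> 2 * K" for q v
  proof -
    obtain q' s' d where d: "delta M q (symb (tocell v)) = (q', s', d)" by (cases "delta M q (symb (tocell v))") auto
    have "q' < Q \<and> s' < K" using delta_ok[OF that(1) symb_less[OF that(2)] d] by simp
    then show ?thesis unfolding STEP_def d prod.case Let_def using code_range[of s' "marked (tocell v)"] K3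
      by (auto simp: tocell_def simp del: upt_Suc)
  qed
  then show ?thesis by (auto simp: BODY_def)
qed

definition gcell :: "(int \<Rightarrow> nat) \<Rightarrow> int \<Rightarrow> nat" where "gcell t i = code (i = 0) (t i)"

definition rep :: "(int \<Rightarrow> nat) \<Rightarrow> int \<Rightarrow> nat list \<Rightarrow> nat list \<Rightarrow> bool" where
  "rep t h L R \<longleftrightarrow> okl L \<and> okl R \<and> (\<forall>i. t i < K) \<and>
     (\<forall>i. getc R i = gcell t (h + int i)) \<and> (\<forall>i. getc L i = gcell t (h - 1 - int i))"

lemma ev_BODY:
  assumes rep: "rep t h L R" and q: "q < Q" and s: "tm_step M (q, t, h) = (q', t', h')" "q \<noteq> 1"
  shows "\<exists>L' R'. ev BODY (mk S L R [Suc q]) = mk S L' R' [Suc q'] \<and> rep t' h' L' R' \<and> q' < Q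
    \<and> length L' \<le> Suc (length L) \<and> length R' \<le> length R + 2"
proof -
  have r: "okl L" "okl R" "\<And>i. t i < K" "\<And>i. getc R i = gcell t (h + int i)" "\<And>i. getc L i = gcell t (h - 1 - int i)"
    using rep by (auto simp: rep_def)
  have top: "tocell (top_of R) = code (h = 0) (t h)" using tocell_top[OF r(2)] r(4)[of 0] by (simp add: gcell_def)
  have sy: "symb (tocell (top_of R)) = t h" "marked (tocell (top_of R)) = (h = 0)"
    using top code_inverse r(3) by simp_all
  obtain q2 s2 d where d: "delta M q (t h) = (q2, s2, d)" by (cases "delta M q (t h)") auto
  have ok: "q2 < Q" "s2 < K" "d \<in> {-1, 0, 1}" using delta_ok[OF q r(3) d] by auto
  have n: "q' = q2" "t' = t(h := s2)" "h' = h + d" using s d by auto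
  let ?w = "code (h = 0) s2"
  have w: "okl [?w]" using code_range[OF ok(2), of "h = 0"] by (simp add: okl_def)
  have tl: "okl (tl l)" if "okl l" for l using that by (cases l) (auto simp: okl_def)
  have cons: "okl (v # l)" if "okl [v]" "okl l" for v l using that by (auto simp: okl_def)
  have BS: "ev BODY (mk S L R [Suc q]) = ev (STEP q (top_of R)) (mk S L R [Suc q])"
    using q okl_top[OF r(2)] by (simp add: BODY_def ev_switch del: upt_Suc)
  have gt': "gcell t' i = (if i = h then ?w else gcell t i)" for i by (simp add: gcell_def n)
  have t'K: "t' i < K" for i using n(2) ok(2) r(3) by auto
  have lt: "length (tl l) \<le> Suc (length l)" for l :: "nat list" by simp
  consider "d = 1" | "d = 0" | "d = -1" using ok(3) by auto
  then show ?thesis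
  proof cases
    case 1
    have "ev BODY (mk S L R [Suc q]) = mk S (?w # L) (tl R) [Suc q']"
      unfolding BS by (simp add: STEP_def sy d 1 n)
    moreover have "getc (?w # L) i = gcell t' (h' - 1 - int i)" for i
      by (cases i) (auto simp: gt' n(3) 1 r(5) algebra_simps)
    moreover have "getc (tl R) i = gcell t' (h' + int i)" for i
      by (auto simp: gt' n(3) 1 r(4) getc_tl algebra_simps)
    ultimately show ?thesis using ok n tl[OF r(2)] cons[OF w r(1)] t'K
      by - (rule exI[of _ "?w # L"], rule exI[of _ "tl R"], auto simp: rep_def)
  next
    case 2
    have "ev BODY (mk S L R [Suc q]) = mk S L (?w # tl R) [Suc q']"
      unfolding BS by (simp add: STEP_def sy d 2 n)
    moreover have "getc (?w # tl R) i = gcell t' (h' + int i)" for i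
      by (cases i) (auto simp: gt' n(3) 2 r(4) getc_tl)
    moreover have "getc L i = gcell t' (h' - 1 - int i)" for i
      by (auto simp: gt' n(3) 2 r(5))
    ultimately show ?thesis using ok n r(1) cons[OF w tl[OF r(2)]] t'K
      by - (rule exI[of _ L], rule exI[of _ "?w # tl R"], auto simp: rep_def)
  next
    case 3
    let ?u = "tocell (top_of L)"
    have u: "?u = gcell t (h - 1)" using tocell_top[OF r(1)] r(5)[of 0] by simp
    have "okl [?u]" using code_range[OF r(3), of "h - 1 = 0" "h - 1"] by (simp add: u gcell_def okl_def)
    then have okR: "okl (?u # ?w # tl R)" using cons w tl r(2) by blast
    have "ev BODY (mk S L R [Suc q]) = mk S (tl L) (?u # ?w # tl R) [Suc q']"
      unfolding BS using okl_top[OF r(1)] by (simp add: STEP_def sy d 3 n ev_switch del: upt_Suc)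
    moreover have "getc (?u # ?w # tl R) i = gcell t' (h' + int i)" for i
    proof (cases i)
      case (Suc j)
      then show ?thesis by (cases j) (auto simp: gt' n(3) 3 r(4) getc_tl ac_simps)
    qed (auto simp: gt' n(3) 3 u)
    moreover have "getc (tl L) i = gcell t' (h' - 1 - int i)" for i
      by (auto simp: gt' n(3) 3 r(5) getc_tl algebra_simps)
    ultimately show ?thesis using ok n okR tl[OF r(1)] t'K
      by - (rule exI[of _ "tl L"], rule exI[of _ "?u # ?w # tl R"], auto simp: rep_def)
  qed
qed

text \<open>The symbol 2 that ends the loop stands for the halting state 1. A machine that halts
  before step \<open>n\<close> idles, so the time is only an upper bound.\<close>

lemma exec_sim:
  assumes "rep t h L R" "q < Q" "(tm_step M ^^ n) (q, t, h) = (1, t', h')"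
  shows "\<exists>L' R'. exec (WHILE 3 2 BODY) (mk S L R [Suc q]) (n * (ctime BODY + 2) + 1) (mk S L' R' [2]) \<and> rep t' h' L' R'
    \<and> length L' \<le> n + length L \<and> length R' \<le> 2 * n + length R"
  using assms
proof (induction n arbitrary: q t h L R)
  case 0
  then show ?case using exec_WHILE_done[of "mk S L R [2]" 3 2 BODY] by (fastforce simp: numeral_2_eq_2)
next
  case (Suc n)
  show ?case
  proof (cases "q = 1")
    case True
    then have "(tm_step M ^^ m) (q, t, h) = (q, t, h)" for m by (induction m) auto
    then have "t' = t" "h' = h" using Suc.prems(3) by (metis prod.inject)+
    moreover have "exec (WHILE 3 2 BODY) (mk S L R [2]) (Suc n * (ctime BODY + 2) + 1) (mk S L R [2])"
      by (rule exec_mono[OF exec_WHILE_done]) auto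
    ultimately show ?thesis using True Suc.prems(1)
      by (intro exI[of _ L] exI[of _ R]) (simp add: numeral_2_eq_2)
  next
    case False
    obtain q1 t1 h1 where s: "tm_step M (q, t, h) = (q1, t1, h1)" by (cases "tm_step M (q, t, h)") auto
    obtain L1 R1 where 1: "ev BODY (mk S L R [Suc q]) = mk S L1 R1 [Suc q1]" "rep t1 h1 L1 R1" "q1 < Q"
      "length L1 \<le> Suc (length L)" "length R1 \<le> length R + 2"
      using ev_BODY[OF Suc.prems(1,2) s False] by blast
    have "(tm_step M ^^ n) (q1, t1, h1) = (1, t', h')"
      using Suc.prems(3) s by (simp add: funpow_swap1 del: tm_step.simps)
    from Suc.IH[OF 1(2,3) this] obtain L' R' where 2:
      "exec (WHILE 3 2 BODY) (mk S L1 R1 [Suc q1]) (n * (ctime BODY + 2) + 1) (mk S L' R' [2])" "rep t' h' L' R'"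
      "length L' \<le> n + length L1" "length R' \<le> 2 * n + length R1" by blast
    have "exec BODY (mk S L R [Suc q]) (ctime BODY) (mk S L1 R1 [Suc q1])"
      by (rule exec_loopfree[OF loopfree_BODY 1(1)]) simp
    from exec_WHILE_step[OF _ this 2(1)] False
    have "exec (WHILE 3 2 BODY) (mk S L R [Suc q]) (ctime BODY + (n * (ctime BODY + 2) + 1) + 2) (mk S L' R' [2])"
      by simp
    then have "exec (WHILE 3 2 BODY) (mk S L R [Suc q]) (Suc n * (ctime BODY + 2) + 1) (mk S L' R' [2])"
      by (rule exec_mono) simp
    then show ?thesis using 2 1 by (intro exI[of _ L'] exI[of _ R']) auto
  qed
qed

section \<open>Reading the output off the simulated tape\<close>

definition SEEK_body :: com where
  "SEEK_body = switch 2 [1..<Suc (2 * K)] (\<lambda>v. if v \<le> K then POP 2 else POP 3)"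

text \<open>The codes above \<open>K\<close> are those of marked cells, so the first of them is the
  origin; popping the flag on stack 3 ends the loop there.\<close>

lemma exec_SEEK:
  assumes "set A \<subseteq> {1..K}" "w \<in> {K<..2 * K}"
  shows "exec (WHILE 3 0 SEEK_body) (mk S [] (A @ w # R) [1]) ((ctime SEEK_body + 2) * length A + ctime SEEK_body + 3) (mk S [] (w # R) [])"
  using assms(1)
proof (induction A)
  case Nil
  have 1: "exec SEEK_body (mk S [] (w # R) [1]) (ctime SEEK_body) (mk S [] (w # R) [])"
    by (rule exec_loopfree) (use assms(2) in \<open>auto simp: SEEK_body_def ev_switch\<close>)
  have 2: "exec (WHILE 3 0 SEEK_body) (mk S [] (w # R) []) 1 (mk S [] (w # R) [])"
    by (rule exec_WHILE_done) simp
  show ?case using exec_mono[OF exec_WHILE_step[OF _ 1 2], of "ctime SEEK_body + 3"] by simp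
next
  case (Cons v A)
  have 1: "exec SEEK_body (mk S [] ((v # A) @ w # R) [1]) (ctime SEEK_body) (mk S [] (A @ w # R) [1])"
    by (rule exec_loopfree) (use Cons.prems in \<open>auto simp: SEEK_body_def ev_switch\<close>)
  have 2: "exec (WHILE 3 0 SEEK_body) (mk S [] (A @ w # R) [1]) ((ctime SEEK_body + 2) * length A + ctime SEEK_body + 3) (mk S [] (w # R) [])"
    using Cons by simp
  show ?case by (rule exec_mono[OF exec_WHILE_step[OF _ 1 2]]) auto
qed

text \<open>\<open>1\<close> and \<open>2\<close> are the codes of the bits, and
  \<open>K + 1\<close>, \<open>K + 2\<close> their codes in the marked cell, where the output
  starts. Any other cell ends the output.\<close>

definition COLL_body :: com where
  "COLL_body = switch 2 [0..<Suc (2 * K)] (\<lambda>v. if v \<in> {1, K + 1} then SEQ (POP 2) (PUSH 1 1)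
     else if v \<in> {2, K + 2} then SEQ (POP 2) (PUSH 1 2) else POP 3)"

lemma exec_COLL:
  assumes "okl R" "\<And>i. i < length y \<Longrightarrow> getc R i = code (m i) (bit_symbol (y ! i))" "getc R (length y) \<in> {K, 2 * K}"
  shows "\<exists>R'. exec (WHILE 3 0 COLL_body) (mk S A R [1]) ((ctime COLL_body + 2) * length y + ctime COLL_body + 3)
     (mk S (rev (map bit_symbol y) @ A) R' []) \<and> okl R' \<and> length R' \<le> length R"
  using assms
proof (induction y arbitrary: R A m)
  case Nil
  have "top_of R \<in> {0, K, 2 * K}" using Nil by (cases R) (auto simp: getc_def)
  then have 1: "exec COLL_body (mk S A R [1]) (ctime COLL_body) (mk S A R [])"
    using K3 by (intro exec_loopfree) (auto simp: COLL_body_def ev_switch simp del: upt_Suc)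
  have 2: "exec (WHILE 3 0 COLL_body) (mk S A R []) 1 (mk S A R [])"
    by (rule exec_WHILE_done) simp
  show ?case using exec_mono[OF exec_WHILE_step[OF _ 1 2], of "ctime COLL_body + 3"] Nil(1) by (intro exI[of _ R]) simp
next
  case (Cons b y)
  have g: "getc R 0 = code (m 0) (bit_symbol b)" using Cons.prems(2)[of 0] by simp
  have ne: "R \<noteq> []" using g K3 by (auto simp: getc_def code_def bit_symbol_def split: if_splits)
  have top: "top_of R = code (m 0) (bit_symbol b)" using g ne by (cases R) auto
  have 1: "exec COLL_body (mk S A R [1]) (ctime COLL_body) (mk S (bit_symbol b # A) (tl R) [1])"
    using top K3 by (intro exec_loopfree) (auto simp: COLL_body_def ev_switch code_def bit_symbol_def simp del: upt_Suc)
  have "\<exists>R'. exec (WHILE 3 0 COLL_body) (mk S (bit_symbol b # A) (tl R) [1]) ((ctime COLL_body + 2) * length y + ctime COLL_body + 3)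
     (mk S (rev (map bit_symbol y) @ bit_symbol b # A) R' []) \<and> okl R' \<and> length R' \<le> length (tl R)"
  proof (rule Cons.IH[of _ "\<lambda>i. m (Suc i)"])
    show "okl (tl R)" using Cons.prems(1) by (cases R) (auto simp: okl_def)
    show "getc (tl R) i = code (m (Suc i)) (bit_symbol (y ! i))" if "i < length y" for i
      using Cons.prems(2)[of "Suc i"] that by (simp add: getc_tl)
    show "getc (tl R) (length y) \<in> {K, 2 * K}" using Cons.prems(3) by (simp add: getc_tl)
  qed
  then obtain R' where 2: "exec (WHILE 3 0 COLL_body) (mk S (bit_symbol b # A) (tl R) [1]) ((ctime COLL_body + 2) * length y + ctime COLL_body + 3)
     (mk S (rev (map bit_symbol y) @ bit_symbol b # A) R' [])" "okl R'" "length R' \<le> length (tl R)" by blast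
  have "exec (WHILE 3 0 COLL_body) (mk S A R [1]) ((ctime COLL_body + 2) * length (b # y) + ctime COLL_body + 3)
     (mk S (rev (map bit_symbol y) @ bit_symbol b # A) R' [])"
    by (rule exec_mono[OF exec_WHILE_step[OF _ 1 2(1)]]) auto
  then show ?case using 2 by (intro exI[of _ R']) auto
qed

text \<open>On empty input cell 0 is not stored yet; \<open>2 * K\<close> is the code of a marked
  blank.\<close>

definition MARKC :: com where
  "MARKC = IFTOP 2 1 (SEQ (POP 2) (PUSH 2 (1 + K))) (IFTOP 2 2 (SEQ (POP 2) (PUSH 2 (2 + K))) (PUSH 2 (2 * K)))"

definition SIM :: com where
  "SIM = SEQ READ (SEQ (xfer [1,2] 1 2) (SEQ (SEQ MARKC (PUSH 3 1)) (SEQ (WHILE 3 2 BODY) (SEQ (POP 3)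
     (SEQ (xfer [1..<Suc (2 * K)] 1 2) (SEQ (PUSH 3 1) (SEQ (WHILE 3 0 SEEK_body) (SEQ (PUSH 3 1)
     (SEQ (WHILE 3 0 COLL_body) (SEQ (CLEAR 2) BUILD))))))))))"

lemma okc_SIM: "okc (2 * K + Q + 4) SIM"
  using okc_BODY K3 by (auto simp: SIM_def MARKC_def SEEK_body_def COLL_body_def CLEAR_def xfer_def simp del: upt_Suc)

definition simtime :: "nat \<Rightarrow> nat \<Rightarrow> nat" where
  "simtime l n = (20 * l + 3) + ((12 * l + 1) + ((ctime (SEQ MARKC (PUSH 3 1))) + ((n * (ctime BODY + 2) + 1) + (1
     + (((8 * K + 3) * (n + l + 1) + 1) + (1 + (((ctime SEEK_body + 2) * (3 * (n + l + 1)) + ctime SEEK_body + 3) + (1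
     + (((ctime COLL_body + 2) * (3 * (n + l + 1)) + ctime COLL_body + 3) + ((3 * (3 * (n + l + 1)) + 1) + (22 * (3 * (n + l + 1)) + 3) + 1) + 1) + 1) + 1) + 1) + 1) + 1) + 1) + 1) + 1) + 1"

lemma exec_SIM:
  assumes h: "halts_with ((tm_step M ^^ n) (initial_config x)) y"
  shows "exec SIM (ds (toke x @ S)) (simtime (length x) n) (ds (toke y @ S))"
proof -
  define X where "X = map bit_symbol x"
  define t0 where "t0 = (\<lambda>i::int. if 0 \<le> i \<and> nat i < length x then bit_symbol (x ! nat i) else 0)"
  define R0 where "R0 = (case X of [] \<Rightarrow> [2 * K] | a # l \<Rightarrow> (a + K) # l)"
  have X12: "set X \<subseteq> {1, 2}" using bit_symbol_set by (simp add: X_def)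
  have lX: "length X = length x" by (simp add: X_def)
  have lR0: "length R0 \<le> length x + 1" by (cases X) (auto simp: R0_def lX[symmetric])
  obtain t' h' where fin: "(tm_step M ^^ n) (0, t0, 0) = (1, t', h')"
    and y: "\<And>i. i < length y \<Longrightarrow> t' (int i) = bit_symbol (y ! i)" "t' (int (length y)) = 0"
    using h by (auto simp: halts_with_def initial_config_def t0_def)
  have rep0: "rep t0 0 [] R0"
  proof -
    have t0i: "t0 (int i) = (if i < length x then bit_symbol (x ! i) else 0)" for i by (simp add: t0_def)
    have "getc R0 i = gcell t0 (0 + int i)" for i
      using K3 by (cases x; cases i) (auto simp: R0_def X_def getc_def gcell_def code_def t0i t0i[of 0, simplified] bit_symbol_def simp del: of_nat_Suc)
    moreover have "okl R0" using X12 K3 by (cases X) (auto simp: R0_def okl_def)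
    moreover have "t0 i < K" for i using K3 by (auto simp: t0_def bit_symbol_def)
    moreover have "getc [] i = gcell t0 (0 - 1 - int i)" for i by (auto simp: getc_def gcell_def code_def t0_def)
    ultimately show ?thesis by (auto simp: rep_def okl_def)
  qed
  obtain L R where LR: "exec (WHILE 3 2 BODY) (mk S [] R0 [Suc 0]) (n * (ctime BODY + 2) + 1) (mk S L R [2])"
    "rep t' h' L R" "length L \<le> n" "length R \<le> 2 * n + length R0"
    using exec_sim[OF rep0 _ fin, of S] Q2 by auto
  have r: "okl L" "okl R" "\<And>i. t' i < K" "\<And>i. getc R i = gcell t' (h' + int i)" "\<And>i. getc L i = gcell t' (h' - 1 - int i)"
    using LR(2) by (auto simp: rep_def)
  define F where "F = rev L @ R"
  have okF: "okl F" using r by (auto simp: F_def okl_def)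
  have getF: "getc F i = gcell t' (h' - int (length L) + int i)" for i
  proof (cases "i < length L")
    case True
    then have "length L - 1 - i < length L" by simp
    then have "getc F i = getc L (length L - 1 - i)" using True by (simp add: F_def getc_def nth_append rev_nth)
    then show ?thesis using True by (simp add: r(5) algebra_simps of_nat_diff)
  next
    case False
    then have "getc F i = getc R (i - length L)" by (auto simp: F_def getc_def nth_append)
    then show ?thesis using False by (simp add: r(4) algebra_simps of_nat_diff)
  qed
  define i0 where "i0 = nat (int (length L) - h')"
  have g0: "gcell t' 0 > K" using K3 by (auto simp: gcell_def code_def)
  \<comment> \<open>Were the origin to the left of all stored cells, it would read as an unmarked
    blank, but its code exceeds \<open>K\<close>. The same argument excludes the right side in
    \<open>i0F\<close>.\<close>
  have i0: "h' - int (length L) + int i0 = 0"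
  proof (rule ccontr)
    assume "\<not> ?thesis"
    then have neg: "h' - int (length L) > 0" by (auto simp: i0_def split: if_splits)
    define j where "j = nat (h' - 1)"
    have "h' - 1 - int j = 0" using neg by (simp add: j_def)
    then have "getc L j = gcell t' 0" using r(5)[of j] by simp
    moreover have "getc L j = K" using neg by (auto simp: getc_def j_def)
    ultimately show False using g0 by simp
  qed
  have i0F: "i0 < length F"
  proof (rule ccontr)
    assume "\<not> ?thesis"
    then have "getc F i0 = K" by (simp add: getc_def)
    then show False using getF[of i0] i0 g0 by simp
  qed
  define A w B where "A = take i0 F" and "w = F ! i0" and "B = drop (Suc i0) F"
  have F: "F = A @ w # B" using id_take_nth_drop[OF i0F] by (simp add: A_def w_def B_def)
  have lA: "length A = i0" using i0F by (simp add: A_def)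
  have wg: "getc (w # B) i = gcell t' (int i)" for i
  proof -
    have "getc F (i0 + i) = getc (w # B) i" unfolding F by (auto simp: getc_def nth_append lA)
    moreover have "h' - int (length L) + int (i0 + i) = int i" using i0 by simp
    ultimately show ?thesis using getF[of "i0 + i"] by metis
  qed
  have w: "w \<in> {K<..2 * K}" using wg[of 0] g0 okF by (auto simp: F okl_def)
  have Ain: "set A \<subseteq> {1..K}"
  proof
    fix v assume "v \<in> set A"
    then obtain i where i: "i < i0" "v = A ! i" using lA by (auto simp: in_set_conv_nth)
    then have "v = getc F i" unfolding F using lA by (simp add: getc_def nth_append)
    then have "v = gcell t' (h' - int (length L) + int i)" using getF by simp
    moreover have "h' - int (length L) + int i \<noteq> 0" using i0 i(1) by linarith
    ultimately have "v = code False (t' (h' - int (length L) + int i))" by (simp add: gcell_def)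
    then show "v \<in> {1..K}" using r(3)[of "h' - int (length L) + int i"] K3 by (auto simp: code_def)
  qed
  have okB: "okl (w # B)" using okF by (auto simp: F okl_def)
  have "\<exists>R'. exec (WHILE 3 0 COLL_body) (mk S [] (w # B) [1]) ((ctime COLL_body + 2) * length y + ctime COLL_body + 3)
     (mk S (rev (map bit_symbol y) @ []) R' []) \<and> okl R' \<and> length R' \<le> length (w # B)"
  proof (rule exec_COLL[OF okB])
    show "getc (w # B) i = code (int i = 0) (bit_symbol (y ! i))" if "i < length y" for i
      using wg[of i] y(1)[OF that] by (simp add: gcell_def)
    show "getc (w # B) (length y) \<in> {K, 2 * K}" using wg[of "length y"] y(2) by (auto simp: gcell_def code_def)
  qed
  then obtain R' where C: "exec (WHILE 3 0 COLL_body) (mk S [] (w # B) [1]) ((ctime COLL_body + 2) * length y + ctime COLL_body + 3)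
     (mk S (rev (map bit_symbol y) @ []) R' [])" "okl R'" "length R' \<le> length (w # B)" by blast
  \<comment> \<open>A step adds at most one cell on the left and two on the right, and the input
    fills at most \<open>length x + 1\<close> cells.\<close>
  have lF: "length F \<le> 3 * (n + length x + 1)" using LR(3,4) lR0 by (simp add: F_def)
  have lAB: "length A \<le> 3 * (n + length x + 1)" "length R' \<le> 3 * (n + length x + 1)"
    using lF C(3) unfolding F by auto
  have 1: "exec READ (ds (toke x @ S)) (20 * length x + 3) (mk S (rev X) [] [])"
    using exec_READ[of x S "[]" "[]" "[]"] by (simp add: X_def)
  have 2: "exec (xfer [1,2] 1 2) (mk S (rev X) [] []) (12 * length x + 1) (mk S [] X [])"
    using xfer_mk(5)[of "rev X" S "[]"] X12 by (simp add: X_def)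
  have 3: "exec (SEQ MARKC (PUSH 3 1)) (mk S [] X []) (ctime (SEQ MARKC (PUSH 3 1))) (mk S [] R0 [Suc 0])"
    using X12 by (intro exec_loopfree) (cases X; auto simp: MARKC_def R0_def)+
  have 5: "exec (POP 3) (mk S L R [2]) 1 (mk S L R [])" by (rule exec_loopfree) auto
  have "(8 * K + 3) * length L \<le> (8 * K + 3) * (n + length x + 1)" using LR(3) by (intro mult_le_mono2) simp
  moreover have "exec (xfer [1..<Suc (2 * K)] 1 2) (mk S L R []) ((8 * K + 3) * length L + 1) (mk S [] F [])"
    using exec_xfer[of 1 2 L "[1..<Suc (2 * K)]" "mk S L R []" R] r(1)
    by (simp add: F_def okl_def atLeastLessThanSuc_atLeastAtMost del: upt_Suc)
  ultimately have 6: "exec (xfer [1..<Suc (2 * K)] 1 2) (mk S L R []) ((8 * K + 3) * (n + length x + 1) + 1) (mk S [] F [])"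
    using exec_mono by (metis add_le_mono1)
  have 7: "exec (PUSH 3 1) (mk S [] F []) 1 (mk S [] (A @ w # B) [1])" by (rule exec_loopfree) (auto simp: F)
  have 8: "exec (WHILE 3 0 SEEK_body) (mk S [] (A @ w # B) [1]) ((ctime SEEK_body + 2) * (3 * (n + length x + 1)) + ctime SEEK_body + 3) (mk S [] (w # B) [])"
    by (rule exec_mono[OF exec_SEEK[OF Ain w]]) (use lAB(1) in \<open>intro add_mono mult_le_mono2 order_refl\<close>)
  have 9: "exec (PUSH 3 1) (mk S [] (w # B) []) 1 (mk S [] (w # B) [1])" by (rule exec_loopfree) auto
  have R0': "0 \<notin> set R'" using C(2) by (auto simp: okl_def)
  have 10: "exec (CLEAR 2) (mk S (rev (map bit_symbol y) @ []) R' []) (3 * (3 * (n + length x + 1)) + 1) (mk S (rev (map bit_symbol y)) [] [])"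
    using exec_mono[OF exec_CLEAR[of R' 2 "mk S (rev (map bit_symbol y)) R' []"], of "3 * (3 * (n + length x + 1)) + 1"] R0' lAB(2)
    by simp
  \<comment> \<open>Cells beyond the stored part are blank and hence not part of the output.\<close>
  have "length y \<le> length (w # B)"
  proof (rule ccontr)
    assume "\<not> ?thesis"
    then have "getc (w # B) (length (w # B)) = code (length (w # B) = 0) (bit_symbol (y ! length (w # B)))"
      using wg[of "length (w # B)"] y(1)[of "length (w # B)"] by (simp add: gcell_def del: of_nat_Suc)
    then show False using K3 by (auto simp: getc_def code_def bit_symbol_def split: if_splits)
  qed
  then have ly: "length y \<le> 3 * (n + length x + 1)" using lF unfolding F by simp
  have C': "exec (WHILE 3 0 COLL_body) (mk S [] (w # B) [1]) ((ctime COLL_body + 2) * (3 * (n + length x + 1)) + ctime COLL_body + 3)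
     (mk S (rev (map bit_symbol y) @ []) R' [])"
    by (rule exec_mono[OF C(1)]) (use ly in \<open>intro add_mono mult_le_mono2 order_refl\<close>)
  have 12: "exec BUILD (mk S (rev (map bit_symbol y)) [] []) (22 * (3 * (n + length x + 1)) + 3) (ds (toke y @ S))"
    by (rule exec_mono[OF exec_BUILD]) (use ly in simp)
  show ?thesis unfolding SIM_def simtime_def
    by (rule exec_SEQ[OF 1 exec_SEQ[OF 2 exec_SEQ[OF 3 exec_SEQ[OF LR(1) exec_SEQ[OF 5 exec_SEQ[OF 6 exec_SEQ[OF 7 exec_SEQ[OF 8
      exec_SEQ[OF 9 exec_SEQ[OF C' exec_SEQ[OF 10 12]]]]]]]]]]])
qed

end

theorem poly_time_imp_ptime:
  fixes f :: "bool list \<Rightarrow> bool list"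
  assumes "poly_time f" shows "ptime f"
proof -
  obtain M and p :: "nat poly" where M: "wf_tm M"
    "\<And>x. \<exists>t \<le> poly p (length x). halts_with ((tm_step M ^^ t) (initial_config x)) (f x)"
    using assms unfolding poly_time_def by blast
  interpret tm_sim M by (unfold_locales) (rule M(1))
  show ?thesis
  proof (rule ptimeI[OF okc_SIM])
    show "pbound (\<lambda>n. simtime n (poly p n))" unfolding simtime_def by (intro pbi)
    fix x :: "bool list" and S
    obtain t where t: "t \<le> poly p (length x)" "halts_with ((tm_step M ^^ t) (initial_config x)) (f x)"
      using M(2) by blast
    have l: "length x \<le> esize x" by (rule length_le_esize)
    have "t \<le> poly p (esize x)" using t(1) mono_poly_nat[OF l, of p] by simp
    then have "simtime (length x) t \<le> simtime (esize x) (poly p (esize x))"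
      unfolding simtime_def using l by (intro add_mono mult_le_mono order_refl)
    then show "exec SIM (ds (toke x @ S)) (simtime (esize x) (poly p (esize x))) (ds (toke (f x) @ S))"
      by (rule exec_mono[OF exec_SIM[OF t(2)]])
  qed
qed

section \<open>Sizes\<close>

lemma esize_append: "Suc (esize (a @ b)) = esize a + esize b"
  by (induction a) auto

lemma esize_in_list: "a \<in> set l \<Longrightarrow> esize a < esize l"
  by (induction l) (auto simp: less_Suc_eq_le)

lemma esize_list_bound: "(\<And>a. a \<in> set l \<Longrightarrow> esize a \<le> z) \<Longrightarrow> esize l \<le> length l * (1 + z) + 1"
proof (induction l)
  case (Cons a l)
  then have "esize l \<le> length l * (1 + z) + 1" "esize a \<le> z" by simp_all
  then show ?case by simp
qed simp

lemma esize_nat: "esize (n :: nat) = 2 * n + 1"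
  by (induction n) auto

lemma esize_bool: "esize (b :: bool) \<le> 3"
  by (simp add: enc_bool_def)

section \<open>Closure properties\<close>

lemmas [pti] = ptime_fst ptime_snd

lemma ptime_case_list' [pti]:
  assumes "ptime l" "ptime f" "ptime (\<lambda>p. g (fst p) (fst (snd p)) (snd (snd p)))"
  shows "ptime (\<lambda>x. case l x of [] \<Rightarrow> f x | a # l' \<Rightarrow> g x a l')"
  by (rule ptime_case_list) (use assms in \<open>simp_all add: case_prod_unfold\<close>)

declare ptime_case_list [pti del]

lemma ptime_not [pti]: "ptime b \<Longrightarrow> ptime (\<lambda>x. \<not> b x)"
  by (rule ptime_recode[OF ptime_if[of b "\<lambda>_. False" "\<lambda>_. True"]]) (auto intro: pti)

lemma ptime_conj [pti]: "ptime a \<Longrightarrow> ptime b \<Longrightarrow> ptime (\<lambda>x. a x \<and> b x)"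
  by (rule ptime_recode[OF ptime_if[of a b "\<lambda>_. False"]]) (auto intro: pti)

lemma ptime_disj [pti]: "ptime a \<Longrightarrow> ptime b \<Longrightarrow> ptime (\<lambda>x. a x \<or> b x)"
  by (rule ptime_recode[OF ptime_if[of a "\<lambda>_. True" b]]) (auto intro: pti)

lemma ptime_bool_eq [pti]: "ptime a \<Longrightarrow> ptime b \<Longrightarrow> ptime (\<lambda>x. a x = (b x :: bool))"
  by (rule ptime_recode[OF ptime_if[of a b "\<lambda>x. \<not> b x"]]) (auto intro: pti)

lemma ptime_null [pti]: "ptime l \<Longrightarrow> ptime (\<lambda>x. l x = [])"
  by (rule ptime_recode[OF ptime_case_list'[of l "\<lambda>_. True" "\<lambda>_ _ _. False"]]) (auto intro: pti split: list.split)

lemma ptime_tl [pti]: "ptime l \<Longrightarrow> ptime (\<lambda>x. tl (l x))"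
  by (rule ptime_recode[OF ptime_case_list'[of l "\<lambda>_. []" "\<lambda>_ _ l'. l'"]]) (auto intro!: pti split: list.split)

text \<open>Iteration takes no parameters, so the state carries the environment and the unread rest
  of the list beside the accumulator. The bound concerns all prefixes, since these are the
  intermediate states.\<close>

theorem ptime_fold:
  assumes "ptime l" "ptime i" and g: "ptime (\<lambda>p. g (fst p) (fst (snd p)) (snd (snd p)))"
    and bnd: "\<And>e k. k \<le> length (l e) \<Longrightarrow> esize (fold (g e) (take k (l e)) (i e)) \<le> poly (q :: nat poly) (esize e)"
  shows "ptime (\<lambda>e. fold (g e) (l e) (i e))"
proof -
  define st where "st = (\<lambda>p. case fst (snd p) of [] \<Rightarrow> p | a # r \<Rightarrow> (fst p, r, g (fst p) a (snd (snd p))))"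
  have it: "(st ^^ k) (e, m, s) = (e, drop k m, fold (g e) (take k m) s)" for k e m s
  proof (induction k arbitrary: m s)
    case (Suc k)
    show ?case
    proof (cases m)
      case Nil
      then show ?thesis using Suc[of "[]" s] by (simp add: st_def)
    next
      case (Cons a r)
      then show ?thesis using Suc[of r "g e a s"] by (simp add: funpow_swap1) (simp add: st_def)
    qed
  qed simp
  obtain pl where pl: "\<And>e. esize (l e) \<le> poly (pl :: nat poly) (esize e)" using ptime_size[OF assms(1)] by blast
  have g': "ptime (\<lambda>x. g (f1 x) (f2 x) (f3 x))" if "ptime f1" "ptime f2" "ptime f3" for f1 f2 f3
    using ptime_compose[OF g, of "\<lambda>x. (f1 x, f2 x, f3 x)"] that by (simp add: ptime_Pair)
  have 1: "ptime st" unfolding st_def by (intro pti g')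
  have 2: "ptime (\<lambda>e. (e, l e, i e))" by (intro pti assms)
  have 3: "esize ((st ^^ k) (e, l e, i e)) \<le> poly ([:2, 1:] + pl + q) (esize e)" if "k \<le> length (l e)" for e k
  proof -
    have "esize (drop k m) \<le> esize m" for m :: "'b list"
      by (induction m arbitrary: k) (auto simp: drop_Cons' le_SucI trans_le_add2)
    then have "esize (drop k (l e)) \<le> poly pl (esize e)" using pl order_trans by blast
    then show ?thesis using bnd[OF that] by (simp add: it)
  qed
  have "ptime (\<lambda>e. (st ^^ length (l e)) (e, l e, i e))"
    by (rule ptime_iterate[OF assms(1) 2 1 3])
  then have "ptime (\<lambda>e. snd (snd ((st ^^ length (l e)) (e, l e, i e))))" by (intro pti)
  then show ?thesis by (simp add: it)
qed

text \<open>If each step adds a summand that is polynomial in the environment alone, the total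
  growth is at most a product of two polynomials.\<close>

theorem ptime_fold_additive:
  assumes "ptime l" "ptime i" "ptime (\<lambda>p. g (fst p) (fst (snd p)) (snd (snd p)))"
    and bnd: "\<And>e a s. a \<in> set (l e) \<Longrightarrow> esize (g e a s) \<le> esize s + poly (q :: nat poly) (esize e)"
  shows "ptime (\<lambda>e. fold (g e) (l e) (i e))"
proof -
  obtain pl where pl: "\<And>e. esize (l e) \<le> poly (pl :: nat poly) (esize e)" using ptime_size[OF assms(1)] by blast
  obtain pj where pj: "\<And>e. esize (i e) \<le> poly (pj :: nat poly) (esize e)" using ptime_size[OF assms(2)] by blast
  have f: "esize (fold (g e) m s) \<le> esize s + length m * poly q (esize e)" if "set m \<subseteq> set (l e)" for e m s
    using that
  proof (induction m arbitrary: s)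
    case (Cons a m)
    then show ?case using bnd[of a e s] Cons.IH[of "g e a s"] by fastforce
  qed simp
  show ?thesis
  proof (rule ptime_fold[OF assms(1-3)])
    fix e k
    have "length (take k (l e)) \<le> poly pl (esize e)" using pl[of e] length_le_esize[of "l e"] by simp
    then have "length (take k (l e)) * poly q (esize e) \<le> poly pl (esize e) * poly q (esize e)" by (rule mult_le_mono1)
    then show "esize (fold (g e) (take k (l e)) (i e)) \<le> poly (pj + pl * q) (esize e)"
      using f[of "take k (l e)" e "i e", OF set_take_subset] pj[of e] unfolding poly_add poly_mult by linarith
  qed
qed

lemma ptime_size_elem:
  assumes "ptime l" "ptime (\<lambda>p. f (fst p) (snd p))"
  shows "\<exists>q :: nat poly. \<forall>e. \<forall>a \<in> set (l e). esize (f e a) \<le> poly q (esize e)"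
proof -
  obtain pl where pl: "\<And>e. esize (l e) \<le> poly (pl :: nat poly) (esize e)" using ptime_size[OF assms(1)] by blast
  obtain pf where pf: "\<And>p. esize (f (fst p) (snd p)) \<le> poly (pf :: nat poly) (esize p)" using ptime_size[OF assms(2)] by blast
  have "esize (f e a) \<le> poly (pcompose pf ([:1, 1:] + pl)) (esize e)" if "a \<in> set (l e)" for e a
  proof -
    have "esize (e, a) \<le> 1 + esize e + poly pl (esize e)" using esize_in_list[OF that] pl[of e] by simp
    from mono_poly_nat[OF this, of pf] show ?thesis using pf[of "(e, a)"] by (simp add: poly_pcompose)
  qed
  then show ?thesis by blast
qed

lemma ptime_fold_Cons:
  assumes "ptime l" "ptime i" and f: "ptime (\<lambda>p. f (fst p) (snd p))" and P: "ptime (\<lambda>p. P (fst p) (snd p))"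
  shows "ptime (\<lambda>e. fold (\<lambda>a s. if P e a then f e a # s else s) (l e) (i e))"
proof -
  obtain q where q: "\<And>e a. a \<in> set (l e) \<Longrightarrow> esize (f e a) \<le> poly (q :: nat poly) (esize e)"
    using ptime_size_elem[OF assms(1) f] by blast
  have f': "ptime (\<lambda>x. f (f1 x) (f2 x))" if "ptime f1" "ptime f2" for f1 f2
    using ptime_compose[OF f, of "\<lambda>x. (f1 x, f2 x)"] that by (simp add: ptime_Pair)
  have P': "ptime (\<lambda>x. P (f1 x) (f2 x))" if "ptime f1" "ptime f2" for f1 f2
    using ptime_compose[OF P, of "\<lambda>x. (f1 x, f2 x)"] that by (simp add: ptime_Pair)
  show ?thesis
    by (rule ptime_fold_additive[where q = "[:1:] + q", OF assms(1,2)])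
       (use q in \<open>auto intro!: pti f' P' simp: trans_le_add2\<close>)
qed

lemma ptime_rev [pti]: assumes "ptime l" shows "ptime (\<lambda>e. rev (l e))"
  using ptime_fold_Cons[OF assms ptime_const[of "[]"], of "\<lambda>e a. a" "\<lambda>e a. True"]
  by (simp add: pti foldr_conv_fold[symmetric] fold_Cons_rev)

lemma fold_Cons_if: "fold (\<lambda>a s. if P a then f a # s else s) l s = rev (map f (filter P l)) @ s"
  by (induction l arbitrary: s) auto

lemma ptime_map_filter:
  assumes "ptime l" "ptime (\<lambda>p. f (fst p) (snd p))" "ptime (\<lambda>p. P (fst p) (snd p))"
  shows "ptime (\<lambda>e. map (f e) (filter (P e) (l e)))"
  using ptime_rev[OF ptime_fold_Cons[OF assms(1) ptime_const[of "[]"] assms(2,3)]] by (simp add: fold_Cons_if)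

lemma ptime_map [pti]:
  assumes "ptime l" "ptime (\<lambda>p. f (fst p) (snd p))" shows "ptime (\<lambda>e. map (f e) (l e))"
  using ptime_map_filter[OF assms, of "\<lambda>_ _. True"] by (simp add: ptime_const)

lemma ptime_filter [pti]:
  assumes "ptime l" "ptime (\<lambda>p. P (fst p) (snd p))" shows "ptime (\<lambda>e. filter (P e) (l e))"
  using ptime_map_filter[OF assms(1) _ assms(2), of "\<lambda>_ a. a"] by (simp add: ptime_snd)

lemma ptime_append [pti]:
  assumes "ptime l" "ptime m" shows "ptime (\<lambda>e. l e @ m e)"
  using ptime_fold_Cons[OF ptime_rev[OF assms(1)] assms(2), of "\<lambda>_ a. a" "\<lambda>_ _. True"]
  by (simp add: pti fold_Cons_rev)

lemma ptime_concat_map [pti]: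
  assumes "ptime l" and f: "ptime (\<lambda>p. f (fst p) (snd p))" shows "ptime (\<lambda>e. concat (map (f e) (l e)))"
proof -
  obtain q where q: "\<And>e a. a \<in> set (l e) \<Longrightarrow> esize (f e a) \<le> poly (q :: nat poly) (esize e)"
    using ptime_size_elem[OF assms] by blast
  have f': "ptime (\<lambda>x. f (f1 x) (f2 x))" if "ptime f1" "ptime f2" for f1 f2
    using ptime_compose[OF f, of "\<lambda>x. (f1 x, f2 x)"] that by (simp add: ptime_Pair)
  have "ptime (\<lambda>e. fold (\<lambda>a s. s @ f e a) (l e) [])"
  proof (rule ptime_fold_additive[where q = q, OF assms(1)])
    fix e a and s :: "'c list" assume "a \<in> set (l e)"
    then show "esize (s @ f e a) \<le> esize s + poly q (esize e)" using q[of a e] esize_append[of s "f e a"] by simp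
  qed (intro pti f')+
  moreover have "fold (\<lambda>a s. s @ f e a) m s = s @ concat (map (f e) m)" for e m s
    by (induction m arbitrary: s) auto
  ultimately show ?thesis by simp
qed

section \<open>Unary numbers\<close>

text \<open>A unary number is a list of that length, so unary arithmetic is list processing.\<close>

lemma enc_nat_replicate: "enc (n :: nat) = enc (replicate n False)"
  by (induction n) (auto simp: enc_bool_def)

lemma ptime_unary: "ptime n \<Longrightarrow> ptime (\<lambda>x. replicate (n x) False)"
  by (rule ptime_recode[of n]) (simp_all add: enc_nat_replicate)

lemma ptime_pred [pti]: "ptime n \<Longrightarrow> ptime (\<lambda>x. n x - (1 :: nat))"
  by (rule ptime_recode[OF ptime_tl[OF ptime_unary[of n]]]) (simp_all add: enc_nat_replicate)

lemma ptime_nat_zero [pti]: "ptime n \<Longrightarrow> ptime (\<lambda>x. n x = (0::nat))"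
  using ptime_null[OF ptime_unary[of n]] by simp

lemma ptime_length [pti]: "ptime l \<Longrightarrow> ptime (\<lambda>x. length (l x))"
  by (rule ptime_recode[OF ptime_map[of l "\<lambda>_ _. False"]]) (auto simp: enc_nat_replicate map_replicate_const intro: pti)

lemma ptime_funpow:
  fixes n :: "'e::enc \<Rightarrow> nat" and g :: "'e \<Rightarrow> 's::enc \<Rightarrow> 's"
  assumes "ptime n" "ptime i" "ptime (\<lambda>p. g (fst p) (snd p))"
    and bnd: "\<And>e k. k \<le> n e \<Longrightarrow> esize ((g e ^^ k) (i e)) \<le> poly (q :: nat poly) (esize e)"
  shows "ptime (\<lambda>e. (g e ^^ n e) (i e))"
proof -
  have f: "fold (\<lambda>_. h) l s = (h ^^ length l) s" for h :: "'s \<Rightarrow> 's" and l :: "bool list" and s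
    by (induction l arbitrary: s) (auto simp: funpow_swap1)
  have "ptime (\<lambda>p :: 'e \<times> bool \<times> 's. g (fst p) (snd (snd p)))"
    using ptime_compose[OF assms(3), of "\<lambda>p. (fst p, snd (snd p))"] by (simp add: pti)
  from ptime_fold[where q = q and g = "\<lambda>e _. g e", OF ptime_unary[OF assms(1)] assms(2) this]
  show ?thesis using bnd by (simp add: f min_def)
qed

lemma ptime_add [pti]: assumes "ptime a" "ptime b" shows "ptime (\<lambda>x. a x + (b x :: nat))"
proof -
  obtain qa where qa: "\<And>e. esize (a e) \<le> poly (qa :: nat poly) (esize e)" using ptime_size[OF assms(1)] by blast
  obtain qb where qb: "\<And>e. esize (b e) \<le> poly (qb :: nat poly) (esize e)" using ptime_size[OF assms(2)] by blast
  have S: "(Suc ^^ k) m = k + m" for k m by (induction k) auto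
  have "ptime (\<lambda>x. (Suc ^^ a x) (b x))"
  proof (rule ptime_funpow[where q = "qa + qb" and g = "\<lambda>_. Suc", OF assms])
    show "ptime (\<lambda>p. Suc (snd p))" by (intro pti)
    fix e k assume "k \<le> a e"
    then show "esize ((Suc ^^ k) (b e)) \<le> poly (qa + qb) (esize e)"
      using qa[of e] qb[of e] by (simp add: S esize_nat)
  qed
  then show ?thesis by (simp add: S)
qed

lemma ptime_diff [pti]: assumes "ptime a" "ptime b" shows "ptime (\<lambda>x. a x - (b x :: nat))"
proof -
  obtain qa where qa: "\<And>e. esize (a e) \<le> poly (qa :: nat poly) (esize e)" using ptime_size[OF assms(1)] by blast
  have S: "((\<lambda>x. x - Suc 0) ^^ k) m = m - k" for k m :: nat by (induction k) auto
  have "ptime (\<lambda>x. ((\<lambda>x. x - 1) ^^ b x) (a x))"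
  proof (rule ptime_funpow[where q = qa and g = "\<lambda>_ x. x - 1", OF assms(2,1)])
    show "ptime (\<lambda>p. snd p - (1::nat))" by (intro pti)
    fix e k
    show "esize (((\<lambda>x. x - 1) ^^ k) (a e)) \<le> poly qa (esize e)"
      using qa[of e] by (simp add: S esize_nat)
  qed
  then show ?thesis by (simp add: S)
qed

lemma ptime_mult [pti]: assumes "ptime a" "ptime b" shows "ptime (\<lambda>x. a x * (b x :: nat))"
proof -
  obtain qa where qa: "\<And>e. esize (a e) \<le> poly (qa :: nat poly) (esize e)" using ptime_size[OF assms(1)] by blast
  obtain qb where qb: "\<And>e. esize (b e) \<le> poly (qb :: nat poly) (esize e)" using ptime_size[OF assms(2)] by blast
  have S: "((\<lambda>s. s + m) ^^ k) 0 = k * m" for k m :: nat by (induction k) auto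
  have b': "ptime (\<lambda>p. b (fst p))" using ptime_compose[OF assms(2) ptime_fst] .
  have "ptime (\<lambda>x. ((\<lambda>s. s + b x) ^^ a x) 0)"
  proof (rule ptime_funpow[where q = "2 * qa * qb + 1" and g = "\<lambda>x s. s + b x", OF assms(1) ptime_const])
    show "ptime (\<lambda>p. snd p + b (fst p))" by (intro pti b')
    fix e k assume k: "k \<le> a e"
    have "k * b e \<le> poly qa (esize e) * poly qb (esize e)"
      using qa[of e] qb[of e] k by (intro mult_le_mono) (auto simp: esize_nat)
    then show "esize (((\<lambda>s. s + b e) ^^ k) 0) \<le> poly (2 * qa * qb + 1) (esize e)"
      by (simp add: S esize_nat)
  qed
  then show ?thesis by (simp add: S)
qed

lemma ptime_le [pti]: "ptime a \<Longrightarrow> ptime b \<Longrightarrow> ptime (\<lambda>x. a x \<le> (b x :: nat))"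
  using ptime_nat_zero[OF ptime_diff[of a b]] by simp

lemma ptime_less [pti]: "ptime a \<Longrightarrow> ptime b \<Longrightarrow> ptime (\<lambda>x. a x < (b x :: nat))"
  using ptime_not[OF ptime_le[of b a]] by (simp add: not_le)

lemma ptime_nat_eq [pti]: "ptime a \<Longrightarrow> ptime b \<Longrightarrow> ptime (\<lambda>x. a x = (b x :: nat))"
  using ptime_conj[OF ptime_le[of a b] ptime_le[of b a]] by (simp add: order_eq_iff[symmetric])

lemma esize_drop: "esize (drop k m) \<le> esize m"
  by (induction m arbitrary: k) (auto simp: drop_Cons' le_SucI trans_le_add2)

lemma ptime_drop [pti]: assumes "ptime n" "ptime l" shows "ptime (\<lambda>x. drop (n x) (l x))"
proof -
  obtain q where q: "\<And>e. esize (l e) \<le> poly (q :: nat poly) (esize e)" using ptime_size[OF assms(2)] by blast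
  have S: "(tl ^^ k) m = drop k m" for k and m :: "'b list"
    by (induction k) (auto simp: drop_Suc tl_drop)
  have "ptime (\<lambda>x. (tl ^^ n x) (l x))"
    by (rule ptime_funpow[where q = q and g = "\<lambda>_. tl", OF assms])
       (use q esize_drop order_trans in \<open>auto intro!: pti simp: S; blast\<close>)+
  then show ?thesis by (simp add: S)
qed

definition nthd :: "'a \<Rightarrow> 'a list \<Rightarrow> nat \<Rightarrow> 'a" where
  "nthd d l n = (case drop n l of [] \<Rightarrow> d | a # _ \<Rightarrow> a)"

lemma nthd_eq: "nthd d l n = (if n < length l then l ! n else d)"
  by (auto simp: nthd_def Cons_nth_drop_Suc[symmetric])

lemma ptime_nthd [pti]: "ptime d \<Longrightarrow> ptime l \<Longrightarrow> ptime n \<Longrightarrow> ptime (\<lambda>x. nthd (d x) (l x) (n x))"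
  unfolding nthd_def by (intro pti)

lemma ptime_upt [pti]: assumes "ptime n" shows "ptime (\<lambda>x. [0..<n x])"
proof -
  obtain q where q: "\<And>e. esize (n e) \<le> poly (q :: nat poly) (esize e)" using ptime_size[OF assms] by blast
  have S: "((\<lambda>l. length l # l) ^^ k) [] = rev [0..<k]" for k by (induction k) auto
  have "ptime (\<lambda>x. ((\<lambda>l. length l # l) ^^ n x) [])"
  proof (rule ptime_funpow[where q = "q * (1 + q) + 1" and g = "\<lambda>_ l. length l # l", OF assms ptime_const])
    show "ptime (\<lambda>p. length (snd p) # snd p)" by (intro pti)
    fix e k assume k: "k \<le> n e"
    have "esize (rev [0..<k]) \<le> length (rev [0..<k]) * (1 + (2 * n e + 1)) + 1"
      using k by (intro esize_list_bound) (auto simp: esize_nat)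
    also have "\<dots> \<le> poly q (esize e) * (1 + poly q (esize e)) + 1"
      using k q[of e] by (intro add_mono mult_le_mono) (auto simp: esize_nat)
    finally show "esize (((\<lambda>l. length l # l) ^^ k) []) \<le> poly (q * (1 + q) + 1) (esize e)" by (simp add: S)
  qed
  then have "ptime (\<lambda>x. rev (((\<lambda>l. length l # l) ^^ n x) []))" by (intro pti)
  then show ?thesis by (simp add: S)
qed

lemma ptime_replicate [pti]: assumes "ptime n" "ptime a" shows "ptime (\<lambda>x. replicate (n x) (a x))"
proof -
  have "ptime (\<lambda>x. map (\<lambda>_. a x) [0..<n x])"
    using ptime_compose[OF assms(2) ptime_fst] by (intro pti assms)
  then show ?thesis by (simp add: map_replicate_const)
qed

lemma ptime_list_ex [pti]: assumes "ptime l" "ptime (\<lambda>p. P (fst p) (snd p))" shows "ptime (\<lambda>e. \<exists>a \<in> set (l e). P e a)"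
  using ptime_not[OF ptime_null[OF ptime_filter[OF assms]]] by (simp add: filter_empty_conv)

lemma ptime_sum_list [pti]:
  assumes "ptime l" "ptime (\<lambda>p. f (fst p) (snd p))" shows "ptime (\<lambda>e. \<Sum>a\<leftarrow>l e. (f e a :: nat))"
proof -
  have "ptime (\<lambda>e. length (concat (map (\<lambda>a. replicate (f e a) False) (l e))))"
    by (intro pti ptime_unary assms)
  then show ?thesis by (simp add: length_concat comp_def)
qed

definition best :: "('a \<Rightarrow> 'a \<Rightarrow> bool) \<Rightarrow> 'a \<Rightarrow> 'a list \<Rightarrow> 'a" where
  "best R d xs = fold (\<lambda>x b. if R x b then x else b) xs d"

lemma best_in: "best R d xs \<in> insert d (set xs)"
proof (induction xs arbitrary: d)
  case (Cons x xs)
  show ?case using Cons[of x] Cons[of d] by (auto simp: best_def)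
qed (simp add: best_def)

text \<open>The current optimum is always an entry of the list or the default value, so its size
  needs no further hypothesis.\<close>

lemma ptime_best:
  assumes "ptime d" "ptime l" and R: "ptime (\<lambda>p. R (fst p) (fst (snd p)) (snd (snd p)))"
  shows "ptime (\<lambda>e. best (R e) (d e) (l e))"
proof -
  obtain q where q: "\<And>e. esize (l e) \<le> poly (q :: nat poly) (esize e)" using ptime_size[OF assms(2)] by blast
  obtain q' where q': "\<And>e. esize (d e) \<le> poly (q' :: nat poly) (esize e)" using ptime_size[OF assms(1)] by blast
  show ?thesis unfolding best_def
  proof (rule ptime_fold[where q = "q + q'", OF assms(2,1)])
    show "ptime (\<lambda>p. if R (fst p) (fst (snd p)) (snd (snd p)) then fst (snd p) else snd (snd p))"
      by (intro pti R)
    fix e k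
    have "best (R e) (d e) (take k (l e)) \<in> insert (d e) (set (l e))"
      using best_in[of "R e" "d e" "take k (l e)"] set_take_subset[of k "l e"] by auto
    then show "esize (fold (\<lambda>x b. if R e x b then x else b) (take k (l e)) (d e)) \<le> poly (q + q') (esize e)"
      unfolding best_def[symmetric] using q[of e] q'[of e] esize_in_list[of _ "l e"] by fastforce
  qed
qed

lemma ptime_list_eq_const: assumes "ptime l" shows "ptime (\<lambda>x. l x = (c :: bool list))"
proof -
  have "ptime (\<lambda>l. l = c)"
  proof (induction c)
    case Nil
    then show ?case by (intro pti)
  next
    case (Cons b c)
    have "ptime (\<lambda>l. case l of [] \<Rightarrow> False | a # l' \<Rightarrow> a = b \<and> l' = c)"
      by (intro pti ptime_compose[OF Cons, of "\<lambda>p. snd (snd p)"])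
    then show ?case by (rule ptime_recode) (auto split: list.split)
  qed
  from ptime_compose[OF this assms] show ?thesis .
qed

text \<open>Finite sets can be wired into a program. This serves for the accepted strings of a
  predicate and for the finitely many NO instances when \<delta> is large.\<close>

lemma ptime_member_finite:
  assumes "finite F" "ptime l" shows "ptime (\<lambda>x. l x \<in> (F :: bool list set))"
  using assms(1) by (induction F) (auto intro!: pti ptime_list_eq_const assms(2))

section \<open>Binary numbers\<close>

fun bval :: "bool list \<Rightarrow> nat" where
  "bval [] = 0"
| "bval (b # l) = of_bool b + 2 * bval l"

lemma binary_0 [simp]: "binary 0 = []"
  by (simp add: binary.simps)

lemma binary_pos: "0 < n \<Longrightarrow> binary n = odd n # binary (n div 2)"
  by (subst binary.simps) simp

lemma bval_binary [simp]: "bval (binary n) = n"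
proof (induction n rule: less_induct)
  case (less n)
  then show ?case by (cases "n = 0") (auto simp: binary_pos)
qed

lemma binary_eq_Nil: "binary n = [] \<longleftrightarrow> n = 0"
  by (cases "n = 0") (auto simp: binary_pos)

lemma binary_bval_Cons:
  "binary (bval (b # l)) = (if binary (bval l) = [] \<and> \<not> b then [] else b # binary (bval l))"
  by (cases "bval (b # l) = 0") (auto simp: binary_pos binary_eq_Nil)

lemma bval_append: "bval (l @ m) = bval l + 2 ^ length l * bval m"
  by (induction l) (auto simp: algebra_simps)

lemma bval_less: "bval l < 2 ^ length l"
  by (induction l) auto

lemma bval_drop_le: "bval (drop k l) \<le> bval l"
proof (induction l arbitrary: k)
  case (Cons b l)
  show ?case using Cons[of "k - 1"] by (cases k) auto
qed simp

lemma length_binary_le: "n < 2 ^ k \<Longrightarrow> length (binary n) \<le> k"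
proof (induction k arbitrary: n)
  case (Suc k)
  then show ?case by (cases "n = 0") (auto simp: binary_pos)
qed simp

lemma length_binary_gt: "n < 2 ^ length (binary n)"
  using bval_less[of "binary n"] by simp

lemma length_binary_mono: "m \<le> n \<Longrightarrow> length (binary m) \<le> length (binary n)"
  using length_binary_gt[of n] by (intro length_binary_le) simp

text \<open>The sum of the lengths, in place of the maximum plus one, gives addition the same bound
  as multiplication, so that \<open>ptime_Bn_fold\<close> covers both.\<close>

lemma length_binary_add: "length (binary (a + b)) \<le> length (binary a) + length (binary b)"
proof (cases "a = 0 \<or> b = 0")
  case False
  let ?x = "length (binary a)" and ?y = "length (binary b)"
  have "1 \<le> ?x" "1 \<le> ?y" using False by (auto simp: binary_pos)
  then have "(2::nat) ^ 1 \<le> 2 ^ ?x" "(2::nat) ^ 1 \<le> 2 ^ ?y" by (intro power_increasing; simp)+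
  moreover have "(u::nat) + v \<le> u * v" if "2 \<le> u" "2 \<le> v" for u v
  proof -
    have "u * 2 \<le> u * v" "2 * v \<le> u * v" using that by (intro mult_le_mono; simp)+
    then show ?thesis by linarith
  qed
  ultimately have "2 ^ ?x + 2 ^ ?y \<le> (2::nat) ^ (?x + ?y)" by (simp add: power_add)
  then show ?thesis using length_binary_gt[of a] length_binary_gt[of b] by (intro length_binary_le) linarith
qed auto

lemma length_binary_mult: "length (binary (a * b)) \<le> length (binary a) + length (binary b)"
  unfolding power_add using length_binary_gt[of a] length_binary_gt[of b]
  by (intro length_binary_le) (simp add: power_add mult_strict_mono)

text \<open>\<open>Bn\<close> only selects the encoding. Rules for binary arithmetic are stated for
  \<open>Bn (f e)\<close> with \<open>f\<close> an ordinary function to the naturals, so they apply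
  to ordinary terms.\<close>

datatype bn = Bn (unbn: nat)

instantiation bn :: enc
begin
definition enc_bn :: "bn \<Rightarrow> D" where "enc_bn x = enc (binary (unbn x))"
instance ..
end

lemma esize_Bn: "esize (Bn n) \<le> 4 * length (binary n) + 1"
  using esize_bools[of "binary n"] by (simp add: enc_bn_def)

lemma length_binary_esize: "length (binary n) \<le> esize (Bn n)"
  by (simp add: enc_bn_def length_le_esize)

lemma ptime_binary [pti]: "ptime (\<lambda>e. Bn (f e)) \<Longrightarrow> ptime (\<lambda>e. binary (f e))"
  by (rule ptime_recode[of "\<lambda>e. Bn (f e)"]) (simp_all add: enc_bn_def)

lemma ptime_unbn [pti]: "ptime x \<Longrightarrow> ptime (\<lambda>e. Bn (unbn (x e)))"
  by simp

text \<open>\<open>binary\<close> has no leading zeros: from the most significant bit on, zeros are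
  skipped up to the first one.\<close>

lemma fold_normalize: "fold (\<lambda>b s. if s = [] \<and> \<not> b then [] else b # s) (rev l) [] = binary (bval l)"
  by (induction l) (auto simp: binary_bval_Cons simp del: bval.simps(2))

lemma ptime_Bn_bval [pti]: assumes "ptime l" shows "ptime (\<lambda>e. Bn (bval (l e)))"
proof -
  have "ptime (\<lambda>e. fold (\<lambda>b s. if s = [] \<and> \<not> b then [] else b # s) (rev (l e)) [])"
    by (rule ptime_fold_additive[where q = "[:4:]"]) (auto intro!: pti assms simp: enc_bool_def)
  then show ?thesis by (rule ptime_recode) (simp add: fold_normalize enc_bn_def)
qed

text \<open>Addition and comparison inspect the bits of both arguments from the least significant one on,
  up to the sum of the lengths, which leaves room for the carry.\<close>

definition bits_upto :: "bool list \<Rightarrow> nat \<Rightarrow> nat" where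
  "bits_upto l k = (\<Sum>i<k. of_bool (nthd False l i) * 2 ^ i)"

lemma bits_upto_bval: "length l \<le> k \<Longrightarrow> bits_upto l k = bval l"
proof (induction l arbitrary: k)
  case Nil
  then show ?case by (simp add: bits_upto_def nthd_eq)
next
  case (Cons b l)
  then obtain k' where k: "k = Suc k'" by (cases k) auto
  have "(\<Sum>i<k'. of_bool (nthd False (b # l) (Suc i)) * 2 ^ Suc i) = (\<Sum>i<k'. 2 * (of_bool (nthd False l i) * 2 ^ i) :: nat)"
    by (rule sum.cong) (auto simp: nthd_def)
  then have "bits_upto (b # l) k = of_bool b + 2 * bits_upto l k'"
    unfolding bits_upto_def k sum.lessThan_Suc_shift sum_distrib_left by (simp add: nthd_def)
  then show ?case using Cons k by simp
qed

lemma bits_upto_less: "bits_upto l k < 2 ^ k"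
  by (induction k) (auto simp: bits_upto_def)

lemma bits_upto_Suc: "bits_upto l (Suc k) = bits_upto l k + of_bool (nthd False l k) * 2 ^ k"
  by (simp add: bits_upto_def)

definition add_step :: "bool list \<Rightarrow> bool list \<Rightarrow> nat \<Rightarrow> bool \<times> bool list \<Rightarrow> bool \<times> bool list" where
  "add_step x y i s = ((nthd False x i \<and> nthd False y i) \<or> (fst s \<and> (nthd False x i \<or> nthd False y i)),
     (nthd False x i \<noteq> (nthd False y i \<noteq> fst s)) # snd s)"

definition add_bits :: "bool list \<Rightarrow> bool list \<Rightarrow> bool list" where
  "add_bits x y = (let s = fold (add_step x y) [0..<length x + length y] (False, []) in rev (snd s) @ [fst s])"

lemma bval_add_bits: "bval (add_bits x y) = bval x + bval y"
proof -
  have inv: "length (snd (fold (add_step x y) [0..<k] (False, []))) = k \<and>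
    bval (rev (snd (fold (add_step x y) [0..<k] (False, [])))) + of_bool (fst (fold (add_step x y) [0..<k] (False, []))) * 2 ^ k
     = bits_upto x k + bits_upto y k" for k
  proof (induction k)
    case 0
    show ?case by (simp add: bits_upto_def)
  next
    case (Suc k)
    obtain c out where s: "fold (add_step x y) [0..<k] (False, []) = (c, out)" by fastforce
    have f: "fold (add_step x y) [0..<Suc k] (False, []) = add_step x y k (c, out)" by (simp add: s)
    show ?case using Suc unfolding s f
      by (cases "nthd False x k"; cases "nthd False y k"; cases c)
         (simp_all add: add_step_def bits_upto_Suc bval_append)
  qed
  from inv[of "length x + length y"] show ?thesis
    by (auto simp: add_bits_def Let_def bval_append bits_upto_bval)
qed

lemma ptime_add_bits [pti]: assumes "ptime x" "ptime y" shows "ptime (\<lambda>e. add_bits (x e) (y e))"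
proof -
  have xy: "ptime (\<lambda>p. x (fst p))" "ptime (\<lambda>p. y (fst p))" using assms ptime_compose[OF _ ptime_fst] by blast+
  have "ptime (\<lambda>e. fold (add_step (x e) (y e)) [0..<length (x e) + length (y e)] (False, []))"
  proof (rule ptime_fold_additive[where q = "[:7:]"])
    show "ptime (\<lambda>p. add_step (x (fst p)) (y (fst p)) (fst (snd p)) (snd (snd p)))"
      unfolding add_step_def by (intro pti xy)
    fix e a s
    show "esize (add_step (x e) (y e) a s) \<le> esize s + poly [:7:] (esize e)"
      using esize_bool by (cases s) (simp add: add_step_def enc_prod_def enc_bool_def)
  qed (intro pti assms)+
  then show ?thesis unfolding add_bits_def Let_def by (intro pti)
qed

lemma ptime_Bn_add [pti]:
  assumes "ptime (\<lambda>e. Bn (f e))" "ptime (\<lambda>e. Bn (g e))" shows "ptime (\<lambda>e. Bn (f e + g e))"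
proof -
  have "ptime (\<lambda>e. Bn (bval (add_bits (binary (f e)) (binary (g e)))))" by (intro pti assms)
  then show ?thesis by (simp add: bval_add_bits)
qed

text \<open>A constant of its own, so that the rule for the comparison of unary numbers does not apply.\<close>

definition ble :: "nat \<Rightarrow> nat \<Rightarrow> bool" where "ble a b \<longleftrightarrow> a \<le> b"

lemma ptime_ble [pti]:
  assumes "ptime (\<lambda>e. Bn (f e))" "ptime (\<lambda>e. Bn (g e))" shows "ptime (\<lambda>e. ble (f e) (g e))"
proof -
  \<comment> \<open>From the least significant bit on, the last position with different bits
    decides.\<close>
  define st where "st = (\<lambda>x y i r. if nthd False x i = nthd False y i then r else nthd False y i)"
  have inv: "fold (st x y) [0..<k] True \<longleftrightarrow> bits_upto x k \<le> bits_upto y k" for x y k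
  proof (induction k)
    case (Suc k)
    have "bits_upto x k < 2 ^ k" "bits_upto y k < 2 ^ k" by (rule bits_upto_less)+
    then show ?case using Suc by (auto simp: st_def bits_upto_Suc)
  qed (simp add: bits_upto_def)
  have b: "ptime (\<lambda>p. binary (f (fst p)))" "ptime (\<lambda>p. binary (g (fst p)))"
    using ptime_compose[OF ptime_binary[OF assms(1)] ptime_fst] ptime_compose[OF ptime_binary[OF assms(2)] ptime_fst] by simp_all
  have "ptime (\<lambda>e. fold (st (binary (f e)) (binary (g e))) [0..<length (binary (f e)) + length (binary (g e))] True)"
  proof (rule ptime_fold_additive[where q = "[:3:]"])
    show "ptime (\<lambda>p. st (binary (f (fst p))) (binary (g (fst p))) (fst (snd p)) (snd (snd p)))"
      unfolding st_def by (intro pti b)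
  qed (auto intro!: pti assms simp: trans_le_add2 esize_bool)
  then show ?thesis by (rule ptime_recode) (simp add: inv bits_upto_bval ble_def)
qed

lemma ptime_Bn_if [pti]:
  "ptime b \<Longrightarrow> ptime (\<lambda>e. Bn (f e)) \<Longrightarrow> ptime (\<lambda>e. Bn (g e)) \<Longrightarrow> ptime (\<lambda>e. Bn (if b e then f e else g e))"
  by (simp add: if_distrib[of Bn] ptime_if)

lemma ptime_Bn_fold:
  fixes l :: "'e::enc \<Rightarrow> 'a::enc list"
  assumes "ptime l" and f: "ptime (\<lambda>p. Bn (f (fst p) (snd p)))"
    and step: "ptime (\<lambda>p :: 'e \<times> 'a \<times> bn. Bn (opr (f (fst p) (fst (snd p))) (unbn (snd (snd p)))))"
    and len: "\<And>a b. length (binary (opr a b)) \<le> length (binary a) + length (binary b)"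
  shows "ptime (\<lambda>e. Bn (fold (\<lambda>a s. opr (f e a) s) (l e) u))"
proof -
  obtain pl where pl: "\<And>e. esize (l e) \<le> poly (pl :: nat poly) (esize e)" using ptime_size[OF assms(1)] by blast
  obtain q where q: "\<And>e a. a \<in> set (l e) \<Longrightarrow> esize (Bn (f e a)) \<le> poly (q :: nat poly) (esize e)"
    using ptime_size_elem[OF assms(1) f] by blast
  have fold_Bn: "fold (\<lambda>a s. Bn (opr (f e a) (unbn s))) m (Bn v) = Bn (fold (\<lambda>a s. opr (f e a) s) m v)" for e m v
    by (induction m arbitrary: v) auto
  have bl: "length (binary (fold (\<lambda>a s. opr (f e a) s) m v)) \<le> length (binary v) + length m * poly q (esize e)"
    if "set m \<subseteq> set (l e)" for e m v
    using that
  proof (induction m arbitrary: v)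
    case (Cons a m)
    have "length (binary (f e a)) \<le> poly q (esize e)"
      using q[of a e] length_binary_esize[of "f e a"] Cons.prems by force
    then show ?case using Cons.IH[of "opr (f e a) v"] Cons.prems len[of "f e a" v] by simp
  qed simp
  have "ptime (\<lambda>e. fold (\<lambda>a s. Bn (opr (f e a) (unbn s))) (l e) (Bn u))"
  proof (rule ptime_fold[OF assms(1) ptime_const step])
    fix e k
    have "length (take k (l e)) \<le> poly pl (esize e)" using pl[of e] length_le_esize[of "l e"] by simp
    then have "length (take k (l e)) * poly q (esize e) \<le> poly pl (esize e) * poly q (esize e)" by (rule mult_le_mono1)
    then have "length (binary (fold (\<lambda>a s. opr (f e a) s) (take k (l e)) u)) \<le> length (binary u) + poly pl (esize e) * poly q (esize e)"
      using bl[of "take k (l e)" e u, OF set_take_subset] by linarith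
    then show "esize (fold (\<lambda>a s. Bn (opr (f e a) (unbn s))) (take k (l e)) (Bn u)) \<le> poly ([:4 * length (binary u) + 1:] + 4 * pl * q) (esize e)"
      unfolding fold_Bn using esize_Bn[of "fold (\<lambda>a s. opr (f e a) s) (take k (l e)) u"] by (simp add: algebra_simps)
  qed
  then show ?thesis by (simp add: fold_Bn)
qed

lemma ptime_Bn_mult [pti]:
  assumes f: "ptime (\<lambda>e. Bn (f e))" and g: "ptime (\<lambda>e. Bn (g e))" shows "ptime (\<lambda>e. Bn (f e * g e))"
proof -
  obtain qf where qf: "\<And>e. esize (Bn (f e)) \<le> poly (qf :: nat poly) (esize e)" using ptime_size[OF f] by blast
  obtain qg where qg: "\<And>e. esize (Bn (g e)) \<le> poly (qg :: nat poly) (esize e)" using ptime_size[OF g] by blast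
  \<comment> \<open>Doubling and adding from the most significant bit on. Every intermediate value
    is \<open>f e\<close> times a leading part of \<open>g e\<close>, hence at most the
    product.\<close>
  define st where "st = (\<lambda>e b s. Bn (unbn s + unbn s + (if b then f e else 0)))"
  have val: "fold (st e) (rev l) (Bn 0) = Bn (f e * bval l)" for e l
    by (induction l) (auto simp: st_def algebra_simps)
  have f': "ptime (\<lambda>p. Bn (f (fst p)))" using ptime_compose[OF f ptime_fst] by simp
  have "ptime (\<lambda>e. fold (st e) (rev (binary (g e))) (Bn 0))"
  proof (rule ptime_fold[where q = "[:1:] + 4 * (qf + qg)"])
    show "ptime (\<lambda>p. st (fst p) (fst (snd p)) (snd (snd p)))" unfolding st_def by (intro pti f')
    fix e k
    let ?l = "drop (length (binary (g e)) - k) (binary (g e))"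
    have t: "take k (rev (binary (g e))) = rev ?l" by (simp add: take_rev)
    have "f e * bval ?l \<le> f e * g e" using bval_drop_le[of _ "binary (g e)"] by simp
    then have "length (binary (f e * bval ?l)) \<le> length (binary (f e)) + length (binary (g e))"
      using length_binary_mono length_binary_mult order_trans by blast
    then show "esize (fold (st e) (take k (rev (binary (g e)))) (Bn 0)) \<le> poly ([:1:] + 4 * (qf + qg)) (esize e)"
      unfolding t val using esize_Bn[of "f e * bval ?l"] qf[of e] qg[of e] length_binary_esize[of "f e"] length_binary_esize[of "g e"]
      by (simp add: algebra_simps)
  qed (intro pti g)+
  then show ?thesis by (simp add: val)
qed

lemma ptime_Bn_sum_list [pti]:
  assumes "ptime l" and f: "ptime (\<lambda>p. Bn (f (fst p) (snd p)))" shows "ptime (\<lambda>e. Bn (\<Sum>a\<leftarrow>l e. f e a))"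
proof -
  have f': "ptime (\<lambda>p. Bn (f (fst p) (fst (snd p))))"
    using ptime_compose[OF f, of "\<lambda>p. (fst p, fst (snd p))"] by (simp add: pti)
  have "ptime (\<lambda>e. Bn (fold (\<lambda>a s. f e a + s) (l e) 0))"
    by (rule ptime_Bn_fold[OF assms _ length_binary_add]) (intro pti f')
  moreover have "fold (\<lambda>a s. f e a + s) m v = v + (\<Sum>a\<leftarrow>m. f e a)" for e m v
    by (induction m arbitrary: v) auto
  ultimately show ?thesis by simp
qed

lemma ptime_Bn_prod_list [pti]:
  assumes "ptime l" and f: "ptime (\<lambda>p. Bn (f (fst p) (snd p)))" shows "ptime (\<lambda>e. Bn (\<Prod>a\<leftarrow>l e. f e a))"
proof -
  have f': "ptime (\<lambda>p. Bn (f (fst p) (fst (snd p))))"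
    using ptime_compose[OF f, of "\<lambda>p. (fst p, fst (snd p))"] by (simp add: pti)
  have "ptime (\<lambda>e. Bn (fold (\<lambda>a s. f e a * s) (l e) 1))"
    by (rule ptime_Bn_fold[OF assms _ length_binary_mult]) (intro pti f')
  moreover have "fold (\<lambda>a s. f e a * s) m v = v * (\<Prod>a\<leftarrow>m. f e a)" for e m v
    by (induction m arbitrary: v) auto
  ultimately show ?thesis by simp
qed

lemma ptime_Bn_unary [pti]: assumes "ptime n" shows "ptime (\<lambda>e. Bn (n e))"
proof -
  have "ptime (\<lambda>e. Bn (\<Sum>a\<leftarrow>replicate (n e) False. 1))" by (intro pti ptime_unary assms)
  then show ?thesis by (simp add: sum_list_replicate)
qed

section \<open>Parsing\<close>

text \<open>Going from binary to unary can be exponential. The cap \<open>m\<close> prevents this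
  and changes nothing when it bounds the true value.\<close>

definition clamp :: "nat \<Rightarrow> bool list \<Rightarrow> nat" where
  "clamp m l = fold (\<lambda>b s. if s + s + (if b then 1 else 0) \<le> m then s + s + (if b then 1 else 0) else m) (rev l) 0"

lemma clamp_eq: "clamp m l = min m (bval l)"
  by (induction l) (auto simp: clamp_def min_def)

lemma ptime_clamp [pti]: assumes "ptime m" "ptime l" shows "ptime (\<lambda>e. clamp (m e) (l e))"
proof -
  obtain q where q: "\<And>e. esize (m e) \<le> poly (q :: nat poly) (esize e)" using ptime_size[OF assms(1)] by blast
  have m': "ptime (\<lambda>p. m (fst p))" using ptime_compose[OF assms(1) ptime_fst] .
  show ?thesis unfolding clamp_def
  proof (rule ptime_fold[where q = q])
    fix e k
    have "take k (rev (l e)) = rev (drop (length (l e) - k) (l e))" by (simp add: take_rev)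
    then show "esize (fold (\<lambda>b s. if s + s + (if b then 1 else 0) \<le> m e then s + s + (if b then 1 else 0) else m e) (take k (rev (l e))) 0) \<le> poly q (esize e)"
      using q[of e] clamp_eq[of "m e" "drop (length (l e) - k) (l e)"] by (simp add: clamp_def[symmetric] esize_nat)
  qed (intro pti assms m')+
qed

text \<open>The state consists of the pending first half of a pair of bits, the current token
  reversed, and the finished tokens reversed. Unequal halves end a token.\<close>

definition tok_step :: "bool \<Rightarrow> bool list \<times> bool list \<times> bool list list \<Rightarrow> bool list \<times> bool list \<times> bool list list" where
  "tok_step b s = (case fst s of [] \<Rightarrow> ([b], fst (snd s), snd (snd s))
     | a # _ \<Rightarrow> if a = b then ([], b # fst (snd s), snd (snd s)) else ([], [], rev (fst (snd s)) # snd (snd s)))"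

definition undelim :: "bool list \<Rightarrow> bool list list" where
  "undelim x = rev (snd (snd (fold tok_step x ([], [], []))))"

lemma tok_step_bits: "fold tok_step (concat (map (\<lambda>b. [b, b]) x)) ([], c, out) = ([], rev x @ c, out)"
  by (induction x arbitrary: c) (auto simp: tok_step_def)

lemma tok_step_delimit: "fold tok_step (delimit x) ([], [], out) = ([], [], x # out)"
  by (simp add: delimit_def tok_step_bits) (simp add: tok_step_def)

lemma undelim_concat: "undelim (concat (map delimit xs)) = xs"
proof -
  have "fold tok_step (concat (map delimit xs)) ([], [], out) = ([], [], rev xs @ out)" for out
    by (induction xs arbitrary: out) (auto simp: tok_step_delimit)
  then show ?thesis by (simp add: undelim_def)
qed

lemma undelim_first: "\<exists>ys. undelim (delimit x @ y) = x # ys"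
proof -
  have "\<exists>o'. snd (snd (fold tok_step y s)) = o' @ snd (snd s)" for s
  proof (induction y arbitrary: s)
    case (Cons b y)
    obtain o' where "snd (snd (fold tok_step y (tok_step b s))) = o' @ snd (snd (tok_step b s))" using Cons by blast
    moreover have "\<exists>o'. snd (snd (tok_step b s)) = o' @ snd (snd s)" by (auto simp: tok_step_def split: list.split)
    ultimately show ?case by auto
  qed simp
  from this[of "([], [], [x])"] obtain o' where "snd (snd (fold tok_step y ([], [], [x]))) = o' @ [x]" by auto
  then show ?thesis by (intro exI[of _ "rev o'"]) (simp add: undelim_def tok_step_delimit)
qed

lemma esize_rev: "esize (rev l) = esize l"
proof (induction l)
  case (Cons a l)
  then show ?case using esize_append[of "rev l" "[a]"] by simp
qed simp

lemma ptime_undelim [pti]: assumes "ptime l" shows "ptime (\<lambda>e. undelim (l e))"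
proof -
  have "ptime (\<lambda>e. fold tok_step (l e) ([], [], []))"
  proof (rule ptime_fold_additive[where q = "[:6:]" and g = "\<lambda>_. tok_step"])
    show "ptime (\<lambda>p. tok_step (fst (snd p)) (snd (snd p)))" unfolding tok_step_def by (intro pti)
    fix e a s
    show "esize (tok_step a s) \<le> esize s + poly [:6:] (esize e)"
      using esize_bool[of a] by (cases s) (auto simp: tok_step_def esize_rev enc_prod_def split: list.split)
  qed (intro pti assms)+
  then show ?thesis unfolding undelim_def by (intro pti)
qed

lemma ptime_delimit [pti]: "ptime l \<Longrightarrow> ptime (\<lambda>e. delimit (l e))"
  unfolding delimit_def by (intro pti)

text \<open>The verifier decodes its first block and decides membership of that. The bound 0 leaves
  only the empty certificate.\<close>

theorem P_subset_NP: "class_P \<subseteq> class_NP"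
proof
  fix L assume "L \<in> class_P"
  then have "ptime (\<lambda>x. [x \<in> L])" using poly_time_imp_ptime by (simp add: class_P_def)
  from ptime_compose[OF this, of "\<lambda>x. case undelim x of [] \<Rightarrow> [] | a # _ \<Rightarrow> a"]
  have "ptime (\<lambda>x. [(case undelim x of [] \<Rightarrow> [] | a # _ \<Rightarrow> a) \<in> L])" by (simp add: pti)
  then have "{x. (case undelim x of [] \<Rightarrow> [] | a # _ \<Rightarrow> a) \<in> L} \<in> class_P"
    using ptime_imp_poly_time by (simp add: class_P_def)
  moreover have "x \<in> L \<longleftrightarrow> (\<exists>y. length y \<le> poly (0 :: nat poly) (length x) \<and> delimit x @ y \<in> {x. (case undelim x of [] \<Rightarrow> [] | a # _ \<Rightarrow> a) \<in> L})" for x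
    using undelim_first[of x "[]"] by auto
  ultimately show "L \<in> class_NP" unfolding class_NP_def by blast
qed

section \<open>Reading instances\<close>

definition csp_tokens :: "csp \<Rightarrow> bool list list" where
  "csp_tokens \<Psi> = binary (num_vertices \<Psi>) #
     concat (map (\<lambda>i. [binary (nat (fst (quotient_of (weight \<Psi> i)))), binary (nat (snd (quotient_of (weight \<Psi> i))))]) [0..<num_vertices \<Psi>]) @
     binary (length (constraints \<Psi>)) # concat (map (map binary) (constraints \<Psi>))"

lemma encode_csp_tokens: "encode_csp \<Psi> = concat (map delimit (csp_tokens \<Psi>))"
proof -
  have h: "concat (map delimit (concat (map f xs))) = concat (map (\<lambda>x. concat (map delimit (f x))) xs)"
    for f :: "'b \<Rightarrow> bool list list" and xs
    by (induction xs) auto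
  have "encode_nat = delimit \<circ> binary" by (auto simp: encode_nat_def)
  then show ?thesis by (simp add: encode_csp_def csp_tokens_def encode_rat_def h comp_def encode_nat_def)
qed

lemma undelim_encode_csp: "undelim (encode_csp \<Psi>) = csp_tokens \<Psi>"
  by (simp add: encode_csp_tokens undelim_concat)

lemma nth_concat_const_length:
  "(\<And>x. x \<in> set xs \<Longrightarrow> length x = r) \<Longrightarrow> j < length xs \<Longrightarrow> t < r \<Longrightarrow> concat xs ! (j * r + t) = xs ! j ! t"
proof (induction xs arbitrary: j)
  case (Cons x xs)
  then show ?case by (cases j) (auto simp: nth_append)
qed simp

lemma length_concat_const: "(\<And>x. x \<in> set xs \<Longrightarrow> length x = r) \<Longrightarrow> length (concat xs) = length xs * r"
  by (induction xs) auto

lemma length_csp_tokens: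
  assumes "csp_instance r \<Psi>"
  shows "length (csp_tokens \<Psi>) = 2 + 2 * num_vertices \<Psi> + length (constraints \<Psi>) * r"
proof -
  have "length (concat (map (map binary) (constraints \<Psi>))) = length (map (map binary) (constraints \<Psi>)) * r"
    using assms by (intro length_concat_const) (auto simp: csp_instance_def)
  moreover have "length (concat (map (\<lambda>i. [f i, g i]) [0..<n])) = 2 * n" for f g :: "nat \<Rightarrow> bool list" and n
    by (induction n) auto
  ultimately show ?thesis by (simp add: csp_tokens_def)
qed

lemma length_encode_csp: "length (csp_tokens \<Psi>) \<le> length (encode_csp \<Psi>)"
proof -
  have "length xs \<le> length (concat (map delimit xs))" for xs by (induction xs) (auto simp: delimit_def)
  then show ?thesis by (simp add: encode_csp_tokens)
qed

text \<open>Token 0 is the number of vertices, followed by two tokens per vertex, the number of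
  constraints, and \<open>r\<close> tokens per constraint. Counts and vertices become unary, capped
  by the code length, which exceeds them since every vertex and, for \<open>1 \<le> r\<close>, every
  constraint has a token. Weights may be exponentially large and stay binary.\<close>

definition parse_n :: "bool list \<Rightarrow> nat" where
  "parse_n x = clamp (length x) (nthd [] (undelim x) 0)"

definition parse_w :: "bool list \<Rightarrow> (bn \<times> bn) list" where
  "parse_w x = map (\<lambda>i. (Bn (bval (nthd [] (undelim x) (1 + 2 * i))), Bn (bval (nthd [] (undelim x) (2 + 2 * i))))) [0..<parse_n x]"

definition parse_c :: "nat \<Rightarrow> bool list \<Rightarrow> nat list list" where
  "parse_c r x = map (\<lambda>j. map (\<lambda>t. clamp (length x) (nthd [] (undelim x) (2 + 2 * parse_n x + (j * r + t)))) [0..<r])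
     [0..<clamp (length x) (nthd [] (undelim x) (1 + 2 * parse_n x))]"

lemma ptime_compose_fst: "ptime f \<Longrightarrow> ptime (\<lambda>p. f (fst p))"
  by (rule ptime_compose[OF _ ptime_fst])

lemma ptime_parse_n [pti]: "ptime x \<Longrightarrow> ptime (\<lambda>e. parse_n (x e))"
  unfolding parse_n_def by (intro pti)

lemma ptime_parse_w [pti]: "ptime x \<Longrightarrow> ptime (\<lambda>e. parse_w (x e))"
  unfolding parse_w_def by (intro pti ptime_compose_fst)

lemma ptime_parse_c [pti]: "ptime x \<Longrightarrow> ptime (\<lambda>e. parse_c r (x e))"
  unfolding parse_c_def by (intro pti ptime_compose[of x "\<lambda>p. fst (fst p)"] ptime_compose_fst)

context
  fixes r :: nat and \<Psi> :: csp
  assumes inst: "csp_instance r \<Psi>" and r: "1 \<le> r"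
begin

lemma sizes_le_encode_csp: "num_vertices \<Psi> \<le> length (encode_csp \<Psi>)" "length (constraints \<Psi>) \<le> length (encode_csp \<Psi>)"
proof -
  have "length (constraints \<Psi>) * 1 \<le> length (constraints \<Psi>) * r" using r by (intro mult_le_mono) auto
  then show "num_vertices \<Psi> \<le> length (encode_csp \<Psi>)" "length (constraints \<Psi>) \<le> length (encode_csp \<Psi>)"
    using length_encode_csp[of \<Psi>] length_csp_tokens[OF inst] by linarith+
qed

lemma parse_n_encode: "parse_n (encode_csp \<Psi>) = num_vertices \<Psi>"
  using sizes_le_encode_csp(1) by (simp add: parse_n_def undelim_encode_csp nthd_eq clamp_eq csp_tokens_def)

lemma parse_w_encode:
  "parse_w (encode_csp \<Psi>) = map (\<lambda>i. (Bn (nat (fst (quotient_of (weight \<Psi> i)))), Bn (nat (snd (quotient_of (weight \<Psi> i)))))) [0..<num_vertices \<Psi>]"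
proof -
  let ?W = "map (\<lambda>i. [binary (nat (fst (quotient_of (weight \<Psi> i)))), binary (nat (snd (quotient_of (weight \<Psi> i))))]) [0..<num_vertices \<Psi>]"
  have len: "length (concat ?W) = num_vertices \<Psi> * 2" by (subst length_concat_const[of _ 2]) auto
  have "nthd [] (csp_tokens \<Psi>) (1 + 2 * i + t) = ?W ! i ! t" if "i < num_vertices \<Psi>" "t < 2" for i t
  proof -
    have "i * 2 + t < length (concat ?W)" using that len by simp
    then have "nthd [] (csp_tokens \<Psi>) (1 + 2 * i + t) = concat ?W ! (i * 2 + t)"
      by (simp add: nthd_eq csp_tokens_def nth_append mult.commute)
    also have "\<dots> = ?W ! i ! t" by (rule nth_concat_const_length) (use that in auto)
    finally show ?thesis .
  qed
  from this[of _ 0] this[of _ 1] show ?thesis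
    by (auto simp: parse_w_def parse_n_encode undelim_encode_csp)
qed

lemma parse_c_encode: "parse_c r (encode_csp \<Psi>) = constraints \<Psi>"
proof -
  let ?C = "map (map binary) (constraints \<Psi>)" and ?x = "encode_csp \<Psi>"
  let ?W = "map (\<lambda>i. [binary (nat (fst (quotient_of (weight \<Psi> i)))), binary (nat (snd (quotient_of (weight \<Psi> i))))]) [0..<num_vertices \<Psi>]"
  have e: "length c = r" "set c \<subseteq> {..<num_vertices \<Psi>}" if "c \<in> set (constraints \<Psi>)" for c
    using inst that by (auto simp: csp_instance_def)
  have lenW: "length (concat ?W) = 2 * num_vertices \<Psi>" by (subst length_concat_const[of _ 2]) auto
  have lenC: "length (concat ?C) = length (constraints \<Psi>) * r" by (subst length_concat_const[of _ r]) (auto simp: e)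
  have m: "clamp (length ?x) (nthd [] (csp_tokens \<Psi>) (1 + 2 * num_vertices \<Psi>)) = length (constraints \<Psi>)"
    using sizes_le_encode_csp(2) lenW by (simp add: nthd_eq clamp_eq csp_tokens_def nth_append)
  have v: "clamp (length ?x) (nthd [] (csp_tokens \<Psi>) (2 + 2 * num_vertices \<Psi> + (j * r + t))) = constraints \<Psi> ! j ! t"
    if jt: "j < length (constraints \<Psi>)" "t < r" for j t
  proof -
    have "j * r + t < length (constraints \<Psi>) * r"
    proof -
      have "j * r + t < Suc j * r" using jt(2) by simp
      also have "\<dots> \<le> length (constraints \<Psi>) * r" using jt(1) by (intro mult_le_mono) auto
      finally show ?thesis .
    qed
    then have "nthd [] (csp_tokens \<Psi>) (2 + 2 * num_vertices \<Psi> + (j * r + t)) = concat ?C ! (j * r + t)"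
      using lenW lenC by (simp add: nthd_eq csp_tokens_def nth_append)
    also have "\<dots> = ?C ! j ! t" using jt e by (intro nth_concat_const_length) auto
    also have "\<dots> = binary (constraints \<Psi> ! j ! t)" using jt e by simp
    finally have b: "nthd [] (csp_tokens \<Psi>) (2 + 2 * num_vertices \<Psi> + (j * r + t)) = binary (constraints \<Psi> ! j ! t)" .
    have "constraints \<Psi> ! j ! t \<in> set (constraints \<Psi> ! j)" using e[of "constraints \<Psi> ! j"] jt by auto
    then have "constraints \<Psi> ! j ! t < num_vertices \<Psi>" using e(2)[of "constraints \<Psi> ! j"] jt by auto
    then show ?thesis using sizes_le_encode_csp(1) unfolding b clamp_eq by simp
  qed
  show ?thesis unfolding parse_c_def undelim_encode_csp parse_n_encode m
    by (rule nth_equalityI) (auto intro!: nth_equalityI simp: v[simplified] e)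
qed

end

section \<open>Values and approximation factors\<close>

lemma finite_labelings: "finite (labelings \<Psi>)"
  unfolding labelings_def using finite_lists_length_eq[of "UNIV :: bool set" "num_vertices \<Psi>"] by simp

lemma relative_weight_zero: "relative_weight \<Psi> (replicate (num_vertices \<Psi>) False) = 0"
proof -
  have "{i. i < num_vertices \<Psi> \<and> replicate (num_vertices \<Psi>) False ! i} = {}" by auto
  then show ?thesis unfolding relative_weight_def by (simp only: sum.empty div_0)
qed

lemma biased_value_ge:
  assumes "\<sigma> \<in> labelings \<Psi>" "relative_weight \<Psi> \<sigma> \<le> \<mu>"
  shows "labeling_value \<psi> \<Psi> \<sigma> \<le> biased_value \<psi> \<mu> \<Psi>"
  unfolding biased_value_def using finite_labelings[of \<Psi>] assms
  by (intro Max_ge finite_subset[OF _ finite_imageI[of "labelings \<Psi>" "labeling_value \<psi> \<Psi>"]]) auto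

lemma biased_value_attained:
  assumes "0 \<le> \<mu>"
  obtains \<sigma> where "\<sigma> \<in> labelings \<Psi>" "relative_weight \<Psi> \<sigma> \<le> \<mu>" "biased_value \<psi> \<mu> \<Psi> = labeling_value \<psi> \<Psi> \<sigma>"
proof -
  let ?A = "{labeling_value \<psi> \<Psi> \<sigma> | \<sigma>. \<sigma> \<in> labelings \<Psi> \<and> relative_weight \<Psi> \<sigma> \<le> \<mu>}"
  have "finite ?A" using finite_labelings[of \<Psi>]
    by (intro finite_subset[OF _ finite_imageI[of "labelings \<Psi>" "labeling_value \<psi> \<Psi>"]]) auto
  moreover have "replicate (num_vertices \<Psi>) False \<in> labelings \<Psi>" by (simp add: labelings_def)
  then have "?A \<noteq> {}" using relative_weight_zero[of \<Psi>] assms by auto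
  ultimately have "biased_value \<psi> \<mu> \<Psi> \<in> ?A" unfolding biased_value_def by (rule Max_in)
  then show ?thesis using that by auto
qed

lemma zero_labeling:
  assumes "1 \<le> r"
  shows "\<exists>f. poly_time f \<and> (\<forall>\<Psi>. csp_instance r \<Psi> \<longrightarrow> f (encode_csp \<Psi>) = replicate (num_vertices \<Psi>) False)"
proof (intro exI conjI allI impI)
  show "poly_time (\<lambda>x. replicate (parse_n x) False)" by (intro ptime_imp_poly_time pti)
qed (simp add: parse_n_encode[OF _ assms])

lemma labeling_value_nonneg: "0 \<le> labeling_value \<psi> \<Psi> \<sigma>"
  by (simp add: labeling_value_def)

text \<open>Serves twice: for the factor 0, which makes the supremum in \<open>approx_factor\<close>
  one over a nonempty set, and for predicates that accept the zero string.\<close>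

lemma achievable_by_zero:
  assumes "1 \<le> r" "0 \<le> \<mu>"
    and "\<And>\<Psi>. csp_instance r \<Psi> \<Longrightarrow> a * biased_value \<psi> \<mu> \<Psi> \<le> labeling_value \<psi> \<Psi> (replicate (num_vertices \<Psi>) False)"
  shows "achievable_factor r \<psi> \<mu> a"
proof -
  obtain f where f: "poly_time f" "\<And>\<Psi>. csp_instance r \<Psi> \<Longrightarrow> f (encode_csp \<Psi>) = replicate (num_vertices \<Psi>) False"
    using zero_labeling[OF assms(1)] by blast
  show ?thesis unfolding achievable_factor_def
    using f assms by (intro allI impI exI[of _ f]) (auto simp: relative_weight_zero labelings_def)
qed

lemma zero_achievable: "1 \<le> r \<Longrightarrow> 0 \<le> \<mu> \<Longrightarrow> achievable_factor r \<psi> \<mu> 0"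
  by (rule achievable_by_zero) (auto simp: labeling_value_nonneg)

lemma approx_factor_ge: "achievable_factor r \<psi> \<mu> a \<Longrightarrow> 0 \<le> a \<Longrightarrow> a \<le> 1 \<Longrightarrow> a \<le> approx_factor r \<psi> \<mu>"
  unfolding approx_factor_def by (intro cSup_upper bdd_aboveI[of _ 1]) auto

lemma approx_factor_nonneg: "1 \<le> r \<Longrightarrow> 0 \<le> \<mu> \<Longrightarrow> 0 \<le> approx_factor r \<psi> \<mu>"
  using approx_factor_ge[OF zero_achievable] by simp

text \<open>Biased values are nonnegative, so smaller factors are easier, and everything below the
  supremum is achievable whether or not the supremum is attained.\<close>

lemma achievable_below:
  assumes "1 \<le> r" "0 \<le> \<mu>" "a < approx_factor r \<psi> \<mu>"
  shows "achievable_factor r \<psi> \<mu> a"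
proof -
  have "{a \<in> {0..1}. achievable_factor r \<psi> \<mu> a} \<noteq> {}" using zero_achievable[OF assms(1,2)] by (auto intro!: exI[of _ 0])
  then obtain b where b: "achievable_factor r \<psi> \<mu> b" "a < b"
    using assms(3) unfolding approx_factor_def by (auto elim: less_cSupE)
  have "0 \<le> biased_value \<psi> \<mu> \<Psi>" for \<Psi>
    using biased_value_attained[OF assms(2)] labeling_value_nonneg by metis
  then have "a * biased_value \<psi> \<mu> \<Psi> \<le> b * biased_value \<psi> \<mu> \<Psi>" for \<Psi>
    using b(2) by (intro mult_right_mono) auto
  then show ?thesis using b(1) unfolding achievable_factor_def by (meson order_trans)
qed

section \<open>Edges inside small sets\<close>

text \<open>The integer square root of the code length: an adjacency matrix has \<open>n * n\<close>
  entries, and exactly the numbers below \<open>n\<close> have a smaller square.\<close>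

definition gr_n :: "bool list \<Rightarrow> nat" where
  "gr_n y = length (filter (\<lambda>i. i * i < length y) [0..<length y])"

definition gr_e :: "bool list \<Rightarrow> (nat \<times> nat) list" where
  "gr_e y = filter (\<lambda>p. nthd False y (fst p * gr_n y + snd p)) (concat (map (\<lambda>i. map (\<lambda>j. (i, j)) [0..<gr_n y]) [0..<gr_n y]))"

lemma ptime_gr_n [pti]: "ptime y \<Longrightarrow> ptime (\<lambda>e. gr_n (y e))"
  unfolding gr_n_def by (intro pti ptime_compose_fst)

lemma ptime_gr_e [pti]: "ptime y \<Longrightarrow> ptime (\<lambda>e. gr_e (y e))"
  unfolding gr_e_def by (intro pti ptime_compose_fst)

lemma gr_n_encode: "gr_n (encode_graph n E) = n"
proof -
  have "i < n" if "i * i < n * n" for i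
    using that by (metis linorder_not_le mult_le_mono)
  moreover have "i * i < n * n \<and> i < n * n" if "i < n" for i
  proof -
    have "i * i < n * n" using that by (intro mult_strict_mono) auto
    moreover have "i * 1 < n * n" using that by (intro mult_less_le_imp_less) auto
    ultimately show ?thesis by simp
  qed
  ultimately have "{i. i < n * n \<and> i * i < n * n} = {..<n}" by blast
  then show ?thesis by (simp add: gr_n_def encode_graph_def length_filter_conv_card cong: conj_cong)
qed

lemma nthd_encode_graph: "i < n \<Longrightarrow> j < n \<Longrightarrow> nthd False (encode_graph n E) (i * n + j) \<longleftrightarrow> (i, j) \<in> E"
proof -
  assume ij: "i < n" "j < n"
  have "i * n + j < Suc i * n" using ij by simp
  also have "\<dots> \<le> n * n" using ij by (intro mult_le_mono) auto
  finally have "i * n + j < n * n" .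
  then show ?thesis using ij by (simp add: nthd_eq encode_graph_def)
qed

lemma gr_e_encode:
  assumes "E \<subseteq> {..<n} \<times> {..<n}"
  shows "set (gr_e (encode_graph n E)) = E" "distinct (gr_e (encode_graph n E))"
proof -
  show "set (gr_e (encode_graph n E)) = E"
  proof -
    have s: "set (concat (map (\<lambda>i. map (\<lambda>j. (i, j)) [0..<n]) [0..<n])) = {..<n} \<times> {..<n}" by auto
    have "(p \<in> {..<n} \<times> {..<n} \<and> nthd False (encode_graph n E) (fst p * n + snd p)) \<longleftrightarrow> p \<in> E" for p
      using assms nthd_encode_graph[of "fst p" n "snd p" E] by (cases p) auto
    then show ?thesis unfolding gr_e_def gr_n_encode set_filter s by blast
  qed
  show "distinct (gr_e (encode_graph n E))"
    unfolding gr_e_def product_concat_map[symmetric] by (intro distinct_filter distinct_product) auto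
qed

lemma encode_graph_inject:
  assumes "encode_graph n E = encode_graph n' E'" "E \<subseteq> {..<n} \<times> {..<n}" "E' \<subseteq> {..<n'} \<times> {..<n'}"
  shows "n = n'" "E = E'"
  using assms gr_n_encode[of n E] gr_n_encode[of n' E'] gr_e_encode(1)[OF assms(2)] gr_e_encode(1)[OF assms(3)] by simp_all

definition inside :: "nat rel \<Rightarrow> nat set \<Rightarrow> nat" where
  "inside E S = card {(i, j) \<in> E. i \<in> S \<and> j \<in> S}"

text \<open>By regularity the oriented edges that start in \<open>S\<close> form the fraction
  \<open>vol n S\<close> of all edges; each of them ends in \<open>S\<close> or leaves it.\<close>

lemma inside_fraction:
  assumes "regular_graph n E" "S \<subseteq> {..<n}"
  shows "real (inside E S) / real (card E) = vol n S - real (card {(i, j) \<in> E. i \<in> S \<and> j \<notin> S}) / real (card E)"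
    and "0 < card E"
proof -
  obtain d where d: "1 \<le> d" "\<And>i. i < n \<Longrightarrow> card (E `` {i}) = d" and n: "1 \<le> n" and E: "E \<subseteq> {..<n} \<times> {..<n}"
    using assms(1) by (auto simp: regular_graph_def)
  have finE: "finite E" using E by (rule finite_subset) auto
  have out: "card {(i, j) \<in> E. i \<in> T} = card T * d" if "T \<subseteq> {..<n}" for T
  proof -
    have "{(i, j) \<in> E. i \<in> T} = Sigma T (\<lambda>i. E `` {i})" by auto
    moreover have "finite (E `` {i})" for i using finE by (rule finite_Image)
    moreover have "finite T" using that finite_subset by blast
    ultimately have "card {(i, j) \<in> E. i \<in> T} = (\<Sum>i\<in>T. card (E `` {i}))" by simp
    also have "\<dots> = (\<Sum>i\<in>T. d)" using d(2) that by (intro sum.cong) auto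
    finally show ?thesis by simp
  qed
  have "{(i, j) \<in> E. i \<in> {..<n}} = E" using E by auto
  then have cE: "card E = n * d" using out[of "{..<n}"] by simp
  then show pos: "0 < card E" using d n by simp
  have "{(i, j) \<in> E. i \<in> S} = {(i, j) \<in> E. i \<in> S \<and> j \<in> S} \<union> {(i, j) \<in> E. i \<in> S \<and> j \<notin> S}" by auto
  moreover have "card ({(i, j) \<in> E. i \<in> S \<and> j \<in> S} \<union> {(i, j) \<in> E. i \<in> S \<and> j \<notin> S})
      = inside E S + card {(i, j) \<in> E. i \<in> S \<and> j \<notin> S}"
    unfolding inside_def by (intro card_Un_disjoint finite_subset[OF _ finE]) auto
  ultimately have "card S * d = inside E S + card {(i, j) \<in> E. i \<in> S \<and> j \<notin> S}" using out[OF assms(2)] by simp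
  then have "real (inside E S) + real (card {(i, j) \<in> E. i \<in> S \<and> j \<notin> S}) = real (card S) * real d"
    unfolding of_nat_add[symmetric] of_nat_mult[symmetric] by (rule arg_cong[OF sym])
  then show "real (inside E S) / real (card E) = vol n S - real (card {(i, j) \<in> E. i \<in> S \<and> j \<notin> S}) / real (card E)"
  proof -
    assume e: "real (inside E S) + real (card {(i, j) \<in> E. i \<in> S \<and> j \<notin> S}) = real (card S) * real d"
    have "vol n S = real (card S) * real d / real (card E)" using d n by (simp add: cE vol_def)
    then show ?thesis unfolding e[symmetric] add_divide_distrib by linarith
  qed
qed

lemma vol_compl: "1 \<le> n \<Longrightarrow> S \<subseteq> {..<n} \<Longrightarrow> vol n ({..<n} - S) = 1 - vol n S"
  using card_mono[of "{..<n}" S] by (simp add: vol_def card_Diff_subset finite_subset of_nat_diff diff_divide_distrib)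

lemma inside_yes:
  assumes "regular_graph n E" "S \<subseteq> {..<n}" "vol n S = \<delta>" "0 < \<delta>" "\<delta> < 1" "expansion n E S \<le> \<epsilon>"
  shows "real (inside E S) / real (card E) \<ge> (1 - \<epsilon>) * \<delta>"
proof -
  have n: "1 \<le> n" using assms(1) by (simp add: regular_graph_def)
  let ?c = "real (card {(i, j) \<in> E. i \<in> S \<and> j \<notin> S}) / real (card E)"
  have m: "0 < min \<delta> (1 - \<delta>)" using assms by simp
  have "?c / min \<delta> (1 - \<delta>) \<le> \<epsilon>" using assms n by (simp add: expansion_def vol_compl)
  then have c: "?c \<le> \<epsilon> * min \<delta> (1 - \<delta>)" by (simp only: pos_divide_le_eq[OF m])
  moreover have "0 \<le> \<epsilon> * min \<delta> (1 - \<delta>)" using c by (rule order_trans[rotated]) simp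
  then have "0 \<le> \<epsilon>" using m by (simp add: zero_le_mult_iff)
  then have "\<epsilon> * min \<delta> (1 - \<delta>) \<le> \<epsilon> * \<delta>" by (intro mult_left_mono) auto
  ultimately show ?thesis using inside_fraction(1)[OF assms(1,2)] assms(3) by (simp add: algebra_simps)
qed

lemma inside_expanding:
  assumes "regular_graph n E" "S \<subseteq> {..<n}" "1 - \<epsilon> \<le> expansion n E S" "S \<noteq> {}" "S \<noteq> {..<n}"
  shows "real (inside E S) / real (card E) \<le> vol n S - (1 - \<epsilon>) * min (vol n S) (1 - vol n S)"
proof -
  have n: "1 \<le> n" using assms(1) by (simp add: regular_graph_def)
  have "0 < card S" using assms(2,4) by (simp add: card_gt_0_iff finite_subset)
  moreover have "card S < n" using assms(2,5) psubset_card_mono[of "{..<n}" S] by auto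
  ultimately have m: "0 < min (vol n S) (1 - vol n S)" by (simp add: vol_def)
  have "1 - \<epsilon> \<le> real (card {(i, j) \<in> E. i \<in> S \<and> j \<notin> S}) / real (card E) / min (vol n S) (1 - vol n S)"
    using assms(3) vol_compl[OF n assms(2)] by (simp add: expansion_def)
  then have "(1 - \<epsilon>) * min (vol n S) (1 - vol n S) \<le> real (card {(i, j) \<in> E. i \<in> S \<and> j \<notin> S}) / real (card E)"
    by (simp only: pos_le_divide_eq[OF m])
  then show ?thesis using inside_fraction(1)[OF assms(1,2)] by simp
qed

text \<open>A set below the window is too small to contain more than \<delta>/k of the edges. Within
  the window only the fraction 1/k^2 of the volume stays inside, which is at most 2\<delta>/k^2 and
  so at most \<delta>/k. As 2\<delta> is below 1/2, the minimum in the expansion is the volume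
  itself.\<close>

lemma inside_no:
  assumes "regular_graph n E" and no: "\<forall>S \<subseteq> {..<n}. vol n S \<in> {\<delta> / k..k * \<delta>} \<longrightarrow> expansion n E S \<ge> 1 - 1 / k\<^sup>2"
    and k: "2 \<le> k" and \<delta>: "0 < \<delta>" "\<delta> < 1 / 4" and S: "S \<subseteq> {..<n}" "vol n S \<le> 2 * \<delta>"
  shows "real (inside E S) / real (card E) \<le> \<delta> / k"
proof (cases "vol n S < \<delta> / k")
  case True
  have "0 \<le> real (card {(i, j) \<in> E. i \<in> S \<and> j \<notin> S}) / real (card E)" by simp
  then show ?thesis using inside_fraction(1)[OF assms(1) S(1)] True by linarith
next
  case False
  have "2 * \<delta> \<le> k * \<delta>" using k \<delta> by (intro mult_right_mono) auto
  then have e: "1 - 1 / k\<^sup>2 \<le> expansion n E S" using no S False by auto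
  have "0 < \<delta> / k" using k \<delta> by simp
  then have v: "0 < vol n S" "vol n S < 1 / 2" using False S(2) \<delta> by linarith+
  then have "S \<noteq> {}" "S \<noteq> {..<n}" by (auto simp: vol_def split: if_splits)
  from inside_expanding[OF assms(1) S(1) e this]
  have "real (inside E S) / real (card E) \<le> vol n S - (1 - 1 / k\<^sup>2) * vol n S" using v by simp
  also have "\<dots> = vol n S / k\<^sup>2" by (simp add: algebra_simps)
  also have "\<dots> \<le> 2 * \<delta> / k\<^sup>2" using S(2) by (intro divide_right_mono) auto
  also have "\<dots> \<le> \<delta> / k"
  proof -
    have "2 * \<delta> \<le> k * \<delta>" using k \<delta> by (intro mult_right_mono) auto
    then have "2 * \<delta> / (k * k) \<le> k * \<delta> / (k * k)" using k by (intro divide_right_mono) auto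
    then show ?thesis using k by (simp add: power2_eq_square)
  qed
  finally show ?thesis .
qed

text \<open>Halves of the vertex set cannot expand by much more than 1/2: if the vertex set is cut into four
  quarters, the six unions of two quarters contain all edges.\<close>

lemma no_instance_small:
  assumes reg: "regular_graph n E" and no: "\<forall>S \<subseteq> {..<n}. vol n S \<in> {\<delta> / k..k * \<delta>} \<longrightarrow> expansion n E S \<ge> 1 - 1 / k\<^sup>2"
    and k: "4 \<le> k" and \<delta>: "1 / 4 \<le> \<delta>" "\<delta> < 1"
  shows "n < 100"
proof (rule ccontr)
  assume "\<not> n < 100"
  then have n: "100 \<le> n" by simp
  define m where "m = n div 4"
  have m: "4 * m \<le> n" "n \<le> 4 * m + 3" by (auto simp: m_def)
  define A where "A = (\<lambda>a. {a * m..<(if a = 3 then n else Suc a * m)})"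
  have cA: "m \<le> card (A a) \<and> card (A a) \<le> m + 3" for a using m by (auto simp: A_def)
  have sA: "A a \<subseteq> {..<n}" if "a < 4" for a
  proof (cases "a = 3")
    case False
    then have "Suc a * m \<le> 4 * m" using that by (intro mult_le_mono) auto
    then have "Suc a * m \<le> n" using m(1) by (rule order_trans)
    then show ?thesis using False by (auto simp: A_def)
  qed (auto simp: A_def)
  define T where "T = (\<lambda>p. A (fst p) \<union> A (snd p))"
  define P :: "(nat \<times> nat) list" where "P = [(0,1), (0,2), (0,3), (1,2), (1,3), (2,3)]"
  have finA: "finite (A a)" for a by (simp add: A_def)
  have small: "real (inside E (T p)) / real (card E) < 1 / 6" if p: "p \<in> set P" for p
  proof -
    have ab: "fst p < snd p" "snd p < 4" using p by (auto simp: P_def)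
    have "Suc (fst p) * m \<le> snd p * m" using ab by (intro mult_le_mono) auto
    then have "A (fst p) \<inter> A (snd p) = {}" using ab by (auto simp: A_def)
    then have "card (T p) = card (A (fst p)) + card (A (snd p))"
      unfolding T_def using finA by (intro card_Un_disjoint) auto
    then have "n \<le> 2 * card (T p) + 3" "2 * card (T p) \<le> n + 12"
      using cA[of "fst p"] cA[of "snd p"] m by linarith+
    then have "real n \<le> 2 * real (card (T p)) + 3" "2 * real (card (T p)) \<le> real n + 12" by linarith+
    then have v: "97 / 200 \<le> vol n (T p)" "vol n (T p) \<le> 14 / 25"
      using n by (simp_all add: vol_def field_simps)
    have sub: "T p \<subseteq> {..<n}" using sA[of "fst p"] sA[of "snd p"] ab by (auto simp: T_def)
    \<comment> \<open>For \<delta> in this range the window contains all volumes from 1/4 to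
      1.\<close>
    have "\<delta> / k \<le> 1 / 4" using \<delta> k by (simp add: field_simps)
    moreover have "1 \<le> k * \<delta>" using mult_mono[of 4 k "1/4" \<delta>] \<delta> k by simp
    ultimately have e: "1 - 1 / k\<^sup>2 \<le> expansion n E (T p)" using no sub v by auto
    have "vol n {} = 0" "vol n {..<n} = 1" using n by (simp_all add: vol_def)
    then have ne: "T p \<noteq> {}" "T p \<noteq> {..<n}" using v by (intro notI; simp)+
    \<comment> \<open>\<open>T p\<close> and its complement have volume at least 11/25, so at most
      14/25 - 15/16 * 11/25 of the edges lie inside, which is less than 1/6.\<close>
    have "1 / k\<^sup>2 \<le> 1 / 4\<^sup>2" using k by (intro divide_left_mono power_mono) auto
    then have "15 / 16 * (11 / 25) \<le> (1 - 1 / k\<^sup>2) * min (vol n (T p)) (1 - vol n (T p))"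
      using v by (intro mult_mono) auto
    then show ?thesis using inside_expanding[OF reg sub e ne] v by linarith
  qed
  have "E \<subseteq> (\<Union>p\<in>set P. {(i, j) \<in> E. i \<in> T p \<and> j \<in> T p})"
  proof
    fix q assume q: "q \<in> E"
    obtain i j where ij: "q = (i, j)" by (cases q)
    have "i < n" "j < n" using q ij reg by (auto simp: regular_graph_def)
    moreover have "\<exists>a \<in> {0,1,2,3}. v \<in> A a" if "v < n" for v
    proof -
      consider "v < m" | "m \<le> v \<and> v < 2 * m" | "2 * m \<le> v \<and> v < 3 * m" | "3 * m \<le> v" by linarith
      then have "v \<in> A 0 \<or> v \<in> A 1 \<or> v \<in> A 2 \<or> v \<in> A 3" using that by cases (simp_all add: A_def)
      then show ?thesis by simp
    qed
    ultimately obtain a b where ab: "a \<in> {0,1,2,3}" "b \<in> {0,1,2,3}" and "i \<in> A a" "j \<in> A b" by meson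
    moreover have "\<exists>p \<in> set P. (a = fst p \<or> a = snd p) \<and> (b = fst p \<or> b = snd p)"
      using ab unfolding P_def by (elim insertE emptyE) simp_all
    then obtain p where "p \<in> set P" "a = fst p \<or> a = snd p" "b = fst p \<or> b = snd p" by (elim bexE conjE)
    ultimately have p: "p \<in> set P" "i \<in> T p" "j \<in> T p" by (auto simp: T_def)
    show "q \<in> (\<Union>p\<in>set P. {(i, j) \<in> E. i \<in> T p \<and> j \<in> T p})"
      by (rule UN_I[OF p(1)]) (use q ij p in simp)
  qed
  then have "card E \<le> card (\<Union>p\<in>set P. {(i, j) \<in> E. i \<in> T p \<and> j \<in> T p})"
  proof (rule card_mono[rotated])
    have "E \<subseteq> {..<n} \<times> {..<n}" using reg by (simp add: regular_graph_def)
    then have "finite E" by (rule finite_subset) simp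
    then show "finite (\<Union>p\<in>set P. {(i, j) \<in> E. i \<in> T p \<and> j \<in> T p})"
      by (rule finite_subset[rotated]) auto
  qed
  also have "\<dots> \<le> (\<Sum>p\<in>set P. inside E (T p))" unfolding inside_def by (rule card_UN_le) simp
  finally have "card E \<le> (\<Sum>p\<in>set P. inside E (T p))" .
  then have "real (card E) \<le> (\<Sum>p\<in>set P. real (inside E (T p)))" unfolding of_nat_sum[symmetric] by (rule of_nat_mono)
  moreover have "(\<Sum>p\<in>set P. real (inside E (T p))) < (\<Sum>p\<in>set P. real (card E) / 6)"
  proof (rule sum_strict_mono)
    show "real (inside E (T p)) < real (card E) / 6" if "p \<in> set P" for p
      using small[OF that] inside_fraction(2)[OF reg order_refl] by (simp add: field_simps)
  qed (simp_all add: P_def)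
  moreover have "(\<Sum>p\<in>set P. real (card E) / 6) = real (card E)" by (simp add: P_def)
  ultimately show False by linarith
qed

section \<open>The reduction\<close>

text \<open>A minimal accepted string \<open>x\<close> of weight at least 2 simulates the conjunction of the vertices in two
  positions \<open>p\<close>, \<open>q\<close> of its support: the vertices in the other positions of the support are free of
  charge, and those outside of the support exceed the budget.\<close>

locale reduction =
  fixes r :: nat and \<psi> :: "bool list \<Rightarrow> bool" and x :: "bool list" and p q :: nat
  assumes minx: "x \<in> minimal_accepted r \<psi>" and pq: "p \<in> supp x" "q \<in> supp x" "p \<noteq> q"
begin

lemma lenx: "length x = r" and psix: "\<psi> x" and pr: "p < r" and qr: "q < r"
  using minx pq by (auto simp: minimal_accepted_def supp_def)

text \<open>Position \<open>p\<close> of a tuple holds an endpoint of the edge, so the vertex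
  \<open>n + p\<close> occurs in no constraint. Counting it as heavy gives \<open>1 \<le> h\<close>,
  from which \<open>hardness\<close> gets a bias below 1/2.\<close>

definition heavy :: "nat list" where
  "heavy = filter (\<lambda>t. t \<notin> supp x \<or> t = p) [0..<r]"

definition h :: nat where "h = length heavy"

lemma h_pos: "1 \<le> h"
proof -
  have "p \<in> set heavy" using pr by (simp add: heavy_def)
  then show ?thesis unfolding h_def by (cases heavy) auto
qed

definition tuple :: "nat \<Rightarrow> nat \<times> nat \<Rightarrow> nat list" where
  "tuple n e = map (\<lambda>t. if t = p then fst e else if t = q then snd e else n + t) [0..<r]"

text \<open>The total weight is \<open>n * (1 + h)\<close>, so the bias \<delta>/(1 + h) is a budget
  of \<delta> n. Even doubled it is below \<open>n\<close>, the price of a single heavy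
  vertex.\<close>

definition wt :: "nat \<Rightarrow> nat \<Rightarrow> nat" where
  "wt n v = (if v < n then 1 else if \<exists>t \<in> set heavy. t = v - n then n else 0)"

definition red :: "nat \<Rightarrow> (nat \<times> nat) list \<Rightarrow> csp" where
  "red n es = \<lparr>num_vertices = n + r, constraints = map (tuple n) es, weight = (\<lambda>v. of_nat (wt n v))\<rparr>"

text \<open>The code of the instance spelled out token by token, to which the rules for
  \<open>ptime\<close> apply. The second token of a weight is the denominator 1.\<close>

definition red_string :: "bool list \<Rightarrow> bool list" where
  "red_string y = concat (map delimit (binary (gr_n y + r) #
     concat (map (\<lambda>v. [binary (wt (gr_n y) v), binary 1]) [0..<gr_n y + r]) @
     binary (length (gr_e y)) # concat (map (\<lambda>e. map binary (tuple (gr_n y) e)) (gr_e y))))"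

lemma red_string_eq: "red_string y = encode_csp (red (gr_n y) (gr_e y))"
  by (simp add: encode_csp_tokens red_string_def csp_tokens_def red_def comp_def)

lemma ptime_red_string: "ptime f \<Longrightarrow> ptime (\<lambda>e. red_string (f e))"
  unfolding red_string_def wt_def tuple_def
  by (intro pti ptime_compose_fst ptime_compose[of f "\<lambda>p. fst (fst p)"])

lemma sum_split: "(\<Sum>v<n + m. f v) = (\<Sum>v<n. f v) + (\<Sum>t<m. f (n + t))" for f :: "nat \<Rightarrow> real"
  by (induction m) (auto simp: algebra_simps)

lemma total_weight: "(\<Sum>v<n + r. real (wt n v)) = real n * (1 + real h)"
proof -
  have "(\<Sum>t<r. real (wt n (n + t))) = (\<Sum>t<r. if t \<in> set heavy then real n else 0)"
    by (intro sum.cong) (auto simp: wt_def)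
  also have "\<dots> = real n * real (card ({..<r} \<inter> set heavy))" by (simp add: sum.If_cases)
  also have "{..<r} \<inter> set heavy = set heavy" by (auto simp: heavy_def)
  also have "card (set heavy) = h" unfolding h_def by (rule distinct_card) (simp add: heavy_def)
  finally show ?thesis by (simp add: sum_split wt_def algebra_simps)
qed

lemma relative_weight_red:
  "relative_weight (red n es) \<sigma> = (\<Sum>v<n + r. if \<sigma> ! v then real (wt n v) else 0) / (real n * (1 + real h))"
proof -
  have "(\<Sum>v | v < n + r \<and> \<sigma> ! v. real (wt n v)) = (\<Sum>v<n + r. if \<sigma> ! v then real (wt n v) else 0)"
    by (subst sum.inter_filter[symmetric]) (auto intro: sum.cong)
  then show ?thesis using total_weight[of n] by (simp add: relative_weight_def red_def)
qed

lemma csp_instance_red: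
  assumes "1 \<le> n" "es \<noteq> []" "\<And>i j. (i, j) \<in> set es \<Longrightarrow> i < n \<and> j < n \<and> i \<noteq> j"
  shows "csp_instance r (red n es)"
proof -
  have "(of_rat (\<Sum>v<n + r. of_nat (wt n v)) :: real) = real n * (1 + real h)"
    using total_weight[of n] by (simp add: of_rat_sum)
  then have "(0 :: real) < of_rat (\<Sum>v<n + r. of_nat (wt n v))" using assms(1) by simp
  then have W: "(0 :: rat) < (\<Sum>v<n + r. of_nat (wt n v))" by (simp only: zero_less_of_rat_iff)
  have "distinct (tuple n e) \<and> set (tuple n e) \<subseteq> {..<n + r}" if "e \<in> set es" for e
  proof -
    have "fst e < n" "snd e < n" "fst e \<noteq> snd e" using assms(3)[of "fst e" "snd e"] that by auto
    then show ?thesis using pr qr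
      by (auto simp: tuple_def distinct_map inj_on_def split: if_splits)
  qed
  then show ?thesis using assms(2) W by (auto simp: csp_instance_def red_def tuple_def)
qed

text \<open>With all heavy vertices at 0, an accepted string has its support inside that of
  \<open>x\<close>, so by minimality it is \<open>x\<close>, with ones at \<open>p\<close> and
  \<open>q\<close>.\<close>

lemma satisfied_inside:
  assumes "e = (i, j)" "\<And>t. t \<in> set heavy \<Longrightarrow> \<not> \<sigma> ! (n + t)" "\<psi> (map (\<lambda>v. \<sigma> ! v) (tuple n e))"
  shows "\<sigma> ! i \<and> \<sigma> ! j"
proof -
  let ?y = "map (\<lambda>v. \<sigma> ! v) (tuple n e)"
  have y: "?y ! t = \<sigma> ! (if t = p then i else if t = q then j else n + t)" if "t < r" for t
    using that by (simp add: tuple_def assms(1))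
  have len: "length ?y = r" by (simp add: tuple_def)
  have "supp ?y \<subseteq> supp x"
  proof
    fix t assume t: "t \<in> supp ?y"
    show "t \<in> supp x"
    proof (rule ccontr)
      assume n: "t \<notin> supp x"
      have tr: "t < r" using t len by (auto simp: supp_def)
      then have "t \<in> set heavy" using n by (auto simp: heavy_def)
      moreover have "t \<noteq> p" "t \<noteq> q" using n pq by auto
      ultimately show False using t y[OF tr] assms(2) by (auto simp: supp_def)
    qed
  qed
  then have "?y = x" using minx len assms(3) by (simp add: minimal_accepted_def)
  then have "?y ! p" "?y ! q" using pq by (auto simp: supp_def)
  then show ?thesis using y[OF pr] y[OF qr] pq by auto
qed

text \<open>The factor 2 is the slack 1 + \<eta> for \<eta> = 1.\<close>

lemma budget:
  assumes "1 \<le> n" "relative_weight (red n es) \<sigma> \<le> \<delta> / (1 + real h) * 2" "\<delta> < 1 / 4"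
  shows "t \<in> set heavy \<Longrightarrow> \<not> \<sigma> ! (n + t)" "vol n {v. v < n \<and> \<sigma> ! v} \<le> 2 * \<delta>"
proof -
  let ?w = "\<lambda>v. if \<sigma> ! v then real (wt n v) else 0"
  have "(\<Sum>v<n + r. ?w v) / (real n * (1 + real h)) \<le> \<delta> / (1 + real h) * 2"
    using assms(2) relative_weight_red by simp
  moreover have "0 < real n * (1 + real h)" using assms(1) by simp
  ultimately have "(\<Sum>v<n + r. ?w v) \<le> \<delta> / (1 + real h) * 2 * (real n * (1 + real h))"
    by (simp only: pos_divide_le_eq)
  also have "\<dots> = 2 * \<delta> * real n"
  proof -
    have "u / H * 2 * (m * H) = 2 * u * m" if "H \<noteq> 0" for u m H :: real using that by simp
    then show ?thesis by (metis add_pos_nonneg less_irrefl of_nat_0_le_iff zero_less_one)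
  qed
  finally have b: "(\<Sum>v<n + r. ?w v) \<le> 2 * \<delta> * real n" .
  show "\<not> \<sigma> ! (n + t)" if "t \<in> set heavy"
  proof
    assume "\<sigma> ! (n + t)"
    then have "?w (n + t) = real n" using that by (auto simp: wt_def)
    moreover have "?w (n + t) \<le> (\<Sum>v<n + r. ?w v)"
      using that by (intro member_le_sum) (auto simp: heavy_def)
    moreover have "2 * \<delta> * real n < real n" using assms(1,3) by simp
    ultimately show False using b by linarith
  qed
  have "(\<Sum>v<n. ?w v) = (\<Sum>v<n. if \<sigma> ! v then 1 else 0)" by (intro sum.cong) (auto simp: wt_def)
  also have "\<dots> = real (card {v. v < n \<and> \<sigma> ! v})"
    by (simp add: sum.If_cases) (intro arg_cong[where f = card]; auto)
  finally have "real (card {v. v < n \<and> \<sigma> ! v}) \<le> (\<Sum>v<n + r. ?w v)"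
    unfolding sum_split by (simp add: sum_nonneg)
  then show "vol n {v. v < n \<and> \<sigma> ! v} \<le> 2 * \<delta>" using b assms(1) by (simp add: vol_def field_simps)
qed

lemma count_inside:
  assumes "distinct es" "set es \<subseteq> {..<n} \<times> {..<n}"
  shows "length (filter (\<lambda>e. \<sigma> ! fst e \<and> \<sigma> ! snd e) es) = inside (set es) {v. v < n \<and> \<sigma> ! v}"
proof -
  have "length (filter (\<lambda>e. \<sigma> ! fst e \<and> \<sigma> ! snd e) es) = card (set (filter (\<lambda>e. \<sigma> ! fst e \<and> \<sigma> ! snd e) es))"
    using assms(1) by (metis distinct_card distinct_filter)
  also have "set (filter (\<lambda>e. \<sigma> ! fst e \<and> \<sigma> ! snd e) es) = {(i, j) \<in> set es. i \<in> {v. v < n \<and> \<sigma> ! v} \<and> j \<in> {v. v < n \<and> \<sigma> ! v}}"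
    using assms(2) by auto
  finally show ?thesis by (simp add: inside_def)
qed

lemma value_le_inside:
  assumes "1 \<le> n" "relative_weight (red n es) \<sigma> \<le> \<delta> / (1 + real h) * 2" "\<delta> < 1 / 4"
    and "distinct es" "set es \<subseteq> {..<n} \<times> {..<n}"
  shows "labeling_value \<psi> (red n es) \<sigma> \<le> real (inside (set es) {v. v < n \<and> \<sigma> ! v}) / real (card (set es))"
proof -
  have sat: "\<sigma> ! fst e \<and> \<sigma> ! snd e" if "\<psi> (map (\<lambda>v. \<sigma> ! v) (tuple n e))" for e
    using satisfied_inside[of e "fst e" "snd e" \<sigma> n] budget(1)[OF assms(1-3)] that by auto
  have "length (filter P l) \<le> length (filter Q l)" if "\<And>e. P e \<Longrightarrow> Q e" for P Q and l :: "(nat \<times> nat) list"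
    using that by (induction l) (auto simp: le_SucI)
  then have "length (filter (\<lambda>e. \<psi> (map (\<lambda>v. \<sigma> ! v) (tuple n e))) es) \<le> length (filter (\<lambda>e. \<sigma> ! fst e \<and> \<sigma> ! snd e) es)"
    using sat by simp
  moreover have "card (set es) = length es" using assms(4) by (rule distinct_card)
  ultimately show ?thesis unfolding count_inside[OF assms(4,5), symmetric]
    by (simp add: labeling_value_def red_def filter_map comp_def divide_right_mono)
qed

text \<open>Besides \<open>S\<close>, the labeling selects the vertices at the remaining support
  positions, which are free; the tuple of an edge inside \<open>S\<close> then reads
  \<open>x\<close>.\<close>

lemma value_ge_inside:
  assumes "1 \<le> n" "distinct es" "set es \<subseteq> {..<n} \<times> {..<n}" "S \<subseteq> {..<n}" "vol n S = \<delta>"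
  shows "real (inside (set es) S) / real (card (set es)) \<le> biased_value \<psi> (\<delta> / (1 + real h)) (red n es)"
proof -
  define \<sigma> where "\<sigma> = map (\<lambda>v. if v < n then v \<in> S else v - n \<in> supp x \<and> v - n \<noteq> p) [0..<n + r]"
  have s1: "\<sigma> ! v \<longleftrightarrow> v \<in> S" if "v < n" for v using that by (simp add: \<sigma>_def)
  have s2: "\<sigma> ! (n + t) \<longleftrightarrow> t \<in> supp x \<and> t \<noteq> p" if "t < r" for t using that by (simp add: \<sigma>_def nth_append)
  have S: "{v. v < n \<and> \<sigma> ! v} = S" using s1 assms(4) by auto
  have fin: "finite S" using assms(4) finite_subset by blast
  have "(\<Sum>t<r. if \<sigma> ! (n + t) then real (wt n (n + t)) else 0) = 0"
    by (intro sum.neutral) (auto simp: s2 wt_def heavy_def)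
  moreover have "(\<Sum>v<n. if \<sigma> ! v then real (wt n v) else 0) = (\<Sum>v<n. if v \<in> S then 1 else 0)"
    by (intro sum.cong) (auto simp: s1 wt_def)
  moreover have "(\<Sum>v<n. if v \<in> S then 1 else (0::real)) = real (card S)"
    using assms(4) by (simp add: sum.If_cases Int_absorb1)
  ultimately have "relative_weight (red n es) \<sigma> = real (card S) / (real n * (1 + real h))"
    by (simp add: relative_weight_red sum_split)
  also have "\<dots> = \<delta> / (1 + real h)" unfolding assms(5)[symmetric] vol_def by simp
  finally have w: "relative_weight (red n es) \<sigma> = \<delta> / (1 + real h)" .
  have lab: "\<sigma> \<in> labelings (red n es)" by (simp add: labelings_def red_def \<sigma>_def)
  have "\<psi> (map (\<lambda>v. \<sigma> ! v) (tuple n e))" if "e \<in> set es" "\<sigma> ! fst e \<and> \<sigma> ! snd e" for e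
  proof -
    have "map (\<lambda>v. \<sigma> ! v) (tuple n e) = x"
    proof (rule nth_equalityI)
      fix t assume "t < length (map (\<lambda>v. \<sigma> ! v) (tuple n e))"
      then have t: "t < r" by (simp add: tuple_def)
      have "t \<in> supp x \<longleftrightarrow> x ! t" using t lenx by (simp add: supp_def)
      then show "map (\<lambda>v. \<sigma> ! v) (tuple n e) ! t = x ! t"
        using t that pq s2[OF t] by (auto simp: tuple_def)
    qed (simp add: tuple_def lenx)
    then show ?thesis using psix by simp
  qed
  then have "length (filter (\<lambda>e. \<sigma> ! fst e \<and> \<sigma> ! snd e) es) \<le> length (filter (\<lambda>e. \<psi> (map (\<lambda>v. \<sigma> ! v) (tuple n e))) es)"
    by (induction es) (auto simp: le_SucI)
  moreover have "card (set es) = length es" using assms(2) by (rule distinct_card)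
  ultimately have "real (inside (set es) S) / real (card (set es)) \<le> labeling_value \<psi> (red n es) \<sigma>"
    using count_inside[OF assms(2,3), of \<sigma>] unfolding S
    by (simp add: labeling_value_def red_def filter_map comp_def divide_right_mono)
  also have "\<dots> \<le> biased_value \<psi> (\<delta> / (1 + real h)) (red n es)"
    by (rule biased_value_ge[OF lab]) (simp add: w)
  finally show ?thesis .
qed

text \<open>Compares the fraction of edges inside the returned set with \<open>c / d\<close>,
  cross-multiplied. The numbers are constants of the program, as \<delta> and the factor are
  reals.\<close>

definition decide :: "(bool list \<Rightarrow> bool list) \<Rightarrow> nat \<Rightarrow> nat \<Rightarrow> bool list \<Rightarrow> bool" where
  "decide g c d y = (c * length (gr_e y) \<le> d * length (filter (\<lambda>e. nthd False (g (red_string y)) (fst e) \<and> nthd False (g (red_string y)) (snd e)) (gr_e y)))"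

lemma ptime_decide:
  assumes "ptime g" "ptime f" shows "ptime (\<lambda>z. decide g c d (f z))"
proof -
  have g: "ptime (\<lambda>e. g (red_string (f' e)))" if "ptime f'" for f'
    by (rule ptime_compose[OF assms(1) ptime_red_string[OF that]])
  show ?thesis unfolding decide_def by (intro pti g ptime_compose_fst[of f] assms(2))
qed

text \<open>On YES instances the optimum is at least \<delta>/2, so the algorithm finds at least
  a\<delta>/2; on NO instances no affordable set has more than \<delta>/k. The threshold lies
  between the two.\<close>

lemma decide_correct:
  assumes reg: "regular_graph n E" and y: "y = encode_graph n E"
    and \<delta>: "0 < \<delta>" "\<delta> < 1 / 4" and d: "0 < d"
    and g: "g (encode_csp (red n (gr_e y))) \<in> labelings (red n (gr_e y))"
      "relative_weight (red n (gr_e y)) (g (encode_csp (red n (gr_e y)))) \<le> \<delta> / (1 + real h) * 2"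
      "labeling_value \<psi> (red n (gr_e y)) (g (encode_csp (red n (gr_e y)))) \<ge> a * biased_value \<psi> (\<delta> / (1 + real h)) (red n (gr_e y))"
    and a: "0 < a" "2 < a * k" and k: "4 \<le> k"
    and cd: "\<delta> / k < real c / real d" "real c / real d < a / 2 * \<delta>"
  shows "(\<exists>S \<subseteq> {..<n}. vol n S = \<delta> \<and> expansion n E S \<le> 1 / k\<^sup>2) \<Longrightarrow> decide g c d y"
    and "(\<forall>S \<subseteq> {..<n}. vol n S \<in> {\<delta> / k..k * \<delta>} \<longrightarrow> expansion n E S \<ge> 1 - 1 / k\<^sup>2) \<Longrightarrow> \<not> decide g c d y"
proof -
  have n: "1 \<le> n" and E: "E \<subseteq> {..<n} \<times> {..<n}" using reg by (auto simp: regular_graph_def)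
  have es: "set (gr_e y) = E" "distinct (gr_e y)" using gr_e_encode[OF E] y by auto
  have gn: "gr_n y = n" by (simp add: y gr_n_encode)
  define \<sigma> where "\<sigma> = g (encode_csp (red n (gr_e y)))"
  define S\<^sub>\<sigma> where "S\<^sub>\<sigma> = {v. v < n \<and> \<sigma> ! v}"
  have len: "length \<sigma> = n + r" using g(1) by (simp add: \<sigma>_def labelings_def red_def)
  have flt: "filter (\<lambda>e. nthd False \<sigma> (fst e) \<and> nthd False \<sigma> (snd e)) (gr_e y) = filter (\<lambda>e. \<sigma> ! fst e \<and> \<sigma> ! snd e) (gr_e y)"
  proof (rule filter_cong)
    fix e assume "e \<in> set (gr_e y)"
    then have "fst e < length \<sigma>" "snd e < length \<sigma>" using es E len by auto
    then show "(nthd False \<sigma> (fst e) \<and> nthd False \<sigma> (snd e)) = (\<sigma> ! fst e \<and> \<sigma> ! snd e)" by (simp add: nthd_eq)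
  qed simp
  have cE: "length (gr_e y) = card E" using es distinct_card by metis
  have pos: "0 < card E" using inside_fraction(2)[OF reg order_refl] .
  have "decide g c d y \<longleftrightarrow> c * card E \<le> d * inside E S\<^sub>\<sigma>"
    unfolding decide_def red_string_eq gn \<sigma>_def[symmetric] flt cE
    using count_inside[OF es(2), of n \<sigma>] E es(1) by (simp add: S\<^sub>\<sigma>_def)
  also have "\<dots> \<longleftrightarrow> real c * real (card E) \<le> real d * real (inside E S\<^sub>\<sigma>)"
    unfolding of_nat_mult[symmetric] of_nat_le_iff ..
  also have "\<dots> \<longleftrightarrow> real c / real d \<le> real (inside E S\<^sub>\<sigma>) / real (card E)"
    using pos d by (simp add: field_simps)
  finally have dec: "decide g c d y \<longleftrightarrow> real c / real d \<le> real (inside E S\<^sub>\<sigma>) / real (card E)" .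
  have val: "labeling_value \<psi> (red n (gr_e y)) \<sigma> \<le> real (inside E S\<^sub>\<sigma>) / real (card E)"
    using value_le_inside[OF n g(2)[folded \<sigma>_def] \<delta>(2) es(2)] E es(1) by (simp add: S\<^sub>\<sigma>_def)
  show "decide g c d y" if yes: "\<exists>S \<subseteq> {..<n}. vol n S = \<delta> \<and> expansion n E S \<le> 1 / k\<^sup>2"
  proof -
    obtain S where S: "S \<subseteq> {..<n}" "vol n S = \<delta>" "expansion n E S \<le> 1 / k\<^sup>2"
      using yes by (elim exE conjE)
    have "1 / k\<^sup>2 \<le> 1 / 4\<^sup>2" using k by (intro divide_left_mono power_mono) auto
    then have "1 / 2 * \<delta> \<le> (1 - 1 / k\<^sup>2) * \<delta>" using \<delta> by (intro mult_right_mono) auto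
    also have "\<dots> \<le> real (inside E S) / real (card E)" using inside_yes[OF reg S(1,2) \<delta>(1) _ S(3)] \<delta> by simp
    also have "\<dots> \<le> biased_value \<psi> (\<delta> / (1 + real h)) (red n (gr_e y))"
      using value_ge_inside[OF n es(2) _ S(1,2)] E es(1) by simp
    finally have "a * (1 / 2 * \<delta>) \<le> a * biased_value \<psi> (\<delta> / (1 + real h)) (red n (gr_e y))"
      using a(1) by (intro mult_left_mono) auto
    moreover have "a * (1 / 2 * \<delta>) = a / 2 * \<delta>" by simp
    ultimately show ?thesis unfolding dec using g(3)[folded \<sigma>_def] val cd(2) by linarith
  qed
  show "\<not> decide g c d y" if no: "\<forall>S \<subseteq> {..<n}. vol n S \<in> {\<delta> / k..k * \<delta>} \<longrightarrow> expansion n E S \<ge> 1 - 1 / k\<^sup>2"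
  proof -
    have "real (inside E S\<^sub>\<sigma>) / real (card E) \<le> \<delta> / k"
      using budget(2)[OF n g(2)[folded \<sigma>_def] \<delta>(2)] k
      by (intro inside_no[OF reg no _ \<delta>]) (auto simp: S\<^sub>\<sigma>_def)
    then show ?thesis unfolding dec using cd(1) by simp
  qed
qed

theorem hardness:
  assumes "SSEH" and a: "0 < a" and ach: "\<And>\<mu>. 0 < \<mu> \<Longrightarrow> \<mu> < 1 / 2 \<Longrightarrow> achievable_factor r \<psi> \<mu> a"
  shows "class_NP \<subseteq> class_P"
proof
  fix L assume L: "L \<in> class_NP"
  obtain k0 :: nat where k0: "2 / a < real k0" using reals_Archimedean2 by blast
  \<comment> \<open>The 4 is for \<open>no_instance_small\<close> and \<open>decide_correct\<close>;
    \<open>k0\<close> opens the gap between \<delta>/k and a\<delta>/2.\<close>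
  define k where "k = real (max 4 k0)"
  have k: "4 \<le> k" "2 < a * k"
  proof -
    show "4 \<le> k" by (simp add: k_def)
    have "2 / a < k" using k0 by (simp add: k_def)
    then show "2 < a * k" using a by (simp add: pos_divide_less_eq mult.commute)
  qed
  have "1 / k\<^sup>2 \<in> {0<..<1}" using k one_less_power[of k 2] by simp
  \<comment> \<open>For \<epsilon> = 1/k^2 the value M = k is the right end of the admissible
    interval.\<close>
  moreover have "k \<in> {1..1 / sqrt (1 / k\<^sup>2)}" using k by (simp add: real_sqrt_divide)
  ultimately obtain \<delta> where \<delta>: "0 < \<delta>" "\<delta> < 1" and hard: "np_hard_promise (sse_yes (1 / k\<^sup>2) \<delta>) (sse_no (1 / k\<^sup>2) k \<delta>)"
    using assms(1) unfolding SSEH_def by (meson greaterThanLessThan_iff)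
  obtain f where f: "poly_time f" "\<And>z. z \<in> L \<Longrightarrow> f z \<in> sse_yes (1 / k\<^sup>2) \<delta>" "\<And>z. z \<notin> L \<Longrightarrow> f z \<in> sse_no (1 / k\<^sup>2) k \<delta>"
    using hard L unfolding np_hard_promise_def by meson
  have pf: "ptime f" by (rule poly_time_imp_ptime[OF f(1)])
  have graph: "\<exists>n E. regular_graph n E \<and> f z = encode_graph n E \<and>
      (z \<in> L \<longrightarrow> (\<exists>S \<subseteq> {..<n}. vol n S = \<delta> \<and> expansion n E S \<le> 1 / k\<^sup>2)) \<and>
      (z \<notin> L \<longrightarrow> (\<forall>S \<subseteq> {..<n}. vol n S \<in> {\<delta> / k..k * \<delta>} \<longrightarrow> expansion n E S \<ge> 1 - 1 / k\<^sup>2))" for z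
    using f(2)[of z] f(3)[of z] unfolding sse_yes_def sse_no_def by (cases "z \<in> L") blast+
  show "L \<in> class_P"
  proof (cases "\<delta> < 1 / 4")
    case False
    \<comment> \<open>Large \<delta>: there are finitely many NO instances, so membership of
      \<open>f z\<close> can be looked up.\<close>
    define F where "F = sse_no (1 / k\<^sup>2) k \<delta>"
    have "F \<subseteq> {y. length y \<le> 10000}"
    proof
      fix y assume "y \<in> F"
      then obtain n E where "regular_graph n E" "y = encode_graph n E"
        "\<forall>S \<subseteq> {..<n}. vol n S \<in> {\<delta> / k..k * \<delta>} \<longrightarrow> expansion n E S \<ge> 1 - 1 / k\<^sup>2"
        unfolding F_def sse_no_def by blast
      with no_instance_small[of n E \<delta> k] k \<delta> False have "n < 100" by simp
      then have "n * n \<le> 100 * 100" by (intro mult_le_mono) auto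
      then show "y \<in> {y. length y \<le> 10000}" using \<open>y = _\<close> by (simp add: encode_graph_def)
    qed
    moreover have "finite {y :: bool list. length y \<le> 10000}"
      using finite_lists_length_le[of "UNIV :: bool set" 10000] by simp
    ultimately have "finite F" by (rule finite_subset)
    then have "ptime (\<lambda>z. [\<not> f z \<in> F])" by (intro pti ptime_member_finite pf)
    moreover have "(\<not> f z \<in> F) = (z \<in> L)" for z
    proof (cases "z \<in> L")
      case True
      \<comment> \<open>YES and NO are disjoint: codes determine graphs, and a set of volume
        \<delta> lies in the window, so its expansion would be both at most 1/16 and at least
        15/16.\<close>
      have "f z \<notin> F"
      proof
        assume "f z \<in> F"
        then obtain n E where 1: "regular_graph n E" "f z = encode_graph n E"
          "\<forall>S \<subseteq> {..<n}. vol n S \<in> {\<delta> / k..k * \<delta>} \<longrightarrow> expansion n E S \<ge> 1 - 1 / k\<^sup>2"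
          unfolding F_def sse_no_def by blast
        obtain n' E' S where 2: "regular_graph n' E'" "f z = encode_graph n' E'" "S \<subseteq> {..<n'}" "vol n' S = \<delta>" "expansion n' E' S \<le> 1 / k\<^sup>2"
          using f(2)[OF True] unfolding sse_yes_def by blast
        have "encode_graph n E = encode_graph n' E'" "E \<subseteq> {..<n} \<times> {..<n}" "E' \<subseteq> {..<n'} \<times> {..<n'}"
          using 1 2 by (simp_all add: regular_graph_def)
        note eq = encode_graph_inject[OF this]
        have "\<delta> / k \<le> \<delta>" using \<delta> k by (simp add: divide_le_eq)
        moreover have "1 * \<delta> \<le> k * \<delta>" using \<delta> k by (intro mult_right_mono) auto
        ultimately have "vol n S \<in> {\<delta> / k..k * \<delta>}" using 2(4) eq by simp
        then have "1 - 1 / k\<^sup>2 \<le> expansion n E S" using 1(3) 2(3) eq by simp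
        then have "1 - 1 / k\<^sup>2 \<le> 1 / k\<^sup>2" using 2(5) eq by simp
        moreover have "1 / k\<^sup>2 \<le> 1 / 4\<^sup>2" using k by (intro divide_left_mono power_mono) auto
        ultimately show False by simp
      qed
      then show ?thesis using True by simp
    next
      case False
      then show ?thesis using f(3) by (simp add: F_def)
    qed
    ultimately show ?thesis using ptime_imp_poly_time by (simp add: class_P_def)
  next
    case small: True
    define \<mu> where "\<mu> = \<delta> / (1 + real h)"
    have "\<delta> / (1 + real h) \<le> \<delta> / 2" using h_pos \<delta> by (intro divide_left_mono) auto
    then have \<mu>: "0 < \<mu>" "\<mu> < 1 / 2" using \<delta> small by (auto simp: \<mu>_def)
    \<comment> \<open>The instance \<eta> = 1: labelings may have up to twice the bias.\<close>
    obtain g where g: "poly_time g" "\<And>\<Psi>. csp_instance r \<Psi> \<Longrightarrow> g (encode_csp \<Psi>) \<in> labelings \<Psi> \<and>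
           relative_weight \<Psi> (g (encode_csp \<Psi>)) \<le> \<mu> * (1 + 1) \<and>
           labeling_value \<psi> \<Psi> (g (encode_csp \<Psi>)) \<ge> a * biased_value \<psi> \<mu> \<Psi>"
      using ach[OF \<mu>] unfolding achievable_factor_def by (meson zero_less_one)
    \<comment> \<open>By \<open>2 < a * k\<close>. The threshold is taken rational so that
      \<open>decide\<close> can work with integers.\<close>
    have "\<delta> / k < a / 2 * \<delta>" using k \<delta> by (simp add: field_simps)
    then obtain \<theta> where \<theta>: "\<theta> \<in> \<rat>" "\<delta> / k < \<theta>" "\<theta> < a / 2 * \<delta>" using Rats_dense_in_real by blast
    have "0 < \<delta> / k" using \<delta> k by simp
    then have "\<bar>\<theta>\<bar> = \<theta>" using \<theta>(2) by simp
    then obtain c d :: nat where cd: "d \<noteq> 0" "\<theta> = real c / real d" using Rats_abs_nat_div_natE[OF \<theta>(1)] by metis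
    have "decide g c d (f z) \<longleftrightarrow> z \<in> L" for z
    proof -
      obtain n E where G: "regular_graph n E" "f z = encode_graph n E"
        "z \<in> L \<Longrightarrow> (\<exists>S \<subseteq> {..<n}. vol n S = \<delta> \<and> expansion n E S \<le> 1 / k\<^sup>2)"
        "z \<notin> L \<Longrightarrow> (\<forall>S \<subseteq> {..<n}. vol n S \<in> {\<delta> / k..k * \<delta>} \<longrightarrow> expansion n E S \<ge> 1 - 1 / k\<^sup>2)"
        using graph[of z] by blast
      have n: "1 \<le> n" and E: "E \<subseteq> {..<n} \<times> {..<n}" "irrefl E" using G(1) by (auto simp: regular_graph_def)
      have es: "set (gr_e (f z)) = E" using gr_e_encode[OF E(1)] G(2) by auto
      have "gr_e (f z) \<noteq> []" using inside_fraction(2)[OF G(1) order_refl] es by auto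
      then have inst: "csp_instance r (red n (gr_e (f z)))"
        using n E es by (intro csp_instance_red) (auto simp: irrefl_def)
      have g': "g (encode_csp (red n (gr_e (f z)))) \<in> labelings (red n (gr_e (f z)))"
        "relative_weight (red n (gr_e (f z))) (g (encode_csp (red n (gr_e (f z))))) \<le> \<delta> / (1 + real h) * 2"
        "labeling_value \<psi> (red n (gr_e (f z))) (g (encode_csp (red n (gr_e (f z))))) \<ge> a * biased_value \<psi> (\<delta> / (1 + real h)) (red n (gr_e (f z)))"
        using g(2)[OF inst] by (auto simp: \<mu>_def)
      have d: "0 < d" "\<delta> / k < real c / real d" "real c / real d < a / 2 * \<delta>" using cd \<theta> by auto
      note correct = decide_correct[of n E "f z" \<delta> d g a k c, OF G(1,2) \<delta>(1) small d(1) g' a k(2,1) d(2,3)]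
      show ?thesis using correct G(3,4) by blast
    qed
    moreover have "ptime (\<lambda>z. [decide g c d (f z)])"
      by (intro pti ptime_decide pf poly_time_imp_ptime g(1))
    ultimately show ?thesis using ptime_imp_poly_time by (simp add: class_P_def)
  qed
qed

end

section \<open>Greedy knapsack\<close>

text \<open>Items are taken in the order of increasing weight per profit. The items up to the first one that
  does not fit are together worth at least as much as any affordable set.\<close>

locale knapsack =
  fixes w d :: "nat \<Rightarrow> nat" and Q B :: nat
begin

definition pick :: "nat \<Rightarrow> nat list \<Rightarrow> nat list" where
  "pick v S = (if ble (Q * (\<Sum>u\<leftarrow>v # S. w u)) B then v # S else S)"

lemma pick_weight: "Q * (\<Sum>u\<leftarrow>S. w u) \<le> B \<Longrightarrow> Q * (\<Sum>u\<leftarrow>fold pick L S. w u) \<le> B"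
  by (induction L arbitrary: S) (auto simp: pick_def ble_def)

lemma pick_set: "set (fold pick L S) \<subseteq> set L \<union> set S"
proof (induction L arbitrary: S)
  case (Cons v L)
  show ?case using Cons[of "pick v S"] by (auto simp: pick_def split: if_splits)
qed simp

lemma pick_distinct: "distinct L \<Longrightarrow> distinct S \<Longrightarrow> set L \<inter> set S = {} \<Longrightarrow> distinct (fold pick L S)"
  by (induction L arbitrary: S) (auto simp: pick_def)

text \<open>Splits at the first rejected item \<open>v\<close>: everything before it was taken, and
  later picks \<open>G\<close> can only add profit.\<close>

lemma pick_cases:
  "fold pick L S = rev L @ S \<or>
   (\<exists>P v R G. L = P @ v # R \<and> fold pick L S = G @ rev P @ S \<and> fold pick P S = rev P @ S \<and> B < Q * (\<Sum>u\<leftarrow>v # rev P @ S. w u))"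
proof (induction L arbitrary: S)
  case (Cons a L)
  have ext: "\<exists>G. fold pick L S = G @ S" for L S
  proof (induction L arbitrary: S)
    case (Cons b L)
    show ?case using Cons[of "pick b S"] by (auto simp: pick_def split: if_splits)
  qed simp
  show ?case
  proof (cases "Q * (\<Sum>u\<leftarrow>a # S. w u) \<le> B")
    case True
    then have p: "pick a S = a # S" by (simp add: pick_def ble_def)
    show ?thesis using Cons[of "a # S"]
    proof (elim disjE exE conjE)
      fix P v R G assume *: "L = P @ v # R" "fold pick L (a # S) = G @ rev P @ a # S" "fold pick P (a # S) = rev P @ a # S"
        "B < Q * (\<Sum>u\<leftarrow>v # rev P @ a # S. w u)"
      show ?thesis
        by (rule disjI2, rule exI[of _ "a # P"], rule exI[of _ v], rule exI[of _ R], rule exI[of _ G]) (use * p in simp)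
    qed (simp add: p)
  next
    case False
    then have p: "pick a S = S" by (simp add: pick_def ble_def)
    obtain G where "fold pick L S = G @ S" using ext by blast
    then show ?thesis using False p
      by (intro disjI2, intro exI[of _ "[]"], simp only: append.simps) (auto simp: not_le)
  qed
qed simp

text \<open>The items up to and including the first rejected one outweigh the capacity, hence
  \<open>S\<close>. An exchange argument compares the profits outside of the intersection.\<close>

lemma greedy_bound:
  assumes sorted: "sorted_wrt (\<lambda>u v. w u * d v \<le> w v * d u) L" and dist: "distinct L"
    and S: "S \<subseteq> set L" "Q * (\<Sum>u\<in>S. w u) \<le> B"
  shows "(\<Sum>u\<in>S. d u) \<le> (\<Sum>u\<leftarrow>fold pick L []. d u) \<or>
    (\<exists>v \<in> set L. (\<Sum>u\<in>S. d u) \<le> (\<Sum>u\<leftarrow>fold pick L []. d u) + d v)"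
  using pick_cases[of L "[]"]
proof (elim disjE exE conjE)
  assume "fold pick L [] = rev L @ []"
  then have "(\<Sum>u\<leftarrow>fold pick L []. d u) = (\<Sum>u\<in>set L. d u)" using dist by (simp add: sum_list_distinct_conv_sum_set rev_map[symmetric])
  moreover have "(\<Sum>u\<in>S. d u) \<le> (\<Sum>u\<in>set L. d u)" using S(1) by (intro sum_mono2) auto
  ultimately show ?thesis by auto
next
  fix P v R G assume *: "L = P @ v # R" "fold pick L [] = G @ rev P @ []" "fold pick P [] = rev P @ []"
        "B < Q * (\<Sum>u\<leftarrow>v # rev P @ []. w u)"
  have dP: "distinct P" "v \<notin> set P" "distinct (v # P)" using dist *(1) by auto
  define P' where "P' = insert v (set P)"
  have fin: "finite S" using S(1) finite_subset by auto
  have wP: "Q * (\<Sum>u\<in>set P. w u) \<le> B"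
    using pick_weight[of "[]" P] *(3) dP by (simp add: sum_list_distinct_conv_sum_set rev_map[symmetric])
  have wP': "B < Q * (\<Sum>u\<in>P'. w u)"
    using *(4) dP by (simp add: P'_def sum_list_distinct_conv_sum_set rev_map[symmetric])
  \<comment> \<open>An item that overflows the capacity weighs something; the exchange below cancels
    its weight.\<close>
  have wv: "0 < w v"
  proof (rule ccontr)
    assume "\<not> 0 < w v"
    then have "(\<Sum>u\<in>P'. w u) = (\<Sum>u\<in>set P. w u)" using dP by (simp add: P'_def)
    then show False using wP wP' by simp
  qed
  have Q: "(\<Sum>u\<in>S. w u) \<le> (\<Sum>u\<in>P'. w u)" using S(2) wP' by (metis le_less_trans less_or_eq_imp_le mult_less_cancel1)
  \<comment> \<open>Items of \<open>?X\<close> come after \<open>v\<close> and have at least its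
    weight per profit, those of \<open>?Y\<close> at most. Since \<open>?X\<close> weighs no more
    than \<open>?Y\<close>, it is worth no more.\<close>
  let ?X = "S - P'" and ?Y = "P' - S"
  have finP: "finite P'" by (simp add: P'_def)
  have split: "sum f S = sum f ?X + sum f (S \<inter> P')" "sum f P' = sum f ?Y + sum f (S \<inter> P')" for f :: "nat \<Rightarrow> nat"
    using sum.Int_Diff[OF fin, of f P'] sum.Int_Diff[OF finP, of f S] by (simp_all add: Int_commute add.commute)
  have wXY: "sum w ?X \<le> sum w ?Y" using Q split[of w] by simp
  have X: "w v * d u \<le> w u * d v" if "u \<in> ?X" for u
    using that S(1) sorted unfolding *(1) P'_def by (auto simp: sorted_wrt_append)
  have Y: "w u * d v \<le> w v * d u" if "u \<in> ?Y" for u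
    using that sorted unfolding *(1) P'_def by (auto simp: sorted_wrt_append)
  have "w v * sum d ?X = (\<Sum>u\<in>?X. w v * d u)" by (simp add: sum_distrib_left)
  also have "\<dots> \<le> (\<Sum>u\<in>?X. w u * d v)" using X by (intro sum_mono)
  also have "\<dots> = sum w ?X * d v" by (simp add: sum_distrib_right)
  also have "\<dots> \<le> sum w ?Y * d v" using wXY by simp
  also have "\<dots> = (\<Sum>u\<in>?Y. w u * d v)" by (simp add: sum_distrib_right)
  also have "\<dots> \<le> (\<Sum>u\<in>?Y. w v * d u)" using Y by (intro sum_mono)
  also have "\<dots> = w v * sum d ?Y" by (simp add: sum_distrib_left)
  finally have "sum d ?X \<le> sum d ?Y" using wv by simp
  then have "sum d S \<le> sum d P'" using split[of d] by simp
  also have "\<dots> = (\<Sum>u\<leftarrow>rev P. d u) + d v"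
    using dP by (simp add: P'_def sum_list_distinct_conv_sum_set rev_map[symmetric])
  also have "\<dots> \<le> (\<Sum>u\<leftarrow>fold pick L []. d u) + d v" unfolding *(2) by simp
  finally show ?thesis using *(1) by auto
qed

definition ins :: "nat \<Rightarrow> nat list \<Rightarrow> nat list" where
  "ins v L = filter (\<lambda>u. ble (w u * d v) (w v * d u)) L @ v # filter (\<lambda>u. \<not> ble (w u * d v) (w v * d u)) L"

lemma set_ins: "set (ins v L) = insert v (set L)"
  by (auto simp: ins_def)

lemma distinct_ins: "distinct L \<Longrightarrow> v \<notin> set L \<Longrightarrow> distinct (ins v L)"
  by (auto simp: ins_def)

text \<open>The cross-multiplied order is transitive for positive profits; the zero profits would
  break it. This is why \<open>items\<close> keeps only vertices of positive degree.\<close>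

lemma sorted_ins:
  assumes "sorted_wrt (\<lambda>u v. w u * d v \<le> w v * d u) L" "\<forall>u \<in> set L. 0 < d u" "0 < d v"
  shows "sorted_wrt (\<lambda>u v. w u * d v \<le> w v * d u) (ins v L)"
proof -
  have tr: "w a * d c \<le> w c * d a" if "w a * d b \<le> w b * d a" "w b * d c \<le> w c * d b" "0 < d b" for a b c
  proof -
    have "w a * d b * d c \<le> w b * d a * d c" using that(1) by simp
    also have "\<dots> = w b * d c * d a" by simp
    also have "\<dots> \<le> w c * d b * d a" using that(2) by (intro mult_le_mono1)
    finally have "d b * (w a * d c) \<le> d b * (w c * d a)" by (simp add: ac_simps)
    then show ?thesis using that(3) by simp
  qed
  show ?thesis using assms tr[of _ v]
    by (auto simp: ins_def sorted_wrt_append sorted_wrt_filter ble_def not_le)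
qed

lemma sort_props:
  assumes "distinct vs" "\<forall>v \<in> set vs. 0 < d v"
  shows "set (fold ins vs []) = set vs" "distinct (fold ins vs [])"
    "sorted_wrt (\<lambda>u v. w u * d v \<le> w v * d u) (fold ins vs [])"
proof -
  have "set (fold ins vs L) = set vs \<union> set L \<and> distinct (fold ins vs L) \<and> sorted_wrt (\<lambda>u v. w u * d v \<le> w v * d u) (fold ins vs L)"
    if "distinct (vs @ L)" "\<forall>v \<in> set (vs @ L). 0 < d v" "sorted_wrt (\<lambda>u v. w u * d v \<le> w v * d u) L" for L
    using that
  proof (induction vs arbitrary: L)
    case (Cons v vs)
    have "distinct (vs @ ins v L)" "\<forall>u \<in> set (vs @ ins v L). 0 < d u" "sorted_wrt (\<lambda>u v. w u * d v \<le> w v * d u) (ins v L)"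
      using Cons.prems by (auto simp: set_ins distinct_ins sorted_ins)
    from Cons.IH[OF this] show ?case by (auto simp: set_ins)
  qed simp
  from this[of "[]"] show "set (fold ins vs []) = set vs" "distinct (fold ins vs [])"
    "sorted_wrt (\<lambda>u v. w u * d v \<le> w v * d u) (fold ins vs [])" using assms by auto
qed

end

section \<open>Greedy colouring\<close>

text \<open>Every vertex receives the colour with the least conflicts with the vertices coloured so far, so that
  at most the fraction 1/K of all conflicts is monochromatic.\<close>

locale colouring =
  fixes a :: "nat \<Rightarrow> nat \<Rightarrow> nat" and K :: nat
begin

text \<open>Both orders are counted because \<open>a\<close> need not be symmetric.\<close>

definition cost :: "(nat \<times> nat) list \<Rightarrow> nat \<Rightarrow> nat \<Rightarrow> nat" where
  "cost A v c = (\<Sum>p\<leftarrow>A. if snd p = c then a (fst p) v + a v (fst p) else 0)"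

definition paint :: "nat \<Rightarrow> (nat \<times> nat) list \<Rightarrow> (nat \<times> nat) list" where
  "paint v A = (v, best (\<lambda>c b. cost A v c < cost A v b) 0 [0..<K]) # A"

definition class_of :: "(nat \<times> nat) list \<Rightarrow> nat \<Rightarrow> nat list" where
  "class_of A c = map fst (filter (\<lambda>p. snd p = c) A)"

definition conf :: "nat list \<Rightarrow> nat" where
  "conf T = (\<Sum>u\<leftarrow>T. \<Sum>v\<leftarrow>T. a u v)"

lemma best_le:
  fixes f :: "nat \<Rightarrow> nat"
  shows "f (best (\<lambda>c b. f c < f b) e xs) \<le> f e \<and> (\<forall>c \<in> set xs. f (best (\<lambda>c b. f c < f b) e xs) \<le> f c)"
proof (induction xs arbitrary: e)
  case (Cons x xs)
  show ?case using Cons[of "if f x < f e then x else e"]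
    by (auto simp: best_def split: if_splits)
qed (simp add: best_def)

lemma sum_list_if: "(\<Sum>u\<leftarrow>map fst (filter (\<lambda>p. snd p = c) A). f u) = (\<Sum>p\<leftarrow>A. if snd p = c then f (fst p) else (0::nat))"
  by (induction A) auto

lemma sum_classes:
  assumes "\<forall>p \<in> set A. snd p < K"
  shows "(\<Sum>c<K. \<Sum>u\<leftarrow>class_of A c. f u) = (\<Sum>u\<leftarrow>map fst A. (f u :: nat))"
proof -
  have "(\<Sum>c<K. \<Sum>p\<leftarrow>A. if snd p = c then f (fst p) else 0) = (\<Sum>p\<leftarrow>A. f (fst p))"
    using assms by (induction A) (auto simp: sum.distrib)
  then show ?thesis unfolding class_of_def sum_list_if by (simp add: comp_def)
qed

lemma conf_Cons: "conf (v # T) = conf T + a v v + (\<Sum>u\<leftarrow>T. a u v + a v u)"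
  by (simp add: conf_def sum_list_addf)

text \<open>The costs of the \<open>K\<close> colours for a new vertex add up to all its conflicts
  with earlier vertices, and the cheapest colour costs at most their average.\<close>

lemma paint_bound:
  assumes K: "0 < K" and "\<And>v. a v v = 0"
  shows "(\<forall>p \<in> set (fold paint S []). snd p < K) \<and> map fst (fold paint S []) = rev S \<and>
    K * (\<Sum>c<K. conf (class_of (fold paint S []) c)) \<le> conf (rev S)"
proof (induction S rule: rev_induct)
  case Nil
  then show ?case by (simp add: conf_def class_of_def)
next
  case (snoc v S)
  define A where "A = fold paint S []"
  define c0 where "c0 = best (\<lambda>c b. cost A v c < cost A v b) 0 [0..<K]"
  have IH: "\<forall>p \<in> set A. snd p < K" "map fst A = rev S" "K * (\<Sum>c<K. conf (class_of A c)) \<le> conf (rev S)"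
    using snoc by (auto simp: A_def)
  have A': "fold paint (S @ [v]) [] = (v, c0) # A" by (simp add: A_def paint_def c0_def)
  have c0K: "c0 < K" using best_in[of "\<lambda>c b. cost A v c < cost A v b" 0 "[0..<K]"] K by (auto simp: c0_def)
  have c0min: "cost A v c0 \<le> cost A v c" if "c < K" for c
    using best_le[of "cost A v" 0 "[0..<K]"] that by (simp add: c0_def)
  have cost_class: "cost A v c = (\<Sum>u\<leftarrow>class_of A c. a u v + a v u)" for c
    unfolding cost_def class_of_def sum_list_if ..
  have cl: "class_of ((v, c0) # A) c = (if c = c0 then v # class_of A c else class_of A c)" for c
    by (simp add: class_of_def)
  have "(\<Sum>c<K. conf (class_of ((v, c0) # A) c)) = (\<Sum>c<K. conf (class_of A c) + (if c = c0 then cost A v c0 else 0))"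
    by (intro sum.cong) (auto simp: cl conf_Cons cost_class assms(2))
  also have "\<dots> = (\<Sum>c<K. conf (class_of A c)) + cost A v c0" using c0K by (simp add: sum.distrib)
  finally have m: "(\<Sum>c<K. conf (class_of ((v, c0) # A) c)) = (\<Sum>c<K. conf (class_of A c)) + cost A v c0" .
  have "K * cost A v c0 = (\<Sum>c<K. cost A v c0)" by simp
  also have "\<dots> \<le> (\<Sum>c<K. cost A v c)" using c0min by (intro sum_mono) auto
  also have "\<dots> = (\<Sum>u\<leftarrow>rev S. a u v + a v u)" unfolding cost_class sum_classes[OF IH(1)] IH(2) ..
  finally have "K * cost A v c0 \<le> (\<Sum>u\<leftarrow>rev S. a u v + a v u)" .
  then have "K * (\<Sum>c<K. conf (class_of ((v, c0) # A) c)) \<le> conf (rev (S @ [v]))"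
    using IH(3) by (simp add: m conf_Cons assms(2) algebra_simps)
  then show ?case unfolding A' using IH c0K by simp
qed

end

section \<open>Constraints with exactly one chosen vertex\<close>

locale slots =
  fixes r :: nat and I :: "nat list" and cs :: "nat list list"
begin

definition deg :: "nat \<Rightarrow> nat" where
  "deg v = (\<Sum>e\<leftarrow>cs. \<Sum>i\<leftarrow>I. if nthd 0 e i = v then 1 else 0)"

text \<open>Counts how often \<open>u\<close> in a position of \<open>I\<close> is spoiled by
  \<open>v\<close> in another position of the same constraint.\<close>

definition conflict :: "nat \<Rightarrow> nat \<Rightarrow> nat" where
  "conflict u v = (\<Sum>e\<leftarrow>cs. \<Sum>i\<leftarrow>I. \<Sum>j\<leftarrow>[0..<r]. if j \<noteq> i \<and> nthd 0 e i = u \<and> nthd 0 e j = v then 1 else 0)"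

end

locale valid_slots = slots +
  assumes I: "distinct I" "set I \<subseteq> {..<r}" and cs: "\<And>e. e \<in> set cs \<Longrightarrow> length e = r \<and> distinct e"
begin

definition good :: "nat set \<Rightarrow> nat list \<Rightarrow> bool" where
  "good T e \<longleftrightarrow> (\<exists>i \<in> set I. e ! i \<in> T \<and> (\<forall>j<r. j \<noteq> i \<longrightarrow> e ! j \<notin> T))"

definition hits :: "nat set \<Rightarrow> nat list \<Rightarrow> nat set" where
  "hits T e = {i \<in> set I. e ! i \<in> T}"

definition hit_pairs :: "nat set \<Rightarrow> nat list \<Rightarrow> (nat \<times> nat) set" where
  "hit_pairs T e = {(i, j). i \<in> set I \<and> j < r \<and> j \<noteq> i \<and> e ! i \<in> T \<and> e ! j \<in> T}"

lemma finite_hits: "finite (hits T e)" "finite (hit_pairs T e)"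
proof -
  show "finite (hits T e)" by (simp add: hits_def)
  have "hit_pairs T e \<subseteq> set I \<times> {..<r}" by (auto simp: hit_pairs_def)
  then show "finite (hit_pairs T e)" by (rule finite_subset) simp
qed

lemma sum_list_swap: "(\<Sum>x\<leftarrow>xs. \<Sum>y\<in>A. f x y) = (\<Sum>y\<in>A. \<Sum>x\<leftarrow>xs. (f x y :: nat))"
  by (induction xs) (auto simp: sum.distrib)

lemma sum_list_upt: "(\<Sum>j\<leftarrow>[0..<r]. f j) = (\<Sum>j<r. (f j :: nat))"
  by (simp add: interv_sum_list_conv_sum_set_nat atLeast0LessThan)

lemma sum_deg:
  assumes "distinct T"
  shows "(\<Sum>v\<leftarrow>T. deg v) = (\<Sum>e\<leftarrow>cs. card (hits (set T) e))"
proof -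
  have "(\<Sum>v\<in>set T. \<Sum>i\<leftarrow>I. if nthd 0 e i = v then 1 else 0) = card (hits (set T) e)" if "e \<in> set cs" for e
  proof -
    have "(\<Sum>v\<in>set T. \<Sum>i\<leftarrow>I. if nthd 0 e i = v then 1 else (0::nat)) = (\<Sum>i\<leftarrow>I. \<Sum>v\<in>set T. if nthd 0 e i = v then 1 else 0)"
      by (rule sum_list_swap[symmetric])
    also have "\<dots> = (\<Sum>i\<leftarrow>I. if e ! i \<in> set T then 1 else 0)"
      using cs[OF that] I(2) by (intro arg_cong[where f = sum_list] map_cong) (auto simp: nthd_eq)
    also have "\<dots> = (\<Sum>i\<in>set I. if e ! i \<in> set T then 1 else 0)" using I(1) by (rule sum_list_distinct_conv_sum_set)
    also have "\<dots> = card (hits (set T) e)" by (simp add: hits_def sum.If_cases Int_def)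
    finally show ?thesis .
  qed
  then have "(\<Sum>e\<leftarrow>cs. \<Sum>v\<in>set T. \<Sum>i\<leftarrow>I. if nthd 0 e i = v then 1 else (0::nat)) = (\<Sum>e\<leftarrow>cs. card (hits (set T) e))"
    by (intro arg_cong[where f = sum_list] map_cong) auto
  then show ?thesis unfolding sum_list_swap
    using assms by (simp add: sum_list_distinct_conv_sum_set deg_def)
qed

lemma sum_conflict:
  assumes "distinct T"
  shows "(\<Sum>u\<leftarrow>T. \<Sum>v\<leftarrow>T. conflict u v) = (\<Sum>e\<leftarrow>cs. card (hit_pairs (set T) e))"
proof -
  have "(\<Sum>u\<in>set T. \<Sum>v\<in>set T. \<Sum>i\<leftarrow>I. \<Sum>j\<leftarrow>[0..<r]. if j \<noteq> i \<and> nthd 0 e i = u \<and> nthd 0 e j = v then 1 else 0)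
     = card (hit_pairs (set T) e)" if "e \<in> set cs" for e
  proof -
    have "(\<Sum>u\<in>set T. \<Sum>v\<in>set T. \<Sum>i\<leftarrow>I. \<Sum>j\<leftarrow>[0..<r]. if j \<noteq> i \<and> nthd 0 e i = u \<and> nthd 0 e j = v then 1 else (0::nat))
       = (\<Sum>i\<leftarrow>I. \<Sum>j\<leftarrow>[0..<r]. \<Sum>u\<in>set T. \<Sum>v\<in>set T. if j \<noteq> i \<and> nthd 0 e i = u \<and> nthd 0 e j = v then 1 else 0)"
      by (simp only: sum_list_swap)
    also have "\<dots> = (\<Sum>i\<leftarrow>I. \<Sum>j\<leftarrow>[0..<r]. if j \<noteq> i \<and> e ! i \<in> set T \<and> e ! j \<in> set T then 1 else 0)"
    proof (intro arg_cong[where f = sum_list] map_cong refl)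
      fix i j assume "i \<in> set I" "j \<in> set [0..<r]"
      then have ij: "nthd 0 e i = e ! i" "nthd 0 e j = e ! j" using cs[OF that] I(2) by (auto simp: nthd_eq)
      have "(\<Sum>v\<in>set T. if j \<noteq> i \<and> e ! i = u \<and> e ! j = v then 1 else (0::nat)) = (if e ! i = u then (if j \<noteq> i \<and> e ! j \<in> set T then 1 else 0) else 0)" for u
        by (cases "j \<noteq> i \<and> e ! i = u") auto
      then show "(\<Sum>u\<in>set T. \<Sum>v\<in>set T. if j \<noteq> i \<and> nthd 0 e i = u \<and> nthd 0 e j = v then 1 else 0)
        = (if j \<noteq> i \<and> e ! i \<in> set T \<and> e ! j \<in> set T then 1 else (0::nat))" unfolding ij by simp
    qed
    also have "\<dots> = (\<Sum>i\<in>set I. \<Sum>j<r. if j \<noteq> i \<and> e ! i \<in> set T \<and> e ! j \<in> set T then 1 else 0)"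
      unfolding sum_list_upt using I(1) by (rule sum_list_distinct_conv_sum_set)
    also have "\<dots> = (\<Sum>p\<in>set I \<times> {..<r}. if snd p \<noteq> fst p \<and> e ! fst p \<in> set T \<and> e ! snd p \<in> set T then 1 else 0)"
      by (simp add: sum.cartesian_product case_prod_beta)
    also have "\<dots> = card {p \<in> set I \<times> {..<r}. snd p \<noteq> fst p \<and> e ! fst p \<in> set T \<and> e ! snd p \<in> set T}"
      by (simp add: sum.If_cases Int_def)
    also have "{p \<in> set I \<times> {..<r}. snd p \<noteq> fst p \<and> e ! fst p \<in> set T \<and> e ! snd p \<in> set T} = hit_pairs (set T) e"
      by (auto simp: hit_pairs_def)
    finally show ?thesis .
  qed
  then have "(\<Sum>e\<leftarrow>cs. \<Sum>u\<in>set T. \<Sum>v\<in>set T. \<Sum>i\<leftarrow>I. \<Sum>j\<leftarrow>[0..<r]. if j \<noteq> i \<and> nthd 0 e i = u \<and> nthd 0 e j = v then 1 else 0)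
     = (\<Sum>e\<leftarrow>cs. card (hit_pairs (set T) e))"
    by (intro arg_cong[where f = sum_list] map_cong) auto
  then show ?thesis unfolding sum_list_swap
    using assms by (simp add: sum_list_distinct_conv_sum_set conflict_def)
qed

text \<open>Here the distinctness of the entries of a constraint enters.\<close>

lemma conflict_self: "conflict v v = 0"
proof -
  have "(if j \<noteq> i \<and> nthd 0 e i = v \<and> nthd 0 e j = v then 1 else 0) = (0::nat)" if "e \<in> set cs" "i \<in> set I" "j < r" for e i j
    using cs[OF that(1)] that(2,3) I(2) by (auto simp: nthd_eq nth_eq_iff_index_eq)
  then show ?thesis unfolding conflict_def by (auto simp: sum_list_eq_0_iff)
qed

text \<open>A hit with no other chosen vertex in the constraint is the only hit and makes the
  constraint good. If there is none, pairing each hit with another chosen position injects hits into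
  hit pairs.\<close>

lemma card_hits_le: "card (hits T e) \<le> card (hit_pairs T e) + of_bool (good T e)"
proof (cases "\<exists>i \<in> hits T e. \<forall>j<r. j \<noteq> i \<longrightarrow> e ! j \<notin> T")
  case True
  then obtain i where i: "i \<in> hits T e" "\<forall>j<r. j \<noteq> i \<longrightarrow> e ! j \<notin> T" by blast
  then have "hits T e = {i}" using I(2) by (auto simp: hits_def)
  moreover have "good T e" using i by (auto simp: good_def hits_def)
  ultimately show ?thesis by simp
next
  case False
  then obtain f where f: "\<And>i. i \<in> hits T e \<Longrightarrow> f i < r \<and> f i \<noteq> i \<and> e ! f i \<in> T" by metis
  have "card (hits T e) = card ((\<lambda>i. (i, f i)) ` hits T e)" by (intro card_image[symmetric]) (auto simp: inj_on_def)
  also have "\<dots> \<le> card (hit_pairs T e)" using f by (intro card_mono finite_hits) (auto simp: hits_def hit_pairs_def)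
  finally show ?thesis by simp
qed

lemma card_hit_pairs_le: "card (hit_pairs T e) \<le> r * card (hits T e)"
proof -
  have "hit_pairs T e \<subseteq> hits T e \<times> {..<r}" by (auto simp: hits_def hit_pairs_def)
  then have "card (hit_pairs T e) \<le> card (hits T e \<times> {..<r})" by (intro card_mono) (simp_all add: finite_hits)
  then show ?thesis unfolding card_cartesian_product card_lessThan by (subst mult.commute)
qed

lemma good_count:
  assumes "distinct T"
  shows "(\<Sum>v\<leftarrow>T. deg v) \<le> (\<Sum>u\<leftarrow>T. \<Sum>v\<leftarrow>T. conflict u v) + length (filter (good (set T)) cs)"
proof -
  have "length (filter P xs) = (\<Sum>e\<leftarrow>xs. of_bool (P e))" for P and xs :: "nat list list" by (induction xs) auto
  then show ?thesis unfolding sum_deg[OF assms] sum_conflict[OF assms]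
    by (simp add: sum_list_addf[symmetric] sum_list_mono card_hits_le)
qed

text \<open>A hit has at most \<open>r\<close> partners in its constraint.\<close>

lemma conflict_le_deg:
  assumes "distinct T"
  shows "(\<Sum>u\<leftarrow>T. \<Sum>v\<leftarrow>T. conflict u v) \<le> r * (\<Sum>v\<leftarrow>T. deg v)"
  unfolding sum_deg[OF assms] sum_conflict[OF assms]
  by (simp add: sum_list_const_mult[symmetric] sum_list_mono card_hit_pairs_le)

end

section \<open>The algorithm\<close>

text \<open>As an introduction rule it would match every binary goal and demand a unary computation,
  which weights do not allow. Only its instance for degrees is put back below.\<close>

declare ptime_Bn_unary [pti del]

text \<open>Clears denominators: each numerator is multiplied by the denominators of all other
  weights. In binary the products remain of polynomial size.\<close>

definition iweights :: "(bn \<times> bn) list \<Rightarrow> bn list" where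
  "iweights ws = map (\<lambda>v. Bn (unbn (fst (nthd (Bn 0, Bn 0) ws v)) *
     (\<Prod>j\<leftarrow>[0..<length ws]. if j = v then 1 else unbn (snd (nthd (Bn 0, Bn 0) ws j))))) [0..<length ws]"

definition wof :: "bn list \<Rightarrow> nat \<Rightarrow> nat" where "wof wl v = unbn (nthd (Bn 0) wl v)"

text \<open>With this budget, relative weight at most \<open>c / q\<close> becomes the integer
  condition that \<open>q\<close> times the weight is at most the budget.\<close>

definition budget_of :: "nat \<Rightarrow> bn list \<Rightarrow> nat" where "budget_of c wl = c * (\<Sum>b\<leftarrow>wl. unbn b)"

text \<open>Vertices that are affordable on their own, so that each is also a feasible solution by
  itself.\<close>

definition items :: "nat \<Rightarrow> nat \<Rightarrow> nat list \<Rightarrow> bn list \<Rightarrow> nat list list \<Rightarrow> nat list" where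
  "items c q I wl cs = filter (\<lambda>v. ble (q * wof wl v) (budget_of c wl) \<and> 0 < slots.deg I cs v) [0..<length wl]"

definition ordered :: "nat \<Rightarrow> nat \<Rightarrow> nat list \<Rightarrow> bn list \<Rightarrow> nat list list \<Rightarrow> nat list" where
  "ordered c q I wl cs = fold (knapsack.ins (wof wl) (slots.deg I cs)) (items c q I wl cs) []"

definition chosen :: "nat \<Rightarrow> nat \<Rightarrow> nat list \<Rightarrow> bn list \<Rightarrow> nat list list \<Rightarrow> nat list" where
  "chosen c q I wl cs = fold (knapsack.pick (wof wl) q (budget_of c wl)) (ordered c q I wl cs) []"

definition painted :: "nat \<Rightarrow> nat \<Rightarrow> nat \<Rightarrow> nat list \<Rightarrow> bn list \<Rightarrow> nat list list \<Rightarrow> (nat \<times> nat) list" where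
  "painted r c q I wl cs = fold (colouring.paint (slots.conflict r I cs) (2 * r)) (chosen c q I wl cs) []"

text \<open>The colour classes handle the greedy solution, the single vertices the item at which it
  overflows.\<close>

definition candidates :: "nat \<Rightarrow> nat \<Rightarrow> nat \<Rightarrow> nat list \<Rightarrow> bn list \<Rightarrow> nat list list \<Rightarrow> nat list list" where
  "candidates r c q I wl cs = map (colouring.class_of (painted r c q I wl cs)) [0..<2 * r] @ map (\<lambda>v. [v]) (items c q I wl cs)"

text \<open>\<open>A\<close> is the table of accepted strings, so the score is the exact number of
  satisfied constraints, whichever string satisfies them.\<close>

definition score :: "nat \<Rightarrow> bool list set \<Rightarrow> nat list list \<Rightarrow> nat list \<Rightarrow> nat" where
  "score r A cs T = length (filter (\<lambda>e. map (\<lambda>t. \<exists>v \<in> set T. v = nthd 0 e t) [0..<r] \<in> A) cs)"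

definition winner :: "nat \<Rightarrow> bool list set \<Rightarrow> nat \<Rightarrow> nat \<Rightarrow> nat list \<Rightarrow> bn list \<Rightarrow> nat list list \<Rightarrow> nat list" where
  "winner r A c q I wl cs = best (\<lambda>T T'. score r A cs T' < score r A cs T) [] (candidates r c q I wl cs)"

definition algorithm :: "nat \<Rightarrow> bool list set \<Rightarrow> nat \<Rightarrow> nat \<Rightarrow> nat list \<Rightarrow> bool list \<Rightarrow> bool list" where
  "algorithm r A c q I x = map (\<lambda>i. \<exists>v \<in> set (winner r A c q I (iweights (parse_w x)) (parse_c r x)). v = i) [0..<parse_n x]"

lemma ptime_iweights [pti]: "ptime ws \<Longrightarrow> ptime (\<lambda>e. iweights (ws e))"
  unfolding iweights_def by (intro pti ptime_compose_fst)

lemma ptime_wof [pti]: "ptime wl \<Longrightarrow> ptime v \<Longrightarrow> ptime (\<lambda>e. Bn (wof (wl e) (v e)))"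
  unfolding wof_def by (intro pti)

lemma ptime_budget_of [pti]: "ptime wl \<Longrightarrow> ptime (\<lambda>e. Bn (budget_of c (wl e)))"
  unfolding budget_of_def by (intro pti)

lemma ptime_deg [pti]: "ptime cs \<Longrightarrow> ptime v \<Longrightarrow> ptime (\<lambda>e. slots.deg I (cs e) (v e))"
  unfolding slots.deg_def by (intro pti ptime_compose_fst)

lemma ptime_conflict [pti]: "ptime cs \<Longrightarrow> ptime u \<Longrightarrow> ptime v \<Longrightarrow> ptime (\<lambda>e. slots.conflict r I (cs e) (u e) (v e))"
  unfolding slots.conflict_def by (intro pti ptime_compose_fst)

lemmas ptime_Bn_deg [pti] = ptime_Bn_unary[OF ptime_deg]

lemma ptime_items [pti]: "ptime wl \<Longrightarrow> ptime cs \<Longrightarrow> ptime (\<lambda>e. items c q I (wl e) (cs e))"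
  unfolding items_def by (intro pti ptime_compose_fst)

lemma ptime_fold_elem:
  assumes "ptime l" "ptime i" "ptime (\<lambda>p. g (fst p) (fst (snd p)) (snd (snd p)))"
    and bnd: "\<And>e a s. esize (g e a s) \<le> esize s + esize a + k"
  shows "ptime (\<lambda>e. fold (g e) (l e) (i e))"
proof -
  obtain q where q: "\<And>e. esize (l e) \<le> poly (q :: nat poly) (esize e)" using ptime_size[OF assms(1)] by blast
  show ?thesis
  proof (rule ptime_fold_additive[OF assms(1-3)])
    fix e a s assume "a \<in> set (l e)"
    then have "esize a \<le> poly q (esize e)" using esize_in_list[of a "l e"] q[of e] by linarith
    then show "esize (g e a s) \<le> esize s + poly (q + [:k:]) (esize e)" using bnd[of e a s] by simp
  qed
qed

lemma esize_partition: "esize (filter P L) + esize (filter (\<lambda>x. \<not> P x) L) = esize L + 1"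
  by (induction L) auto

lemma ptime_ordered [pti]:
  assumes "ptime wl" "ptime cs" shows "ptime (\<lambda>e. ordered c q I (wl e) (cs e))"
  unfolding ordered_def
proof (rule ptime_fold_elem[where k = 1])
  show "ptime (\<lambda>p. knapsack.ins (wof (wl (fst p))) (slots.deg I (cs (fst p))) (fst (snd p)) (snd (snd p)))"
    unfolding knapsack.ins_def by (intro pti ptime_compose_fst assms)
  fix e v L
  show "esize (knapsack.ins (wof (wl e)) (slots.deg I (cs e)) v L) \<le> esize L + esize v + 1"
    using esize_partition[of "\<lambda>u. ble (wof (wl e) u * slots.deg I (cs e) v) (wof (wl e) v * slots.deg I (cs e) u)" L]
      esize_append[of "filter (\<lambda>u. ble (wof (wl e) u * slots.deg I (cs e) v) (wof (wl e) v * slots.deg I (cs e) u)) L"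
        "v # filter (\<lambda>u. \<not> ble (wof (wl e) u * slots.deg I (cs e) v) (wof (wl e) v * slots.deg I (cs e) u)) L"]
    by (simp add: knapsack.ins_def)
qed (intro pti assms)+

lemma ptime_chosen [pti]:
  assumes "ptime wl" "ptime cs" shows "ptime (\<lambda>e. chosen c q I (wl e) (cs e))"
  unfolding chosen_def
proof (rule ptime_fold_elem[where k = 1])
  show "ptime (\<lambda>p. knapsack.pick (wof (wl (fst p))) q (budget_of c (wl (fst p))) (fst (snd p)) (snd (snd p)))"
    unfolding knapsack.pick_def by (intro pti ptime_compose_fst assms)
  fix e v L
  show "esize (knapsack.pick (wof (wl e)) q (budget_of c (wl e)) v L) \<le> esize L + esize v + 1"
    by (simp add: knapsack.pick_def)
qed (intro pti assms)+

lemma ptime_cost: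
  assumes "ptime cs" "ptime A" "ptime v" "ptime k"
  shows "ptime (\<lambda>e. colouring.cost (slots.conflict r I (cs e)) (A e) (v e) (k e))"
  unfolding colouring.cost_def by (intro pti ptime_compose_fst assms)

lemma ptime_painted [pti]:
  assumes "ptime wl" "ptime cs" shows "ptime (\<lambda>e. painted r c q I (wl e) (cs e))"
  unfolding painted_def
\<comment> \<open>The unary code of a colour has size at most \<open>4 * r + 1\<close>; the pair and
  the list cell add one each.\<close>
proof (rule ptime_fold_elem[where k = "4 * r + 3"])
  show "ptime (\<lambda>p. colouring.paint (slots.conflict r I (cs (fst p))) (2 * r) (fst (snd p)) (snd (snd p)))"
    unfolding colouring.paint_def by (intro pti ptime_best ptime_cost ptime_compose_fst assms)
  fix e v A
  let ?a = "slots.conflict r I (cs e)"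
  let ?b = "best (\<lambda>c b. colouring.cost ?a A v c < colouring.cost ?a A v b) 0 [0..<2 * r]"
  have "?b \<in> insert 0 (set [0..<2 * r])" by (rule best_in)
  then show "esize (colouring.paint ?a (2 * r) v A) \<le> esize A + esize v + (4 * r + 3)"
    by (auto simp: colouring.paint_def esize_nat simp del: enc_nat.simps)
qed (intro pti assms)+

lemma ptime_candidates [pti]: "ptime wl \<Longrightarrow> ptime cs \<Longrightarrow> ptime (\<lambda>e. candidates r c q I (wl e) (cs e))"
  unfolding candidates_def colouring.class_of_def by (intro pti ptime_compose_fst)

lemma ptime_score:
  assumes "finite A" "ptime cs" "ptime T" shows "ptime (\<lambda>e. score r A (cs e) (T e))"
  unfolding score_def by (intro pti ptime_member_finite[OF assms(1)] ptime_compose_fst assms)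

lemma ptime_winner:
  assumes "finite A" "ptime wl" "ptime cs" shows "ptime (\<lambda>e. winner r A c q I (wl e) (cs e))"
  unfolding winner_def by (intro pti ptime_best ptime_score ptime_compose_fst assms)

lemma ptime_algorithm: "finite A \<Longrightarrow> ptime (algorithm r A c q I)"
  unfolding algorithm_def[abs_def] by (intro pti ptime_winner ptime_compose_fst)

section \<open>The approximation factor\<close>

definition iweight :: "csp \<Rightarrow> nat \<Rightarrow> nat" where
  "iweight \<Psi> v = nat (fst (quotient_of (weight \<Psi> v))) *
     (\<Prod>j<num_vertices \<Psi>. if j = v then 1 else nat (snd (quotient_of (weight \<Psi> j))))"

lemma iweights_parse:
  assumes "csp_instance r \<Psi>" "1 \<le> r"
  shows "iweights (parse_w (encode_csp \<Psi>)) = map (\<lambda>v. Bn (iweight \<Psi> v)) [0..<num_vertices \<Psi>]"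
proof -
  have "(\<Prod>j\<leftarrow>[0..<n]. f j) = (\<Prod>j<n. (f j :: nat))" for f n by (induction n) auto
  moreover have "(\<Prod>j<n. if j = v then 1 else unbn (snd (nthd z (map (\<lambda>i. (Bn (a i), Bn (b i))) [0..<n]) j))) = (\<Prod>j<n. if j = v then 1 else b j)"
    for n v z a b by (intro prod.cong) (auto simp: nthd_eq)
  ultimately show ?thesis
    by (simp add: iweights_def parse_w_encode[OF assms] iweight_def nthd_eq)
qed

text \<open>Integer weights are the given ones times the product \<open>D\<close> of all
  denominators, which cancels in the quotient.\<close>

lemma relative_weight_iweight:
  assumes "csp_instance r \<Psi>"
  shows "relative_weight \<Psi> \<sigma> = real (\<Sum>v | v < num_vertices \<Psi> \<and> \<sigma> ! v. iweight \<Psi> v) / real (\<Sum>v<num_vertices \<Psi>. iweight \<Psi> v)"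
    and "0 < (\<Sum>v<num_vertices \<Psi>. iweight \<Psi> v)"
proof -
  let ?n = "num_vertices \<Psi>"
  define den where "den = (\<lambda>j. nat (snd (quotient_of (weight \<Psi> j))))"
  define D where "D = (\<Prod>j<?n. den j)"
  have den: "0 < den j" for j using quotient_of_denom_pos'[of "weight \<Psi> j"] by (simp add: den_def)
  have D: "0 < D" using den by (simp add: D_def prod_pos)
  have iw: "real (iweight \<Psi> v) = of_rat (weight \<Psi> v) * real D" if "v < ?n" for v
  proof -
    have "0 \<le> weight \<Psi> v" using assms that by (simp add: csp_instance_def)
    obtain a b where ab: "quotient_of (weight \<Psi> v) = (a, b)" by fastforce
    have b: "0 < b" using quotient_of_denom_pos[OF ab] .
    have w: "weight \<Psi> v = of_int a / of_int b" by (rule quotient_of_div[OF ab])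
    have "0 \<le> a" using \<open>0 \<le> weight \<Psi> v\<close> b unfolding w by (simp add: zero_le_divide_iff)
    have "D = den v * (\<Prod>j\<in>{..<?n} - {v}. den j)" unfolding D_def using that by (simp add: prod.remove)
    also have "(\<Prod>j\<in>{..<?n} - {v}. den j) = (\<Prod>j<?n. if j = v then 1 else den j)"
      using that by (subst prod.remove[of "{..<?n}" v]) (auto intro: prod.cong)
    finally have "real D = real_of_int b * real (\<Prod>j<?n. if j = v then 1 else den j)"
      using b by (simp add: den_def ab)
    moreover have "iweight \<Psi> v = nat a * (\<Prod>j<?n. if j = v then 1 else den j)"
      by (simp add: iweight_def ab den_def cong: if_cong)
    then have "real (iweight \<Psi> v) = real_of_int a * real (\<Prod>j<?n. if j = v then 1 else den j)"
      using \<open>0 \<le> a\<close> by (simp only: of_nat_mult of_nat_nat of_int_of_nat_eq)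
    moreover have "(of_rat (weight \<Psi> v) :: real) = real_of_int a / real_of_int b" by (simp add: w of_rat_divide)
    ultimately show ?thesis using b by simp
  qed
  have s: "real (\<Sum>v\<in>T. iweight \<Psi> v) = (\<Sum>v\<in>T. of_rat (weight \<Psi> v)) * real D" if "T \<subseteq> {..<?n}" for T
  proof -
    have "real (\<Sum>v\<in>T. iweight \<Psi> v) = (\<Sum>v\<in>T. of_rat (weight \<Psi> v) * real D)"
      unfolding of_nat_sum using that iw by (intro sum.cong) auto
    then show ?thesis by (simp add: sum_distrib_right)
  qed
  have "{v. v < ?n \<and> \<sigma> ! v} \<subseteq> {..<?n}" by auto
  from s[OF this] s[OF order_refl] D
  show "relative_weight \<Psi> \<sigma> = real (\<Sum>v | v < ?n \<and> \<sigma> ! v. iweight \<Psi> v) / real (\<Sum>v<?n. iweight \<Psi> v)"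
    by (simp add: relative_weight_def)
  have "(0::real) < of_rat (\<Sum>v<?n. weight \<Psi> v)" using assms by (simp add: csp_instance_def)
  then have "0 < real (\<Sum>v<?n. iweight \<Psi> v)" unfolding s[OF order_refl] using D by (simp add: of_rat_sum)
  then show "0 < (\<Sum>v<?n. iweight \<Psi> v)" by (simp only: of_nat_0_less_iff)
qed

lemma best_max:
  fixes f :: "'a \<Rightarrow> nat"
  shows "f d \<le> f (best (\<lambda>x y. f y < f x) d xs) \<and> (\<forall>c \<in> set xs. f c \<le> f (best (\<lambda>x y. f y < f x) d xs))"
proof (induction xs arbitrary: d)
  case (Cons x xs)
  show ?case using Cons[of "if f d < f x then x else d"] by (auto simp: best_def split: if_splits)
qed (simp add: best_def)

definition unit_string :: "nat \<Rightarrow> nat \<Rightarrow> bool list" where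
  "unit_string r i = map (\<lambda>t. t = i) [0..<r]"

text \<open>Descent on the size of the support.\<close>

lemma exists_minimal_accepted:
  "length x = r \<Longrightarrow> \<psi> x \<Longrightarrow> \<exists>y \<in> minimal_accepted r \<psi>. supp y \<subseteq> supp x"
proof (induction "card (supp x)" arbitrary: x rule: less_induct)
  case less
  show ?case
  proof (cases "x \<in> minimal_accepted r \<psi>")
    case False
    then obtain y where y: "length y = r" "\<psi> y" "supp y \<subseteq> supp x" "y \<noteq> x"
      using less.prems by (auto simp: minimal_accepted_def)
    have "supp y \<noteq> supp x"
    proof
      assume "supp y = supp x"
      then have "y = x" using y(1) less.prems(1) by (intro nth_equalityI) (auto simp: supp_def set_eq_iff)
      then show False using y(4) by simp
    qed
    moreover have "finite (supp x)" by (simp add: supp_def)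
    ultimately have "card (supp y) < card (supp x)" using y(3) by (intro psubset_card_mono) auto
    from less.hyps[OF this y(1,2)] show ?thesis using y(3) by blast
  qed auto
qed

theorem algorithm_correct:
  fixes \<psi> :: "bool list \<Rightarrow> bool" and \<mu> :: real
  assumes r: "1 \<le> r" and min1: "minimal_accepted r \<psi> \<subseteq> weight_at_most_one r" and zero: "\<not> \<psi> (replicate r False)"
    and q: "0 < q" and \<mu>: "0 \<le> \<mu>" "\<mu> \<le> real c / real q"
    and inst: "csp_instance r \<Psi>"
  defines "I \<equiv> filter (\<lambda>i. \<psi> (unit_string r i)) [0..<r]"
  defines "\<tau> \<equiv> algorithm r {x. length x = r \<and> \<psi> x} c q I (encode_csp \<Psi>)"
  shows "\<tau> \<in> labelings \<Psi>" "relative_weight \<Psi> \<tau> \<le> real c / real q"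
    "labeling_value \<psi> \<Psi> \<tau> \<ge> 1 / real (4 * r + 1) * biased_value \<psi> \<mu> \<Psi>"
proof -
  define n where "n = num_vertices \<Psi>"
  define cs where "cs = constraints \<Psi>"
  define W where "W = iweight \<Psi>"
  define wl where "wl = map (\<lambda>v. Bn (W v)) [0..<n]"
  define A where "A = {x. length x = r \<and> \<psi> x}"
  define out where "out = winner r A c q I wl cs"
  have wl: "iweights (parse_w (encode_csp \<Psi>)) = wl" using iweights_parse[OF inst r] by (simp add: wl_def n_def W_def)
  have \<tau>: "\<tau> = map (\<lambda>i. \<exists>v \<in> set out. v = i) [0..<n]"
    unfolding \<tau>_def algorithm_def parse_n_encode[OF inst r] parse_c_encode[OF inst r] wl out_def A_def n_def cs_def ..
  have e: "length e = r" "distinct e" "set e \<subseteq> {..<n}" if "e \<in> set cs" for e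
    using inst that by (auto simp: csp_instance_def cs_def n_def)
  interpret valid_slots r I cs by unfold_locales (auto simp: I_def e)
  have wof: "wof wl v = W v" if "v < n" for v using that by (simp add: wof_def wl_def nthd_eq)
  define B where "B = budget_of c wl"
  have B: "B = c * (\<Sum>v<n. W v)"
    by (simp add: B_def budget_of_def wl_def comp_def interv_sum_list_conv_sum_set_nat atLeast0LessThan)
  interpret knapsack "wof wl" deg q B .
  interpret colouring conflict "2 * r" .
  define vs where "vs = items c q I wl cs"
  have vs: "set vs = {v. v < n \<and> q * W v \<le> B \<and> 0 < deg v}" "distinct vs"
    by (auto simp: vs_def items_def wl_def ble_def B_def wof[unfolded wl_def])
  define L where "L = fold ins vs []"
  have L: "set L = set vs" "distinct L" "sorted_wrt (\<lambda>u v. wof wl u * deg v \<le> wof wl v * deg u) L"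
    unfolding L_def using sort_props[of vs] vs by auto
  define G where "G = fold pick L []"
  have G: "distinct G" "set G \<subseteq> set vs" "q * (\<Sum>u\<leftarrow>G. wof wl u) \<le> B"
    using pick_distinct[of L "[]"] pick_set[of L "[]"] pick_weight[of "[]" L] L by (auto simp: G_def)
  define AA where "AA = fold paint G []"
  have cand: "candidates r c q I wl cs = map (class_of AA) [0..<2 * r] @ map (\<lambda>v. [v]) vs"
    by (simp add: candidates_def painted_def chosen_def ordered_def AA_def G_def L_def vs_def B_def)
  have r2: "0 < 2 * r" using r by simp
  have P: "\<forall>p \<in> set AA. snd p < 2 * r" "map fst AA = rev G" "2 * r * (\<Sum>k<2 * r. conf (class_of AA k)) \<le> conf (rev G)"
    using paint_bound[OF r2 conflict_self, of G] by (auto simp: AA_def)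
  have dist_class: "distinct (class_of AA k)" "set (class_of AA k) \<subseteq> set G" for k
  proof -
    have "distinct (map fst AA)" using P(2) G(1) by simp
    then show "distinct (class_of AA k)" unfolding class_of_def by (rule distinct_map_filter)
    have "set (class_of AA k) \<subseteq> set (map fst AA)" by (auto simp: class_of_def)
    then show "set (class_of AA k) \<subseteq> set G" using P(2) by simp
  qed
  define s where "s = score r A cs out"
  have best: "score r A cs T \<le> s" if "T \<in> set (candidates r c q I wl cs)" for T
    using best_max[of "score r A cs" "[]" "candidates r c q I wl cs"] that by (simp add: s_def out_def winner_def)
  have bits: "map (\<lambda>t. \<exists>v \<in> set T. v = nthd 0 e' t) [0..<r] = map (\<lambda>i. i \<in> set T) e'" if "e' \<in> set cs" for T e'
    using e[OF that] by (intro nth_equalityI) (auto simp: nthd_eq)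
  have score_good: "length (filter (good (set T)) cs) \<le> score r A cs T" for T
  proof -
    have "map (\<lambda>i. i \<in> set T) e' \<in> A" if "e' \<in> set cs" and gd: "good (set T) e'" for e'
    proof -
      obtain i where i: "i \<in> set I" "e' ! i \<in> set T" "\<forall>j<r. j \<noteq> i \<longrightarrow> e' ! j \<notin> set T"
        using gd by (auto simp: good_def)
      have "map (\<lambda>i. i \<in> set T) e' = unit_string r i"
        using i e[OF that(1)] by (intro nth_equalityI) (auto simp: unit_string_def)
      then show ?thesis using i(1) by (auto simp: A_def I_def unit_string_def)
    qed
    then have "filter (\<lambda>e'. good (set T) e' \<and> map (\<lambda>i. i \<in> set T) e' \<in> A) cs = filter (good (set T)) cs"
      by (intro filter_cong) auto
    moreover have "length (filter (\<lambda>e'. P e' \<and> Q' e') l) \<le> length (filter Q' l)" for P Q' and l :: "nat list list"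
      by (induction l) auto
    moreover have "score r A cs T = length (filter (\<lambda>e'. map (\<lambda>i. i \<in> set T) e' \<in> A) cs)"
      unfolding score_def using bits by (intro arg_cong[where f = length] filter_cong) auto
    ultimately show ?thesis by metis
  qed
  \<comment> \<open>A vertex alone has no conflicts, so all constraints that it hits are
    good.\<close>
  have single: "deg v \<le> s" if "v \<in> set vs" for v
  proof -
    have "deg v \<le> length (filter (good (set [v])) cs)" using good_count[of "[v]"] conflict_self by simp
    also have "\<dots> \<le> score r A cs [v]" by (rule score_good)
    also have "\<dots> \<le> s" using that by (intro best) (simp add: cand)
    finally show ?thesis .
  qed
  have DG: "(\<Sum>v\<leftarrow>G. deg v) \<le> 4 * r * s"
  proof -
    \<comment> \<open>Conflicts number at most \<open>r * ?D\<close>, and \<open>2 * r\<close>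
      colours leave at most half of \<open>?D\<close> monochromatic. The other half comes from good
      constraints, at most \<open>s\<close> in each class.\<close>
    let ?D = "\<Sum>v\<leftarrow>G. deg v" and ?C = "\<Sum>k<2 * r. conf (class_of AA k)"
    have revG: "(\<Sum>v\<leftarrow>rev G. deg v) = ?D" by (simp add: rev_map[symmetric])
    have "?D = (\<Sum>k<2 * r. \<Sum>v\<leftarrow>class_of AA k. deg v)" unfolding sum_classes[OF P(1)] P(2) revG ..
    also have "\<dots> \<le> (\<Sum>k<2 * r. conf (class_of AA k) + s)"
    proof (rule sum_mono)
      fix k assume "k \<in> {..<2 * r}"
      then have "class_of AA k \<in> set (candidates r c q I wl cs)" by (auto simp: cand)
      from best[OF this] score_good[of "class_of AA k"] good_count[OF dist_class(1), of k]
      show "(\<Sum>v\<leftarrow>class_of AA k. deg v) \<le> conf (class_of AA k) + s" by (simp add: conf_def)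
    qed
    also have "\<dots> = ?C + 2 * r * s" by (simp add: sum.distrib)
    finally have 1: "?D \<le> ?C + 2 * r * s" .
    have "2 * r * ?C \<le> conf (rev G)" by (rule P(3))
    also have "\<dots> \<le> r * ?D" using conflict_le_deg[of "rev G"] G(1) revG by (simp add: conf_def)
    finally have "r * (2 * ?C) \<le> r * ?D" by simp
    then have "2 * ?C \<le> ?D" using r by simp
    then show ?thesis using 1 by simp
  qed
  show lab: "\<tau> \<in> labelings \<Psi>" by (simp add: labelings_def \<tau> n_def)
  have \<tau>n: "\<tau> ! v \<longleftrightarrow> v \<in> set out" if "v < n" for v using that by (simp add: \<tau>)
  have feas: "q * (\<Sum>v\<in>set out. W v) \<le> B \<and> set out \<subseteq> {..<n}"
  proof -
    have "out \<in> insert [] (set (candidates r c q I wl cs))"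
      unfolding out_def winner_def by (rule best_in)
    then consider "out = []" | k where "out = class_of AA k" | v where "v \<in> set vs" "out = [v]"
      by (auto simp: cand)
    then show ?thesis
    proof cases
      case 2
      have sub: "set out \<subseteq> set G" using dist_class(2) 2 by simp
      have Gn: "set G \<subseteq> {..<n}" using G(2) vs(1) by auto
      have "(\<Sum>v\<in>set out. W v) \<le> (\<Sum>v\<in>set G. W v)" using sub by (intro sum_mono2) auto
      also have "\<dots> = (\<Sum>v\<in>set G. wof wl v)" using Gn wof by (intro sum.cong) auto
      also have "\<dots> = (\<Sum>u\<leftarrow>G. wof wl u)" using G(1) by (simp add: sum_list_distinct_conv_sum_set)
      finally have "q * (\<Sum>v\<in>set out. W v) \<le> q * (\<Sum>u\<leftarrow>G. wof wl u)" by simp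
      then have "q * (\<Sum>v\<in>set out. W v) \<le> B" using G(3) by (rule order_trans)
      then show ?thesis using sub Gn by auto
    qed (use vs(1) in auto)
  qed
  have Wpos: "0 < (\<Sum>v<n. W v)" using relative_weight_iweight(2)[OF inst] by (simp add: W_def n_def)
  have rw: "relative_weight \<Psi> \<sigma> = real (\<Sum>v | v < n \<and> \<sigma> ! v. W v) / real (\<Sum>v<n. W v)" for \<sigma>
    using relative_weight_iweight(1)[OF inst] by (simp add: W_def n_def)
  have cmp: "real x / real (\<Sum>v<n. W v) \<le> real c / real q \<longleftrightarrow> q * x \<le> B" for x
  proof -
    have gen: "(u / y \<le> v / z) = (z * u \<le> v * y)" if "0 < y" "0 < z" for u v y z :: real
      using that by (simp add: field_simps)
    have "real x / real (\<Sum>v<n. W v) \<le> real c / real q \<longleftrightarrow> real q * real x \<le> real c * real (\<Sum>v<n. W v)"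
      by (rule gen) (use Wpos q in \<open>simp_all only: of_nat_0_less_iff\<close>)
    also have "\<dots> \<longleftrightarrow> q * x \<le> B" unfolding B of_nat_mult[symmetric] of_nat_le_iff ..
    finally show ?thesis .
  qed
  have "{v. v < n \<and> \<tau> ! v} = set out" using feas \<tau>n by auto
  then show "relative_weight \<Psi> \<tau> \<le> real c / real q" using feas unfolding rw cmp by simp
  obtain \<sigma> where \<sigma>: "\<sigma> \<in> labelings \<Psi>" "relative_weight \<Psi> \<sigma> \<le> \<mu>" "biased_value \<psi> \<mu> \<Psi> = labeling_value \<psi> \<Psi> \<sigma>"
    using biased_value_attained[OF \<mu>(1)] by blast
  define S where "S = {v. v < n \<and> \<sigma> ! v}"
  define T where "T = filter (\<lambda>v. \<sigma> ! v) [0..<n]"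
  have ST: "set T = S" "distinct T" by (auto simp: S_def T_def)
  have "relative_weight \<Psi> \<sigma> \<le> real c / real q" using \<sigma>(2) \<mu>(2) by linarith
  then have SB: "q * (\<Sum>v\<in>S. W v) \<le> B" unfolding rw S_def[symmetric] cmp .
  \<comment> \<open>Below a satisfying string lies a minimal one. It has weight at most 1 and is not
    the zero string, so it is a unit string at a position of \<open>I\<close>.\<close>
  have sat: "1 \<le> card (hits S e')" if "e' \<in> set cs" "\<psi> (map (\<lambda>i. \<sigma> ! i) e')" for e'
  proof -
    let ?y = "map (\<lambda>i. \<sigma> ! i) e'"
    have "length ?y = r" using e[OF that(1)] by simp
    from exists_minimal_accepted[where \<psi> = \<psi>, OF this that(2)]
    obtain z where z: "z \<in> minimal_accepted r \<psi>" "supp z \<subseteq> supp ?y" by blast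
    have lz: "length z = r" "\<psi> z" using z(1) by (auto simp: minimal_accepted_def)
    have "card (supp z) \<le> 1" using z(1) min1 by (auto simp: weight_at_most_one_def)
    moreover have "supp z \<noteq> {}"
    proof
      assume "supp z = {}"
      then have "z = replicate r False" using lz by (intro nth_equalityI) (auto simp: supp_def)
      then show False using lz zero by simp
    qed
    moreover have "finite (supp z)" by (simp add: supp_def)
    ultimately obtain i where i: "supp z = {i}" by (metis card_1_singletonE card_0_eq le_antisym less_one linorder_not_le)
    then have "z = unit_string r i" using lz by (intro nth_equalityI) (auto simp: supp_def unit_string_def set_eq_iff)
    moreover have ir: "i < r" using i lz by (auto simp: supp_def)
    ultimately have "i \<in> set I" using lz by (simp add: I_def)
    moreover have "e' ! i \<in> S"
    proof -
      have "i \<in> supp ?y" using i z(2) by simp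
      then have "\<sigma> ! (e' ! i)" using e[OF that(1)] ir by (auto simp: supp_def)
      moreover have "e' ! i \<in> set e'" using e(1)[OF that(1)] ir by simp
      then have "e' ! i < n" using e(3)[OF that(1)] by auto
      ultimately show ?thesis by (simp add: S_def)
    qed
    ultimately have "i \<in> hits S e'" by (simp add: hits_def)
    then show ?thesis using finite_hits(1)[of S e'] by (metis One_nat_def Suc_leI card_gt_0_iff empty_iff)
  qed
  have cnt: "length (filter P' l) \<le> (\<Sum>e\<leftarrow>l. f e)" if "\<And>e. e \<in> set l \<Longrightarrow> P' e \<Longrightarrow> 1 \<le> (f e :: nat)"
    for P' f and l :: "nat list list"
    using that
  proof (induction l)
    case (Cons b l)
    then have "length (filter P' l) \<le> (\<Sum>e\<leftarrow>l. f e)" "P' b \<Longrightarrow> 1 \<le> f b" by simp_all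
    then show ?case by (cases "P' b") simp_all
  qed simp
  have "length (filter (\<lambda>e'. \<psi> (map (\<lambda>i. \<sigma> ! i) e')) cs) \<le> (\<Sum>e'\<leftarrow>cs. card (hits S e'))"
    by (rule cnt[OF sat])
  also have "\<dots> = (\<Sum>v\<leftarrow>T. deg v)" using sum_deg[OF ST(2)] ST(1) by simp
  also have "\<dots> = (\<Sum>v\<in>S. deg v)" using ST by (simp add: sum_list_distinct_conv_sum_set)
  \<comment> \<open>The knapsack items have positive degree, and nothing is lost by dropping the
    others.\<close>
  also have "\<dots> = (\<Sum>v\<in>{v \<in> S. 0 < deg v}. deg v)" by (intro sum.mono_neutral_right) (auto simp: S_def)
  also have "\<dots> \<le> (4 * r + 1) * s"
  proof -
    have finS: "finite S" by (simp add: S_def)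
    have le: "(\<Sum>v\<in>U. W v) \<le> (\<Sum>v\<in>S. W v)" if "U \<subseteq> S" for U using that finS by (intro sum_mono2) auto
    have leB: "q * (\<Sum>v\<in>U. W v) \<le> B" if "U \<subseteq> S" for U
      using mult_le_mono2[OF le[OF that], of q] SB by linarith
    have sub: "{v \<in> S. 0 < deg v} \<subseteq> set L"
    proof
      fix v assume v: "v \<in> {v \<in> S. 0 < deg v}"
      then show "v \<in> set L" using leB[of "{v}"] by (auto simp: L vs S_def)
    qed
    have "(\<Sum>v\<in>{v \<in> S. 0 < deg v}. wof wl v) = (\<Sum>v\<in>{v \<in> S. 0 < deg v}. W v)"
      by (intro sum.cong) (auto simp: S_def wof)
    then have "q * (\<Sum>v\<in>{v \<in> S. 0 < deg v}. wof wl v) \<le> B" using leB[of "{v \<in> S. 0 < deg v}"] by auto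
    from greedy_bound[OF L(3,2) sub this]
    have "(\<Sum>v\<in>{v \<in> S. 0 < deg v}. deg v) \<le> (\<Sum>v\<leftarrow>G. deg v) + s"
      using single L(1) unfolding G_def by fastforce
    then show ?thesis using DG by simp
  qed
  finally have fin: "length (filter (\<lambda>e'. \<psi> (map (\<lambda>i. \<sigma> ! i) e')) cs) \<le> (4 * r + 1) * s" .
  have "s = length (filter (\<lambda>e'. \<psi> (map (\<lambda>i. \<tau> ! i) e')) cs)"
    unfolding s_def score_def
  proof (intro arg_cong[where f = length] filter_cong refl)
    fix e' assume e': "e' \<in> set cs"
    have eq: "map (\<lambda>i. i \<in> set out) e' = map (\<lambda>i. \<tau> ! i) e'" using e(3)[OF e'] \<tau>n by auto
    show "(map (\<lambda>t. \<exists>v \<in> set out. v = nthd 0 e' t) [0..<r] \<in> A) = \<psi> (map (\<lambda>i. \<tau> ! i) e')"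
      unfolding bits[OF e'] eq using e(1)[OF e'] by (simp add: A_def)
  qed
  then have v\<tau>: "labeling_value \<psi> \<Psi> \<tau> = real s / real (length cs)" by (simp add: labeling_value_def cs_def)
  have "biased_value \<psi> \<mu> \<Psi> = real (length (filter (\<lambda>e'. \<psi> (map (\<lambda>i. \<sigma> ! i) e')) cs)) / real (length cs)"
    using \<sigma>(3) by (simp add: labeling_value_def cs_def)
  also have "\<dots> \<le> real ((4 * r + 1) * s) / real (length cs)" using fin by (intro divide_right_mono) (auto simp del: of_nat_mult of_nat_add)
  finally have "biased_value \<psi> \<mu> \<Psi> \<le> real (4 * r + 1) * labeling_value \<psi> \<Psi> \<tau>"
    unfolding v\<tau> of_nat_mult times_divide_eq_right .
  then show "1 / real (4 * r + 1) * biased_value \<psi> \<mu> \<Psi> \<le> labeling_value \<psi> \<Psi> \<tau>"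
    by (simp add: divide_le_eq mult.commute del: of_nat_add of_nat_mult)
qed

lemma constant_factor:
  assumes r: "1 \<le> r" and min1: "minimal_accepted r \<psi> \<subseteq> weight_at_most_one r" and \<mu>: "0 < \<mu>"
  shows "achievable_factor r \<psi> \<mu> (1 / real (4 * r + 1))"
proof (cases "\<psi> (replicate r False)")
  case True
  show ?thesis
  proof (rule achievable_by_zero[OF r])
    fix \<Psi> assume inst: "csp_instance r \<Psi>"
    let ?z = "replicate (num_vertices \<Psi>) False"
    have le1: "labeling_value \<psi> \<Psi> \<sigma> \<le> 1" for \<sigma>
    proof -
      have "real (length (filter (\<lambda>e. \<psi> (map (\<lambda>i. \<sigma> ! i) e)) (constraints \<Psi>))) \<le> real (length (constraints \<Psi>))"
        by simp
      then show ?thesis unfolding labeling_value_def by (rule divide_le_eq_1[THEN iffD2, OF disjI1, OF conjI, rotated])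
          (use inst in \<open>simp add: csp_instance_def\<close>)
    qed
    have "map (\<lambda>i. ?z ! i) e = replicate r False" if "e \<in> set (constraints \<Psi>)" for e
    proof -
      have e: "length e = r" "set e \<subseteq> {..<num_vertices \<Psi>}" using inst that by (auto simp: csp_instance_def)
      have "map (\<lambda>i. ?z ! i) e = map (\<lambda>i. False) e" using e(2) by (intro map_cong) auto
      then show ?thesis using e(1) by (simp add: map_replicate_const)
    qed
    then have "filter (\<lambda>e. \<psi> (map (\<lambda>i. ?z ! i) e)) (constraints \<Psi>) = constraints \<Psi>"
      using True by (intro filter_True) auto
    then have v: "labeling_value \<psi> \<Psi> ?z = 1" using inst by (simp add: labeling_value_def csp_instance_def)
    obtain \<sigma> where "biased_value \<psi> \<mu> \<Psi> = labeling_value \<psi> \<Psi> \<sigma>"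
      using biased_value_attained[of \<mu>] \<mu> by (metis less_imp_le)
    then have "biased_value \<psi> \<mu> \<Psi> \<le> 1" using le1 by simp
    then have "1 / real (4 * r + 1) * biased_value \<psi> \<mu> \<Psi> \<le> 1 / real (4 * r + 1) * 1"
      by (intro mult_left_mono) auto
    also have "\<dots> \<le> 1" by simp
    finally show "1 / real (4 * r + 1) * biased_value \<psi> \<mu> \<Psi> \<le> labeling_value \<psi> \<Psi> ?z" using v by simp
  qed (use \<mu> in simp)
next
  case False
  show ?thesis unfolding achievable_factor_def
  proof (intro allI impI)
    fix \<eta> :: real assume "0 < \<eta>"
    then have "\<mu> < \<mu> * (1 + \<eta>)" using \<mu> by simp
    \<comment> \<open>The slack leaves room for a rational bias, whose numerator and denominator are
      wired into the algorithm.\<close>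
    then obtain \<theta> where \<theta>: "\<theta> \<in> \<rat>" "\<mu> < \<theta>" "\<theta> < \<mu> * (1 + \<eta>)" using Rats_dense_in_real by blast
    then have "\<bar>\<theta>\<bar> = \<theta>" using \<mu> by simp
    then obtain c q :: nat where cq: "q \<noteq> 0" "\<theta> = real c / real q" using Rats_abs_nat_div_natE[OF \<theta>(1)] by metis
    let ?A = "{x. length x = r \<and> \<psi> x}" and ?I = "filter (\<lambda>i. \<psi> (unit_string r i)) [0..<r]"
    have fin: "finite ?A" using finite_lists_length_eq[of "UNIV :: bool set" r] by (auto intro: finite_subset)
    have qc: "0 < q" "0 \<le> \<mu>" "\<mu> \<le> real c / real q" using cq \<theta> \<mu> by auto
    note correct = algorithm_correct[OF r min1 False qc]
    show "\<exists>f. poly_time f \<and> (\<forall>\<Psi>. csp_instance r \<Psi> \<longrightarrow> f (encode_csp \<Psi>) \<in> labelings \<Psi> \<and>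
        relative_weight \<Psi> (f (encode_csp \<Psi>)) \<le> \<mu> * (1 + \<eta>) \<and>
        1 / real (4 * r + 1) * biased_value \<psi> \<mu> \<Psi> \<le> labeling_value \<psi> \<Psi> (f (encode_csp \<Psi>)))"
    proof (intro exI conjI allI impI)
      show "poly_time (algorithm r ?A c q ?I)" by (rule ptime_imp_poly_time[OF ptime_algorithm[OF fin]])
      fix \<Psi> assume inst: "csp_instance r \<Psi>"
      show "algorithm r ?A c q ?I (encode_csp \<Psi>) \<in> labelings \<Psi>"
        "1 / real (4 * r + 1) * biased_value \<psi> \<mu> \<Psi> \<le> labeling_value \<psi> \<Psi> (algorithm r ?A c q ?I (encode_csp \<Psi>))"
        by (rule correct[OF inst])+
      show "relative_weight \<Psi> (algorithm r ?A c q ?I (encode_csp \<Psi>)) \<le> \<mu> * (1 + \<eta>)"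
        using correct(2)[OF inst] cq \<theta>(3) by linarith
    qed
  qed
qed

theorem theorem1p1:
  fixes r :: nat and \<psi> :: "bool list \<Rightarrow> bool"
  assumes "class_P \<noteq> class_NP"
    and "SSEH"
    and "r \<ge> 1"
  shows "bias_independent r \<psi> \<longleftrightarrow> minimal_accepted r \<psi> \<subseteq> weight_at_most_one r"
proof
  let ?M = "{0<..<1 / 2} :: real set"
  assume "bias_independent r \<psi>"
  then obtain c where c: "0 < c" "(INF \<mu>\<in>?M. approx_factor r \<psi> \<mu>) = c" by (auto simp: bias_independent_def)
  have bdd: "bdd_below (approx_factor r \<psi> ` ?M)"
    using approx_factor_nonneg[OF assms(3)] by (intro bdd_belowI[of _ 0]) auto
  \<comment> \<open>Half of the infimum is strictly below every supremum, so it is achieved for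
    every bias.\<close>
  have ach: "achievable_factor r \<psi> \<mu> (c / 2)" if "0 < \<mu>" "\<mu> < 1 / 2" for \<mu>
  proof (rule achievable_below[OF assms(3)])
    have "c \<le> approx_factor r \<psi> \<mu>" unfolding c(2)[symmetric] using that by (intro cINF_lower[OF bdd]) auto
    then show "c / 2 < approx_factor r \<psi> \<mu>" using c(1) by simp
  qed (use that in simp)
  show "minimal_accepted r \<psi> \<subseteq> weight_at_most_one r"
  proof
    fix x assume x: "x \<in> minimal_accepted r \<psi>"
    show "x \<in> weight_at_most_one r"
    proof (rule ccontr)
      assume "x \<notin> weight_at_most_one r"
      then have "\<not> card (supp x) \<le> 1" using x by (auto simp: weight_at_most_one_def minimal_accepted_def)
      moreover have "finite (supp x)" by (simp add: supp_def)
      ultimately obtain p q where "p \<in> supp x" "q \<in> supp x" "p \<noteq> q"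
        using card_le_Suc0_iff_eq[of "supp x"] by auto
      with x interpret reduction r \<psi> x p q by unfold_locales
      have "class_NP \<subseteq> class_P" using hardness[OF assms(2) _ ach] c(1) by simp
      then show False using P_subset_NP assms(1) by blast
    qed
  qed
next
  let ?M = "{0<..<1 / 2} :: real set"
  assume min1: "minimal_accepted r \<psi> \<subseteq> weight_at_most_one r"
  have "1 / real (4 * r + 1) \<le> approx_factor r \<psi> \<mu>" if "\<mu> \<in> ?M" for \<mu>
    using that by (intro approx_factor_ge constant_factor[OF assms(3) min1]) auto
  then have "1 / real (4 * r + 1) \<le> (INF \<mu>\<in>?M. approx_factor r \<psi> \<mu>)"
    by (intro cINF_greatest) auto
  moreover have "0 < 1 / real (4 * r + 1)" by simp
  ultimately show "bias_independent r \<psi>" unfolding bias_independent_def by (metis less_le_trans)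
qed

end
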